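(* Let $\Sigma\subseteq\mathbb{R}^{n+1}$ be an orientable $C^{\infty}$ hypersurface with $\partial\Sigma=\emptyset$. Suppose there exists $\lambda\in\mathbb{R}$ such that $H(x)=\langle x,N(x)\rangle+\lambda$ for all $x\in\Sigma$. Let $p=\int_{\Sigma}\gamma_{n}(x)dx$. Then there exist $v,w\in S^{n}$ such that, with $m=\frac{1}{p}\int_{\Sigma}\langle v,N(y)\rangle\langle w,N(y)\rangle\gamma_{n}(y)dy$, $$(n+1)^{2}\int_{\Sigma}(\langle v,N\rangle\langle w,N\rangle-m)\,L(\langle v,N\rangle\langle w,N\rangle-m)\,\gamma_{n}(x)dx$$ $$\geq\frac{1}{p^{2}}\int_{\Sigma\times\Sigma\times\Sigma}\big(1-\|A_{x}\|^{2}-2\|A_{y}\|_{2\to 2}^{2}\big)\,\|\Pi_{y}(N(z))\|^{2}\,\gamma_{n}(x)\gamma_{n}(y)\gamma_{n}(z)\,dx\,dy\,dz.$$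
   Context: $\gamma_{n}(x)=(2\pi)^{-n/2}e^{-\|x\|^{2}/2}$ for $x\in\mathbb{R}^{n+1}$; $S^{n}$ is the unit sphere in $\mathbb{R}^{n+1}$. $N$ is the unit normal of $\Sigma$; for a local orthonormal tangent frame $e_{1},\dots,e_{n}$ and $\nabla$ the Euclidean connection, $H=\operatorname{div}(N)=\sum_{i}\langle\nabla_{e_{i}}N,e_{i}\rangle$ is the mean curvature, $A=(a_{ij})$ with $a_{ij}=\langle\nabla_{e_{i}}e_{j},N\rangle$ is the second fundamental form ($A_{x}$ its value at $x$), $\|A\|^{2}=\sum_{i,j}a_{ij}^{2}$, and $\|A_{y}\|_{2\to2}$ is the $\ell_{2}$ operator norm of $A_{y}$. $\Pi_{y}$ is the orthogonal projection of $\mathbb{R}^{n+1}$ onto the tangent space of $\Sigma$ at $y$ (so $\|\Pi_{y}u\|^{2}=\|u\|^{2}-\langle N(y),u\rangle^{2}$). For $f\in C^{\infty}(\Sigma)$, $Lf(x)=\Delta f(x)-\langle x,\nabla f(x)\rangle+\|A_{x}\|^{2}f(x)+f(x)$, with $\Delta,\nabla$ the Laplacian and gradient of $\Sigma$. Integrals over $\Sigma$ are with respect to $n$-dimensional surface measure. *)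

theory Defs
  imports "HOL-Analysis.Analysis"
begin

section \<open>Hausdorff measure\<close>

text \<open>The contribution of a bounded set to the d-dimensional Hausdorff measure, normalised so that
  the d-dimensional Hausdorff measure on a d-dimensional Euclidean space is Lebesgue measure.  The
  empty set is singled out because \<open>0 ^ 0 = 1\<close>.\<close>

definition hausdorff_gauge :: "nat \<Rightarrow> 'a::metric_space set \<Rightarrow> ennreal" where
  "hausdorff_gauge d C =
    (if C = {} then 0 else ennreal (unit_ball_vol (real d) * (diameter C / 2) ^ d))"

definition hausdorff_covers :: "real \<Rightarrow> 'a::metric_space set \<Rightarrow> (nat \<Rightarrow> 'a set) set" where
  "hausdorff_covers \<delta> E = {C. E \<subseteq> (\<Union>i. C i) \<and> (\<forall>i. bounded (C i) \<and> diameter (C i) \<le> \<delta>)}"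

definition hausdorff_pre :: "nat \<Rightarrow> real \<Rightarrow> 'a::metric_space set \<Rightarrow> ennreal" where
  "hausdorff_pre d \<delta> E = (INF C\<in>hausdorff_covers \<delta> E. \<Sum>i. hausdorff_gauge d (C i))"

definition hausdorff_outer :: "nat \<Rightarrow> 'a::metric_space set \<Rightarrow> ennreal" where
  "hausdorff_outer d E = (SUP \<delta>\<in>{0<..}. hausdorff_pre d \<delta> E)"

definition hausdorff_measure :: "nat \<Rightarrow> 'a::metric_space measure" where
  "hausdorff_measure d = measure_of UNIV (sets borel) (hausdorff_outer d)"

text \<open>\<^const>\<open>measure_of\<close> yields the zero measure unless its argument is countably additive; the rest of
  this section shows, by Caratheodory's criterion for metric outer measures, that this is the case.\<close>

lemma hausdorff_gauge_empty [simp]: "hausdorff_gauge d {} = 0"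
  by (simp add: hausdorff_gauge_def)

lemma hausdorff_pre_lower: "C \<in> hausdorff_covers \<delta> E \<Longrightarrow> hausdorff_pre d \<delta> E \<le> (\<Sum>i. hausdorff_gauge d (C i))"
  unfolding hausdorff_pre_def by (rule INF_lower)

lemma hausdorff_pre_empty: "0 < \<delta> \<Longrightarrow> hausdorff_pre d \<delta> {} = 0"
  using hausdorff_pre_lower[of "\<lambda>_. {}" \<delta> "{}" d] by (simp add: hausdorff_covers_def)

lemma hausdorff_pre_mono: "A \<subseteq> B \<Longrightarrow> hausdorff_pre d \<delta> A \<le> hausdorff_pre d \<delta> B"
  unfolding hausdorff_pre_def by (rule INF_superset_mono) (auto simp: hausdorff_covers_def)

lemma hausdorff_pre_antimono: "\<delta> \<le> \<delta>' \<Longrightarrow> hausdorff_pre d \<delta>' A \<le> hausdorff_pre d \<delta> A"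
  unfolding hausdorff_pre_def
  by (rule INF_superset_mono) (auto simp: hausdorff_covers_def intro: order_trans)

lemma hausdorff_pre_subadditive:
  "hausdorff_pre d \<delta> (\<Union>i. A i) \<le> (\<Sum>i. hausdorff_pre d \<delta> (A (i::nat)))"
proof (cases "\<exists>i. hausdorff_pre d \<delta> (A i) = \<infinity>")
  case True
  then obtain i where "hausdorff_pre d \<delta> (A i) = \<infinity>" by blast
  then have "(\<Sum>i. hausdorff_pre d \<delta> (A i)) = \<infinity>"
    by (metis ennreal_suminf_lessD infinity_ennreal_def top.not_eq_extremum less_irrefl)
  then show ?thesis by simp
next
  case False
  show ?thesis
  proof (rule ennreal_le_epsilon)
    fix e :: real assume e: "0 < e"
    have "\<exists>C\<in>hausdorff_covers \<delta> (A i). (\<Sum>j. hausdorff_gauge d (C j))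
            \<le> hausdorff_pre d \<delta> (A i) + ennreal (e * (1/2) ^ Suc i)" for i
    proof -
      have "hausdorff_pre d \<delta> (A i) < hausdorff_pre d \<delta> (A i) + ennreal (e * (1/2) ^ Suc i)"
        using False e ennreal_add_left_cancel_less[of "hausdorff_pre d \<delta> (A i)" 0]
        by (simp add: less_top)
      then show ?thesis
        unfolding hausdorff_pre_def INF_less_iff by (auto intro: less_imp_le)
    qed
    then obtain C where C: "\<And>i. C i \<in> hausdorff_covers \<delta> (A i)"
      and le: "\<And>i. (\<Sum>j. hausdorff_gauge d (C i j))
            \<le> hausdorff_pre d \<delta> (A i) + ennreal (e * (1/2) ^ Suc i)" by metis
    define D where "D k = (case prod_decode k of (i, j) \<Rightarrow> C i j)" for k
    have "D \<in> hausdorff_covers \<delta> (\<Union>i. A i)"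
    proof -
      have "x \<in> (\<Union>k. D k)" if "x \<in> A i" for x i
      proof -
        have "x \<in> (\<Union>j. C i j)" using C[of i] that by (auto simp: hausdorff_covers_def)
        then obtain j where "x \<in> C i j" by blast
        then have "x \<in> D (prod_encode (i, j))" by (simp add: D_def)
        then show ?thesis by blast
      qed
      then show ?thesis using C
        by (auto simp: hausdorff_covers_def D_def split: prod.split)
    qed
    then have "hausdorff_pre d \<delta> (\<Union>i. A i) \<le> (\<Sum>k. hausdorff_gauge d (D k))"
      by (rule hausdorff_pre_lower)
    also have "\<dots> = (\<Sum>i. \<Sum>j. hausdorff_gauge d (C i j))"
      using suminf_ennreal_2dimen[of "\<lambda>i. \<Sum>j. hausdorff_gauge d (C i j)" "\<lambda>(i, j). hausdorff_gauge d (C i j)"]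
      by (simp add: D_def o_def case_prod_beta)
    also have "\<dots> \<le> (\<Sum>i. hausdorff_pre d \<delta> (A i) + ennreal (e * (1/2) ^ Suc i))"
      using le by (intro suminf_le) auto
    also have "\<dots> = (\<Sum>i. hausdorff_pre d \<delta> (A i)) + (\<Sum>i. ennreal (e * (1/2) ^ Suc i))"
      by (rule suminf_add[symmetric]) auto
    also have "(\<Sum>i. ennreal (e * (1/2) ^ Suc i)) = ennreal e"
      using e sums_mult[OF power_half_series, of e] by (intro suminf_ennreal_eq) auto
    finally show "hausdorff_pre d \<delta> (\<Union>i. A i) \<le> (\<Sum>i. hausdorff_pre d \<delta> (A i)) + ennreal e" .
  qed
qed

lemma hausdorff_outer_mono: "A \<subseteq> B \<Longrightarrow> hausdorff_outer d A \<le> hausdorff_outer d B"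
  unfolding hausdorff_outer_def by (intro SUP_mono) (auto intro: hausdorff_pre_mono)

lemma hausdorff_outer_empty [simp]: "hausdorff_outer d {} = 0"
  unfolding hausdorff_outer_def
  by (intro antisym SUP_least) (auto simp: hausdorff_pre_empty)

lemma hausdorff_outer_UN: "hausdorff_outer d (\<Union>i. A i) \<le> (\<Sum>i. hausdorff_outer d (A (i::nat)))"
  unfolding hausdorff_outer_def[of d "\<Union>i. A i"]
proof (rule SUP_least)
  fix \<delta> :: real assume "\<delta> \<in> {0<..}"
  then have "(\<Sum>i. hausdorff_pre d \<delta> (A i)) \<le> (\<Sum>i. hausdorff_outer d (A i))"
    by (intro suminf_le) (auto simp: hausdorff_outer_def intro!: SUP_upper)
  then show "hausdorff_pre d \<delta> (\<Union>i. A i) \<le> (\<Sum>i. hausdorff_outer d (A i))"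
    using hausdorff_pre_subadditive[of d \<delta> A] by (rule order_trans[rotated])
qed

lemma hausdorff_outer_measure_space: "outer_measure_space UNIV (hausdorff_outer d)"
  unfolding outer_measure_space_def positive_def increasing_def countably_subadditive_def
  by (auto intro: hausdorff_outer_mono hausdorff_outer_UN)

lemma hausdorff_outer_Un: "hausdorff_outer d (A \<union> B) \<le> hausdorff_outer d A + hausdorff_outer d B"
proof -
  have "hausdorff_outer d (\<Union>i. binaryset A B i) \<le> (\<Sum>i. hausdorff_outer d (binaryset A B i))"
    by (rule hausdorff_outer_UN)
  then show ?thesis
    using suminf_binaryset_eq[of "hausdorff_outer d" A B] by (simp add: UN_binaryset_eq)
qed

lemma hausdorff_pre_separated:
  assumes "0 < \<delta>" "\<delta> < s" and sep: "\<And>x y. x \<in> A \<Longrightarrow> y \<in> B \<Longrightarrow> s \<le> dist x y"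
  shows "hausdorff_pre d \<delta> A + hausdorff_pre d \<delta> B \<le> hausdorff_pre d \<delta> (A \<union> B)"
  unfolding hausdorff_pre_def[of d \<delta> "A \<union> B"]
proof (rule INF_greatest)
  fix C assume C: "C \<in> hausdorff_covers \<delta> (A \<union> B)"
  define CA where "CA i = (if C i \<inter> A \<noteq> {} then C i else {})" for i
  define CB where "CB i = (if C i \<inter> A = {} then C i else {})" for i
  have "CA \<in> hausdorff_covers \<delta> A"
    using C \<open>0 < \<delta>\<close> by (fastforce simp: hausdorff_covers_def CA_def)
  moreover have "CB \<in> hausdorff_covers \<delta> B"
  proof -
    have "C i \<inter> A = {}" if "y \<in> B" "y \<in> C i" for y i
    proof (rule ccontr)
      assume "C i \<inter> A \<noteq> {}"
      then obtain x where x: "x \<in> C i" "x \<in> A" by blast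
      have "dist x y \<le> diameter (C i)"
        using C x that by (intro diameter_bounded_bound) (auto simp: hausdorff_covers_def)
      also have "\<dots> \<le> \<delta>" using C by (auto simp: hausdorff_covers_def)
      finally show False using sep[OF x(2) that(1)] \<open>\<delta> < s\<close> by simp
    qed
    then show ?thesis
      using C \<open>0 < \<delta>\<close> by (fastforce simp: hausdorff_covers_def CB_def)
  qed
  ultimately have "hausdorff_pre d \<delta> A + hausdorff_pre d \<delta> B
      \<le> (\<Sum>i. hausdorff_gauge d (CA i)) + (\<Sum>i. hausdorff_gauge d (CB i))"
    by (intro add_mono hausdorff_pre_lower)
  also have "\<dots> = (\<Sum>i. hausdorff_gauge d (CA i) + hausdorff_gauge d (CB i))"
    by (rule suminf_add) auto
  also have "\<dots> = (\<Sum>i. hausdorff_gauge d (C i))"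
    by (intro suminf_cong) (simp add: CA_def CB_def)
  finally show "hausdorff_pre d \<delta> A + hausdorff_pre d \<delta> B \<le> (\<Sum>i. hausdorff_gauge d (C i))" .
qed

lemma hausdorff_outer_separated:
  assumes "0 < s" and sep: "\<And>x y. x \<in> A \<Longrightarrow> y \<in> B \<Longrightarrow> s \<le> dist x y"
  shows "hausdorff_outer d A + hausdorff_outer d B \<le> hausdorff_outer d (A \<union> B)"
proof -
  have "hausdorff_outer d A + hausdorff_outer d B
      = (SUP \<delta>\<in>{0<..}. hausdorff_pre d \<delta> A + hausdorff_pre d \<delta> B)"
    unfolding hausdorff_outer_def
  proof (rule SUP_add_directed_ennreal[symmetric])
    fix i j :: real assume "i \<in> {0<..}" "j \<in> {0<..}"
    then show "\<exists>k\<in>{0<..}. hausdorff_pre d i A + hausdorff_pre d j B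
        \<le> hausdorff_pre d k A + hausdorff_pre d k B"
      by (intro bexI[of _ "min i j"] add_mono hausdorff_pre_antimono) auto
  qed
  also have "\<dots> \<le> hausdorff_outer d (A \<union> B)"
  proof (rule SUP_least)
    fix \<delta> :: real assume \<delta>: "\<delta> \<in> {0<..}"
    define \<eta> where "\<eta> = min \<delta> (s / 2)"
    have \<eta>: "0 < \<eta>" "\<eta> < s" "\<eta> \<le> \<delta>" using \<delta> \<open>0 < s\<close> by (auto simp: \<eta>_def)
    have "hausdorff_pre d \<delta> A + hausdorff_pre d \<delta> B \<le> hausdorff_pre d \<eta> A + hausdorff_pre d \<eta> B"
      using \<eta> by (intro add_mono hausdorff_pre_antimono)
    also have "\<dots> \<le> hausdorff_pre d \<eta> (A \<union> B)"
      using \<eta> sep by (intro hausdorff_pre_separated) auto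
    also have "\<dots> \<le> hausdorff_outer d (A \<union> B)"
      unfolding hausdorff_outer_def using \<eta> by (intro SUP_upper) auto
    finally show "hausdorff_pre d \<delta> A + hausdorff_pre d \<delta> B \<le> hausdorff_outer d (A \<union> B)" .
  qed
  finally show ?thesis .
qed

lemma hausdorff_outer_layers:
  assumes sep: "\<And>i j x y. i + 2 \<le> j \<Longrightarrow> x \<in> R i \<Longrightarrow> y \<in> R j \<Longrightarrow> s i \<le> dist x y"
    and s: "\<And>i. 0 < s i" and R: "\<And>i. R i \<subseteq> T"
  shows "(\<Sum>i. hausdorff_outer d (R (i::nat))) \<le> 2 * hausdorff_outer d T"
proof -
  have part: "(\<Sum>i<n. hausdorff_outer d (R (2 * i + r))) \<le> hausdorff_outer d (\<Union>i<n. R (2 * i + r))" for n r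
  proof (induction n)
    case (Suc n)
    define t where "t = Min (insert 1 ((\<lambda>i. s (2 * i + r)) ` {..<n}))"
    have "0 < t" unfolding t_def using s by (subst Min_gr_iff) auto
    have t: "t \<le> s (2 * i + r)" if "i < n" for i unfolding t_def using that by (intro Min_le) auto
    have "(\<Sum>i<Suc n. hausdorff_outer d (R (2 * i + r)))
        \<le> hausdorff_outer d (\<Union>i<n. R (2 * i + r)) + hausdorff_outer d (R (2 * n + r))"
      using Suc by (simp add: add_right_mono)
    also have "\<dots> \<le> hausdorff_outer d ((\<Union>i<n. R (2 * i + r)) \<union> R (2 * n + r))"
    proof (rule hausdorff_outer_separated[OF \<open>0 < t\<close>])
      fix x y assume "x \<in> (\<Union>i<n. R (2 * i + r))" and y: "y \<in> R (2 * n + r)"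
      then obtain i where i: "i < n" "x \<in> R (2 * i + r)" by blast
      then have "s (2 * i + r) \<le> dist x y" using y by (intro sep) auto
      with t[OF i(1)] show "t \<le> dist x y" by simp
    qed
    also have "(\<Union>i<n. R (2 * i + r)) \<union> R (2 * n + r) = (\<Union>i<Suc n. R (2 * i + r))"
      by (auto simp: less_Suc_eq)
    finally show ?case .
  qed simp
  have part_le: "(\<Sum>i<n. hausdorff_outer d (R (2 * i + r))) \<le> hausdorff_outer d T" for n r
    using part by (rule order_trans) (use R in \<open>auto intro!: hausdorff_outer_mono\<close>)
  have "(\<Sum>i<n. hausdorff_outer d (R i)) \<le> 2 * hausdorff_outer d T" for n
  proof -
    have "(\<Sum>i<n. hausdorff_outer d (R i)) \<le> (\<Sum>i<2 * n. hausdorff_outer d (R i))"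
      by (intro sum_mono2) auto
    also have "\<dots> = (\<Sum>i<n. hausdorff_outer d (R (2 * i + 0))) + (\<Sum>i<n. hausdorff_outer d (R (2 * i + 1)))"
      by (induction n) (auto simp: ac_simps)
    also have "\<dots> \<le> hausdorff_outer d T + hausdorff_outer d T"
      by (intro add_mono part_le)
    finally show ?thesis by (simp add: mult_2)
  qed
  then show ?thesis by (intro suminf_le_const) auto
qed

lemma hausdorff_outer_closed:
  assumes "closed F"
  shows "hausdorff_outer d (T \<inter> F) + hausdorff_outer d (T - F) \<le> hausdorff_outer d T"
proof (cases "F = {} \<or> hausdorff_outer d T = top")
  case False
  then have F: "F \<noteq> {}" and fin: "hausdorff_outer d T < top"
    by (auto simp: top.not_eq_extremum)
  define A where "A k = {x \<in> T. 1 / (real k + 1) \<le> infdist x F}" for k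
  define R where "R k = {x \<in> T. 1 / (real k + 2) \<le> infdist x F \<and> infdist x F < 1 / (real k + 1)}" for k
  define s where "s k = 1 / (real k + 2) - 1 / (real k + 3)" for k
  have "(\<Sum>i. hausdorff_outer d (R i)) \<le> 2 * hausdorff_outer d T"
  proof (rule hausdorff_outer_layers)
    fix i j x y assume ij: "i + 2 \<le> j" and x: "x \<in> R i" and y: "y \<in> R j"
    have "1 / (real j + 1) \<le> 1 / (real i + 3)" using ij by (intro divide_left_mono) auto
    then show "s i \<le> dist x y"
      using x y infdist_triangle[of x F y] by (auto simp: R_def s_def)
  next
    show "0 < s i" for i
      unfolding s_def using divide_strict_left_mono[of "real i + 2" "real i + 3" 1] by simp
    show "R i \<subseteq> T" for i by (auto simp: R_def)
  qed
  also have "\<dots> < top" using fin by (simp add: ennreal_mult_less_top)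
  finally have sum_fin: "(\<Sum>i. hausdorff_outer d (R i)) < top" .
  have R_fin: "hausdorff_outer d (R i) < top" for i
    using fin by (rule le_less_trans[rotated]) (auto simp: R_def intro: hausdorff_outer_mono)
  define f where "f i = enn2real (hausdorff_outer d (R i))" for i
  have f: "hausdorff_outer d (R i) = ennreal (f i)" and f0: "0 \<le> f i" for i
    using R_fin[of i] by (auto simp: f_def)
  have f_summable: "summable f"
    using sum_fin f0 by (intro summable_suminf_not_top) (auto simp: f)
  show ?thesis
  proof (rule ennreal_le_epsilon)
    fix e :: real assume "0 < e"
    then obtain k where k: "norm (\<Sum>i. f (i + k)) < e"
      using suminf_exist_split[OF _ f_summable] by blast
    have tail: "(\<Sum>i. hausdorff_outer d (R (i + k))) \<le> ennreal e"
    proof -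
      have "(\<Sum>i. hausdorff_outer d (R (i + k))) = ennreal (\<Sum>i. f (i + k))"
        unfolding f using f0 f_summable by (intro suminf_ennreal2) (auto simp: summable_iff_shift)
      also have "\<dots> \<le> ennreal e" using k by (intro ennreal_leI) auto
      finally show ?thesis .
    qed
    have cover: "T - F \<subseteq> A k \<union> (\<Union>i. R (i + k))"
    proof
      fix x assume x: "x \<in> T - F"
      have "infdist x F > 0"
        using in_closed_iff_infdist_zero[OF assms F, of x] x infdist_nonneg[of x F] by auto
      then obtain n where "1 / (real n + 1) < infdist x F"
        using reals_Archimedean[of "infdist x F"] by (auto simp: inverse_eq_divide add.commute)
      then have ex: "\<exists>n. 1 / (real n + 1) \<le> infdist x F" by (auto intro: less_imp_le)
      define m where "m = (LEAST n. 1 / (real n + 1) \<le> infdist x F)"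
      have m: "1 / (real m + 1) \<le> infdist x F" unfolding m_def using ex by (rule LeastI_ex)
      show "x \<in> A k \<union> (\<Union>i. R (i + k))"
      proof (cases "m \<le> k")
        case True
        then have "1 / (real k + 1) \<le> 1 / (real m + 1)" by (intro divide_left_mono) auto
        with m x show ?thesis by (auto simp: A_def)
      next
        case False
        then obtain i where i: "m = Suc (i + k)" by (metis not_le less_iff_Suc_add add.commute)
        have "\<not> 1 / (real (i + k) + 1) \<le> infdist x F"
          using not_less_Least[of "i + k" "\<lambda>n. 1 / (real n + 1) \<le> infdist x F"] i by (simp add: m_def)
        with m x have "x \<in> R (i + k)" by (auto simp: R_def i ac_simps)
        then show ?thesis by blast
      qed
    qed
    have "hausdorff_outer d (T - F) \<le> hausdorff_outer d (A k) + (\<Sum>i. hausdorff_outer d (R (i + k)))"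
      by (rule order_trans[OF hausdorff_outer_mono[OF cover]],
          rule order_trans[OF hausdorff_outer_Un add_left_mono[OF hausdorff_outer_UN]])
    also have "\<dots> \<le> hausdorff_outer d (A k) + ennreal e"
      using tail by (rule add_left_mono)
    finally have "hausdorff_outer d (T \<inter> F) + hausdorff_outer d (T - F)
        \<le> (hausdorff_outer d (T \<inter> F) + hausdorff_outer d (A k)) + ennreal e"
      by (simp add: add_left_mono add.assoc)
    also have "\<dots> \<le> hausdorff_outer d ((T \<inter> F) \<union> A k) + ennreal e"
    proof (intro add_right_mono hausdorff_outer_separated)
      show "0 < 1 / (real k + 1)" by simp
      fix x y assume "x \<in> T \<inter> F" "y \<in> A k"
      then show "1 / (real k + 1) \<le> dist x y"
        using infdist_le[of x F y] by (auto simp: A_def dist_commute)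
    qed
    also have "\<dots> \<le> hausdorff_outer d T + ennreal e"
      by (intro add_right_mono hausdorff_outer_mono) (auto simp: A_def)
    finally show "hausdorff_outer d (T \<inter> F) + hausdorff_outer d (T - F)
        \<le> hausdorff_outer d T + ennreal e" .
  qed
next
  case True
  then show ?thesis
  proof
    assume "F = {}"
    then show ?thesis by simp
  next
    assume "hausdorff_outer d T = top"
    then show ?thesis by simp
  qed
qed

proposition measure_space_hausdorff_outer:
  "measure_space UNIV (sets borel) (hausdorff_outer d :: 'a::metric_space set \<Rightarrow> ennreal)"
proof -
  let ?L = "lambda_system UNIV UNIV (hausdorff_outer d :: 'a set \<Rightarrow> ennreal)"
  interpret U: sigma_algebra "UNIV :: 'a set" UNIV
    using sigma_algebra_Pow[of UNIV] by simp
  have L: "measure_space UNIV ?L (hausdorff_outer d)"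
    using hausdorff_outer_measure_space by (rule U.caratheodory_lemma)
  then interpret L: sigma_algebra UNIV ?L by (simp add: measure_space_def)
  have "F \<in> ?L" if "closed F" for F
    unfolding U.lambda_system_eq
  proof (safe intro!: antisym)
    fix T :: "'a set"
    show "hausdorff_outer d (T \<inter> F) + hausdorff_outer d (T - F) \<le> hausdorff_outer d T"
      using that by (rule hausdorff_outer_closed)
    show "hausdorff_outer d T \<le> hausdorff_outer d (T \<inter> F) + hausdorff_outer d (T - F)"
      using hausdorff_outer_Un[of d "T \<inter> F" "T - F"] by (simp add: Int_Diff_Un)
  qed simp
  then have "sigma_sets UNIV {F :: 'a set. closed F} \<subseteq> ?L"
    by (intro L.sigma_sets_subset) auto
  then have "sets (borel :: 'a measure) \<subseteq> ?L"
    unfolding borel_eq_closed by simp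
  moreover have "sigma_algebra UNIV (sets (borel :: 'a measure))"
    using sets.sigma_algebra_axioms[of "borel :: 'a measure"] by (simp only: space_borel)
  ultimately show ?thesis by (intro measure_down[OF L])
qed

lemma sets_hausdorff_measure [simp]:
  "sets (hausdorff_measure d :: 'a::metric_space measure) = sets borel"
proof -
  have "sigma_sets UNIV (sets (borel :: 'a measure)) = sets borel"
    using sets.sigma_sets_eq[of "borel :: 'a measure"] by (simp only: space_borel)
  then show ?thesis by (simp add: hausdorff_measure_def)
qed

lemma space_hausdorff_measure [simp]: "space (hausdorff_measure d) = UNIV"
  by (simp add: hausdorff_measure_def space_measure_of_conv)

lemma emeasure_hausdorff_measure:
  fixes A :: "'a::metric_space set"
  assumes "A \<in> sets borel"
  shows "emeasure (hausdorff_measure d) A = hausdorff_outer d A"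
proof (rule emeasure_measure_of[OF hausdorff_measure_def])
  have "measure_space UNIV (sets borel) (hausdorff_outer d :: 'a set \<Rightarrow> ennreal)"
    by (rule measure_space_hausdorff_outer)
  then show "positive (sets (hausdorff_measure d)) (hausdorff_outer d :: 'a set \<Rightarrow> ennreal)"
    and "countably_additive (sets (hausdorff_measure d)) (hausdorff_outer d :: 'a set \<Rightarrow> ennreal)"
    by (simp_all only: sets_hausdorff_measure measure_space_def)
  show "A \<in> sets (hausdorff_measure d)" using assms by (simp only: sets_hausdorff_measure)
qed auto

section \<open>Smooth hypersurfaces\<close>

text \<open>Continuous differentiability of order k on an open set, by iterated directional
  derivatives.\<close>

fun C_on :: "nat \<Rightarrow> 'a::euclidean_space set \<Rightarrow> ('a \<Rightarrow> 'b::real_normed_vector) \<Rightarrow> bool" where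
  "C_on 0 U f \<longleftrightarrow> continuous_on U f"
| "C_on (Suc k) U f \<longleftrightarrow> (\<forall>x\<in>U. f differentiable (at x)) \<and>
     (\<forall>v. C_on k U (\<lambda>x. frechet_derivative f (at x) v))"

definition smooth_on :: "'a::euclidean_space set \<Rightarrow> ('a \<Rightarrow> 'b::real_normed_vector) \<Rightarrow> bool" where
  "smooth_on U f \<longleftrightarrow> (\<forall>k. C_on k U f)"

text \<open>A hypersurface without boundary is locally the graph, over an open subset of the hyperplane
  orthogonal to some unit vector b, of a smooth function u.  The points of that hyperplane are
  the vectors \<open>y - (y \<bullet> b) *\<^sub>R b\<close>.\<close>

definition smooth_hypersurface :: "'a::euclidean_space set \<Rightarrow> bool" where
  "smooth_hypersurface S \<longleftrightarrow> (\<forall>x\<in>S. \<exists>U b u. open U \<and> x \<in> U \<and> norm b = 1 \<and>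
     smooth_on U (\<lambda>y. u (y - (y \<bullet> b) *\<^sub>R b) :: real) \<and>
     S \<inter> U = {y \<in> U. y \<bullet> b = u (y - (y \<bullet> b) *\<^sub>R b)})"

definition smooth_along :: "'a::euclidean_space set \<Rightarrow> ('a \<Rightarrow> 'b::real_normed_vector) \<Rightarrow> bool" where
  "smooth_along S f \<longleftrightarrow> (\<forall>x\<in>S. \<exists>U g. open U \<and> x \<in> U \<and> smooth_on U g \<and> (\<forall>y\<in>S \<inter> U. g y = f y))"

definition tangent_space :: "'a::euclidean_space set \<Rightarrow> 'a \<Rightarrow> 'a set" where
  "tangent_space S x = {v. \<exists>c :: real \<Rightarrow> 'a. c 0 = x \<and> (\<forall>\<^sub>F t in nhds 0. c t \<in> S) \<and>
     (c has_vector_derivative v) (at 0)}"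

text \<open>A hypersurface is orientable iff it carries such a field.\<close>

definition unit_normal_field :: "'a::euclidean_space set \<Rightarrow> ('a \<Rightarrow> 'a) \<Rightarrow> bool" where
  "unit_normal_field S N \<longleftrightarrow> smooth_along S N \<and>
     (\<forall>x\<in>S. norm (N x) = 1 \<and> (\<forall>v\<in>tangent_space S x. N x \<bullet> v = 0))"

section \<open>Differential geometry of hypersurfaces\<close>

text \<open>The derivative along S at x of a function on S: the Euclidean connection.  Derivatives within
  S are not unique as linear maps, but their values on \<open>tangent_space S x\<close> are, and only those are
  used.\<close>

definition deriv_along :: "'a::euclidean_space set \<Rightarrow> ('a \<Rightarrow> 'b::real_normed_vector) \<Rightarrow> 'a \<Rightarrow> 'a \<Rightarrow> 'b" where
  "deriv_along S f x v = frechet_derivative f (at x within S) v"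

text \<open>With \<open>DIM('a) = n + 1\<close>, a frame is \<open>e 0, \<dots>, e (n - 1)\<close>.\<close>

definition local_frame :: "'a::euclidean_space set \<Rightarrow> 'a \<Rightarrow> (nat \<Rightarrow> 'a \<Rightarrow> 'a) \<Rightarrow> bool" where
  "local_frame S x e \<longleftrightarrow> (\<exists>U. open U \<and> x \<in> U \<and>
     (\<forall>i<DIM('a) - 1. smooth_along (S \<inter> U) (e i)) \<and>
     (\<forall>y\<in>S \<inter> U. \<forall>i<DIM('a) - 1. e i y \<in> tangent_space S y \<and>
        (\<forall>j<DIM('a) - 1. e i y \<bullet> e j y = (if i = j then 1 else 0))))"

text \<open>An arbitrary choice; everything below except the individual entries of the second
  fundamental form is independent of it.\<close>

definition frame :: "'a::euclidean_space set \<Rightarrow> 'a \<Rightarrow> nat \<Rightarrow> 'a \<Rightarrow> 'a" where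
  "frame S x = (SOME e. local_frame S x e)"

definition surface_div :: "'a::euclidean_space set \<Rightarrow> ('a \<Rightarrow> 'a) \<Rightarrow> 'a \<Rightarrow> real" where
  "surface_div S X x = (\<Sum>i<DIM('a) - 1. deriv_along S X x (frame S x i x) \<bullet> frame S x i x)"

definition mean_curvature :: "'a::euclidean_space set \<Rightarrow> ('a \<Rightarrow> 'a) \<Rightarrow> 'a \<Rightarrow> real" where
  "mean_curvature S N x = surface_div S N x"

definition second_ff :: "'a::euclidean_space set \<Rightarrow> ('a \<Rightarrow> 'a) \<Rightarrow> 'a \<Rightarrow> nat \<Rightarrow> nat \<Rightarrow> real" where
  "second_ff S N x i j = deriv_along S (frame S x j) x (frame S x i x) \<bullet> N x"

definition second_ff_norm_sq :: "'a::euclidean_space set \<Rightarrow> ('a \<Rightarrow> 'a) \<Rightarrow> 'a \<Rightarrow> real" where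
  "second_ff_norm_sq S N x = (\<Sum>i<DIM('a) - 1. \<Sum>j<DIM('a) - 1. (second_ff S N x i j)\<^sup>2)"

definition second_ff_opnorm :: "'a::euclidean_space set \<Rightarrow> ('a \<Rightarrow> 'a) \<Rightarrow> 'a \<Rightarrow> real" where
  "second_ff_opnorm S N x =
    (SUP c\<in>{c :: nat \<Rightarrow> real. L2_set c {..<DIM('a) - 1} \<le> 1}.
       L2_set (\<lambda>i. \<Sum>j<DIM('a) - 1. second_ff S N x i j * c j) {..<DIM('a) - 1})"

definition surface_grad :: "'a::euclidean_space set \<Rightarrow> ('a \<Rightarrow> real) \<Rightarrow> 'a \<Rightarrow> 'a" where
  "surface_grad S f x =
    (\<Sum>i<DIM('a) - 1. deriv_along S f x (frame S x i x) *\<^sub>R frame S x i x)"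

definition surface_laplacian :: "'a::euclidean_space set \<Rightarrow> ('a \<Rightarrow> real) \<Rightarrow> 'a \<Rightarrow> real" where
  "surface_laplacian S f x = surface_div S (surface_grad S f) x"

definition L_op :: "'a::euclidean_space set \<Rightarrow> ('a \<Rightarrow> 'a) \<Rightarrow> ('a \<Rightarrow> real) \<Rightarrow> 'a \<Rightarrow> real" where
  "L_op S N f x = surface_laplacian S f x - x \<bullet> surface_grad S f x
     + second_ff_norm_sq S N x * f x + f x"

definition tangent_proj :: "'a::euclidean_space set \<Rightarrow> 'a \<Rightarrow> 'a \<Rightarrow> 'a" where
  "tangent_proj S y u =
    (THE p. p \<in> tangent_space S y \<and> (\<forall>w\<in>tangent_space S y. orthogonal (u - p) w))"

section \<open>Gaussian integrals over hypersurfaces\<close>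

definition surface_measure :: "'a::euclidean_space set \<Rightarrow> 'a measure" where
  "surface_measure S = restrict_space (hausdorff_measure (DIM('a) - 1)) S"

definition gauss :: "nat \<Rightarrow> 'a::euclidean_space \<Rightarrow> real" where
  "gauss n x = (2 * pi) powr (- real n / 2) * exp (- (norm x)\<^sup>2 / 2)"

end

theory Submission
  imports Defs
begin

text \<open>Write W for the shape operator of \<open>\<Sigma>\<close> extended by 0 in the normal direction.  The Codazzi
  equation and the hypothesis on H give \<open>L (v \<bullet> N) = v \<bullet> N\<close>, hence pointwise
  \<open>L (f - m) = (1 - \<parallel>A\<parallel>\<^sup>2) f + 2 (W v \<bullet> W w) - (\<parallel>A\<parallel>\<^sup>2 + 1) m\<close> for \<open>f = (v \<bullet> N) (w \<bullet> N)\<close>; no integration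
  by parts is needed.  The left-hand side is a quadratic form in v and in w, so its sum over all pairs
  of basis vectors is computed by traces.  That sum equals the right-hand side except that
  \<open>\<parallel>W N(z)\<parallel>\<^sup>2\<close> stands in place of the larger quantity \<open>\<parallel>A\<parallel>\<^sub>o\<^sub>p\<^sup>2 \<parallel>\<Pi> N(z)\<parallel>\<^sup>2\<close>; some pair is at least
  as good as the average.

  Nothing is assumed to be integrable, and a Bochner integral that diverges is 0.  When \<open>\<gamma>\<close> or
  \<open>\<parallel>A\<parallel>\<^sup>2 \<gamma>\<close> is not integrable, the same trace identities show that the left-hand integrand
  is not integrable for some pair, so that both sides are 0; the exception is a normal that is constant
  up to sign, for which all integrands vanish almost everywhere.\<close>

section \<open>Calculus of iterated directional derivatives\<close>

text \<open>A derivative along S is determined on tangent vectors only, and the frame used at a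
  point is chosen independently of the frames at nearby points, so sums over frames cannot be
  differentiated as they stand. Two devices get around this. N is extended locally to a unit field V
  on an open set, and derivatives along S are read off from ambient ones. Frame sums are rewritten
  as traces over the standard basis, which does not move with the point; this is what the extension
  of W by 0 is for, since the normal direction then contributes nothing. The invariance of traces
  also explains the constants: (n+1)^2 is the number of pairs of basis vectors, and m, being
  bilinear in v and w, becomes the second moment matrix of N under the probability density
  \<open>g / p\<close>. If K is the squared norm of that matrix, \<open>1 - K\<close> is the average
  of |Pi_y N(z)|^2, which is how this factor enters.\<close>

lemma has_frechet_derivative:
  "f differentiable F \<Longrightarrow> (f has_derivative frechet_derivative f F) F"
  by (simp add: frechet_derivative_works[symmetric])

lemma C_on_cong:
  assumes "open U" "\<And>x. x \<in> U \<Longrightarrow> f x = g x" "C_on k U f"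
  shows "C_on k U g"
  using assms(2,3)
proof (induction k arbitrary: f g)
  case 0
  then show ?case by (auto cong: continuous_on_cong)
next
  case (Suc k)
  have d: "(g has_derivative frechet_derivative f (at x)) (at x)" if "x \<in> U" for x
  proof (rule has_derivative_transform_within_open[OF _ assms(1) that])
    show "(f has_derivative frechet_derivative f (at x)) (at x)"
      using Suc.prems that by (simp add: frechet_derivative_works[symmetric])
  qed (rule Suc.prems(1))
  have "C_on k U (\<lambda>x. frechet_derivative g (at x) v)" for v
  proof (rule Suc.IH)
    show "frechet_derivative f (at x) v = frechet_derivative g (at x) v" if "x \<in> U" for x
      using frechet_derivative_at[OF d[OF that]] by simp
    show "C_on k U (\<lambda>x. frechet_derivative f (at x) v)"
      using Suc.prems by simp
  qed
  with d show ?case by (auto simp: differentiable_def)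
qed

text \<open>Lets the derivative be given by a formula: at points of an open set any derivative
  agrees with the one that \<open>frechet_derivative\<close> selects.\<close>

lemma C_on_SucI:
  assumes "open U" "\<And>x. x \<in> U \<Longrightarrow> (f has_derivative f' x) (at x)" "\<And>v. C_on k U (\<lambda>x. f' x v)"
  shows "C_on (Suc k) U f"
proof -
  have "C_on k U (\<lambda>x. frechet_derivative f (at x) v)" for v
    by (rule C_on_cong[OF assms(1) _ assms(3)[of v]])
       (use frechet_derivative_at[OF assms(2)] in metis)
  with assms(2) show ?thesis by (auto simp: differentiable_def)
qed

lemma C_on_Suc_deriv:
  assumes "C_on (Suc k) U f" "x \<in> U"
  shows "(f has_derivative frechet_derivative f (at x)) (at x)"
  using assms by (simp add: frechet_derivative_works[symmetric])

lemma C_on_SucD: "C_on (Suc k) U f \<Longrightarrow> C_on k U f"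
proof (induction k arbitrary: f)
  case 0
  then show ?case
    by (auto intro!: differentiable_imp_continuous_on differentiable_at_imp_differentiable_on)
next
  case (Suc k)
  then show ?case using C_on.simps(2)[of "Suc k" U f] C_on.simps(2)[of k U f] by metis
qed

lemma C_on_le: "C_on k U f \<Longrightarrow> j \<le> k \<Longrightarrow> C_on j U f"
  by (induction k) (auto simp: le_Suc_eq simp del: C_on.simps dest: C_on_SucD)

lemma C_on_continuous_on: "C_on k U f \<Longrightarrow> continuous_on U f"
  using C_on_le[of k U f 0] by simp

lemma C_on_subset: "C_on k U f \<Longrightarrow> V \<subseteq> U \<Longrightarrow> C_on k V f"
  by (induction k arbitrary: f) (auto intro: continuous_on_subset)

lemma C_on_const: "C_on k U (\<lambda>x. c)"
  by (induction k arbitrary: c) auto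

section \<open>Closure of C^k under algebraic operations\<close>

lemma C_on_bounded_linear_comp:
  assumes "open U" "bounded_linear L"
  shows "C_on k U f \<Longrightarrow> C_on k U (\<lambda>x. L (f x))"
proof (induction k arbitrary: f)
  case 0
  then show ?case
    using assms(2) by (auto intro: linear_continuous_on_compose bounded_linear.continuous_on)
next
  case (Suc k)
  show ?case
  proof (rule C_on_SucI[OF assms(1)])
    show "((\<lambda>x. L (f x)) has_derivative (\<lambda>v. L (frechet_derivative f (at x) v))) (at x)" if "x \<in> U" for x
      using bounded_linear.has_derivative[OF assms(2) C_on_Suc_deriv[OF Suc.prems that]] .
    show "C_on k U (\<lambda>x. L (frechet_derivative f (at x) v))" for v
      using Suc by auto
  qed
qed

lemma C_on_add:
  assumes "open U"
  shows "C_on k U f \<Longrightarrow> C_on k U g \<Longrightarrow> C_on k U (\<lambda>x. f x + g x)"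
proof (induction k arbitrary: f g)
  case 0
  then show ?case by (auto intro: continuous_intros)
next
  case (Suc k)
  show ?case
  proof (rule C_on_SucI[OF assms])
    show "((\<lambda>x. f x + g x) has_derivative
        (\<lambda>v. frechet_derivative f (at x) v + frechet_derivative g (at x) v)) (at x)" if "x \<in> U" for x
      using C_on_Suc_deriv[OF Suc.prems(1) that] C_on_Suc_deriv[OF Suc.prems(2) that]
      by (rule has_derivative_add)
    show "C_on k U (\<lambda>x. frechet_derivative f (at x) v + frechet_derivative g (at x) v)" for v
      using Suc by auto
  qed
qed

lemma C_on_bilinear:
  assumes "open U" "bounded_bilinear p"
  shows "C_on k U f \<Longrightarrow> C_on k U g \<Longrightarrow> C_on k U (\<lambda>x. p (f x) (g x))"
proof (induction k arbitrary: f g)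
  case 0
  then show ?case using assms(2) by (auto intro: bounded_bilinear.continuous_on)
next
  case (Suc k)
  show ?case
  proof (rule C_on_SucI[OF assms(1)])
    show "((\<lambda>x. p (f x) (g x)) has_derivative
        (\<lambda>v. p (f x) (frechet_derivative g (at x) v) + p (frechet_derivative f (at x) v) (g x))) (at x)"
      if "x \<in> U" for x
      using bounded_bilinear.FDERIV[OF assms(2) C_on_Suc_deriv[OF Suc.prems(1) that]
          C_on_Suc_deriv[OF Suc.prems(2) that]] .
    show "C_on k U (\<lambda>x. p (f x) (frechet_derivative g (at x) v) + p (frechet_derivative f (at x)
        v) (g x))" for v
    proof (rule C_on_add[OF assms(1)]; rule Suc.IH)
      show "C_on k U f" "C_on k U g" using Suc.prems C_on_SucD by blast+
    qed (use Suc.prems in auto)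
  qed
qed

lemmas C_on_inner = C_on_bilinear[OF _ bounded_bilinear_inner]
lemmas C_on_scaleR = C_on_bilinear[OF _ bounded_bilinear_scaleR]
lemmas C_on_mult = C_on_bilinear[OF _ bounded_bilinear_mult[where 'a=real]]
lemmas C_on_uminus = C_on_bounded_linear_comp[OF _ bounded_linear_minus[OF bounded_linear_ident]]

lemma C_on_diff: "open U \<Longrightarrow> C_on k U f \<Longrightarrow> C_on k U g \<Longrightarrow> C_on k U (\<lambda>x. f x - g x)"
  using C_on_add[of U k f "\<lambda>x. - g x"] C_on_uminus[of U k g] by simp

lemma C_on_sum:
  assumes "open U" "finite I" "\<And>i. i \<in> I \<Longrightarrow> C_on k U (f i)"
  shows "C_on k U (\<lambda>x. \<Sum>i\<in>I. f i x)"
  using assms(2,3) by (induction I rule: finite_induct) (auto intro: C_on_const C_on_add[OF assms(1)])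

text \<open>The exponent stays arbitrary in the induction because differentiation lowers it. The
  exponents -1/2 and -1 serve to normalise a gradient and to build rotations.\<close>

lemma C_on_powr:
  fixes s :: "'a::euclidean_space \<Rightarrow> real"
  assumes "open U" "\<And>x. x \<in> U \<Longrightarrow> 0 < s x"
  shows "C_on k U s \<Longrightarrow> C_on k U (\<lambda>x. s x powr a)"
proof (induction k arbitrary: a)
  case 0
  then show ?case using assms(2) by (fastforce intro!: continuous_intros)
next
  case (Suc k)
  show ?case
  proof (rule C_on_SucI[OF assms(1)])
    show "((\<lambda>x. s x powr a) has_derivative
        (\<lambda>v. (a * s x powr (a - 1)) * frechet_derivative s (at x) v)) (at x)" if "x \<in> U" for x
    proof -
      have "(s has_derivative frechet_derivative s (at x)) (at x)"
        using C_on_Suc_deriv[OF Suc.prems that] .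
      from has_derivative_powr[OF this has_derivative_const[of a] assms(2)[OF that]]
      show ?thesis
        by (rule has_derivative_eq_rhs)
           (use assms(2)[OF that] in \<open>auto simp: powr_diff fun_eq_iff\<close>)
    qed
    show "C_on k U (\<lambda>x. a * s x powr (a - 1) * frechet_derivative s (at x) v)" for v
      using Suc C_on_SucD[OF Suc.prems] by (intro C_on_mult assms(1) C_on_const) auto
  qed
qed

lemma smooth_onD: "smooth_on U f \<Longrightarrow> C_on k U f"
  by (simp add: smooth_on_def)

section \<open>Symmetry of second derivatives\<close>

lemma has_vector_derivative_line:
  assumes "(f has_derivative f') (at (x + s *\<^sub>R u))"
  shows "((\<lambda>s. f (x + s *\<^sub>R u)) has_vector_derivative f' u) (at s)"
proof -
  have l: "linear f'" using assms has_derivative_linear by blast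
  have "((\<lambda>s. x + s *\<^sub>R u) has_derivative (\<lambda>h. h *\<^sub>R u)) (at s)"
    by (auto intro!: derivative_eq_intros)
  from has_derivative_compose[OF this assms]
  show ?thesis by (simp add: has_vector_derivative_def linear_scale[OF l])
qed

text \<open>Both orders of differentiation compute the second difference of f over a small
  parallelogram spanned by multiples of u and w.\<close>

lemma second_difference_mvt:
  fixes f :: "'a::euclidean_space \<Rightarrow> real"
  assumes C: "C_on 2 U f" and h: "0 < h"
    and U: "\<And>s t. 0 \<le> s \<Longrightarrow> s \<le> h \<Longrightarrow> 0 \<le> t \<Longrightarrow> t \<le> h \<Longrightarrow> x + s *\<^sub>R u + t *\<^sub>R w \<in> U"
  shows "\<exists>s t. 0 < s \<and> s < h \<and> 0 < t \<and> t < h \<and>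
    f (x + h *\<^sub>R u + h *\<^sub>R w) - f (x + h *\<^sub>R u) - f (x + h *\<^sub>R w) + f x =
    h * h * frechet_derivative (\<lambda>y. frechet_derivative f (at y) u) (at (x + s *\<^sub>R u + t *\<^sub>R w)) w"
proof -
  have C2: "C_on (Suc (Suc 0)) U f" using C by (simp add: numeral_2_eq_2)
  let ?D = "\<lambda>y. frechet_derivative f (at y)"
  have D: "(f has_derivative ?D y) (at y)" if "y \<in> U" for y
    using C_on_Suc_deriv[OF C2 that] .
  have DD: "((\<lambda>y. ?D y u) has_derivative frechet_derivative (\<lambda>y. ?D y u) (at y)) (at y)" if "y \<in> U" for y
    using C_on_Suc_deriv[of 0 U "\<lambda>y. ?D y u"] C2 that by simp
  let ?g = "\<lambda>s. f ((x + h *\<^sub>R w) + s *\<^sub>R u) - f (x + s *\<^sub>R u)"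
  have "DERIV ?g s :> ?D (x + h *\<^sub>R w + s *\<^sub>R u) u - ?D (x + s *\<^sub>R u) u" if "0 \<le> s" "s \<le> h" for s
  proof -
    have "x + h *\<^sub>R w + s *\<^sub>R u \<in> U" "x + s *\<^sub>R u \<in> U"
      using U[OF that, of h] U[OF that, of 0] h by (simp_all add: ac_simps)
    then show ?thesis
      unfolding has_real_derivative_iff_has_vector_derivative
      by (intro has_vector_derivative_diff has_vector_derivative_line D)
  qed
  from MVT2[OF h this] obtain s where s: "0 < s" "s < h"
    "?g h - ?g 0 = h * (?D (x + h *\<^sub>R w + s *\<^sub>R u) u - ?D (x + s *\<^sub>R u) u)" by auto
  let ?k = "\<lambda>t. ?D (x + s *\<^sub>R u + t *\<^sub>R w) u"
  have "DERIV ?k t :> frechet_derivative (\<lambda>y. ?D y u) (at (x + s *\<^sub>R u + t *\<^sub>R w)) w" if "0 \<le> t"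
      "t \<le> h" for t
    unfolding has_real_derivative_iff_has_vector_derivative
    by (rule has_vector_derivative_line[OF DD[OF U]]) (use s that in auto)
  from MVT2[OF h this] obtain t where t: "0 < t" "t < h"
    "?k h - ?k 0 = h * frechet_derivative (\<lambda>y. ?D y u) (at (x + s *\<^sub>R u + t *\<^sub>R w)) w" by auto
  have "?D (x + h *\<^sub>R w + s *\<^sub>R u) u - ?D (x + s *\<^sub>R u) u = ?k h - ?k 0"
    by (simp add: algebra_simps)
  with s t show ?thesis by (intro exI[of _ s] exI[of _ t]) (simp add: algebra_simps)
qed

lemma C_on_2_symmetric_real:
  fixes f :: "'a::euclidean_space \<Rightarrow> real"
  assumes "open U" "C_on 2 U f" "x \<in> U"
  shows "frechet_derivative (\<lambda>y. frechet_derivative f (at y) u) (at x) w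
       = frechet_derivative (\<lambda>y. frechet_derivative f (at y) w) (at x) u"
proof (rule ccontr)
  let ?A = "\<lambda>x. frechet_derivative (\<lambda>y. frechet_derivative f (at y) u) (at x) w"
  let ?B = "\<lambda>x. frechet_derivative (\<lambda>y. frechet_derivative f (at y) w) (at x) u"
  assume ne: "?A x \<noteq> ?B x"
  have C2: "C_on (Suc (Suc 0)) U f" using assms(2) by (simp add: numeral_2_eq_2)
  \<comment> \<open>Half the gap: two values of the mixed derivatives that coincide near x cannot
    both lie within e of their values at x.\<close>
  define e where "e = \<bar>?A x - ?B x\<bar> / 2"
  have e: "0 < e" using ne by (simp add: e_def)
  have cA: "isCont ?A x" and cB: "isCont ?B x"
    using C2 assms(1,3) by (auto simp: continuous_on_eq_continuous_at)
  obtain d1 where d1: "d1 > 0" "\<And>y. dist y x < d1 \<Longrightarrow> \<bar>?A y - ?A x\<bar> < e"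
    using cA e unfolding continuous_at_eps_delta by (auto simp: dist_norm)
  obtain d2 where d2: "d2 > 0" "\<And>y. dist y x < d2 \<Longrightarrow> \<bar>?B y - ?B x\<bar> < e"
    using cB e unfolding continuous_at_eps_delta by (auto simp: dist_norm)
  obtain d3 where d3: "d3 > 0" "ball x d3 \<subseteq> U" using assms(1,3) openE by blast
  define d where "d = min d1 (min d2 d3)"
  have d: "d > 0" using d1 d2 d3 by (simp add: d_def)
  \<comment> \<open>Keeps the parallelogram with sides h u and h w inside the ball of radius d; the
    summand 1 guards against u = w = 0.\<close>
  define h where "h = d / (2 * (norm u + norm w + 1))"
  have h: "h > 0" using d by (simp add: h_def add_nonneg_pos)
  have near: "dist (x + s *\<^sub>R u + t *\<^sub>R w) x < d" "dist (x + s *\<^sub>R w + t *\<^sub>R u) x < d"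
    if "0 \<le> s" "s \<le> h" "0 \<le> t" "t \<le> h" for s t
  proof -
    have hb: "h * norm u + h * norm w < d"
    proof -
      have "h * (norm u + norm w) \<le> h * (norm u + norm w + 1)" using h by (simp add: mult_left_mono)
      also have "\<dots> = d / 2"
        using add_nonneg_pos[of "norm u + norm w" 1] by (simp add: h_def field_simps)
      also have "\<dots> < d" using d by simp
      finally show ?thesis by (simp add: algebra_simps)
    qed
    have "norm (s *\<^sub>R u + t *\<^sub>R w) \<le> s * norm u + t * norm w"
      using norm_triangle_ineq[of "s *\<^sub>R u" "t *\<^sub>R w"] that by simp
    also have "\<dots> \<le> h * norm u + h * norm w" using that by (intro add_mono mult_right_mono) auto
    finally show "dist (x + s *\<^sub>R u + t *\<^sub>R w) x < d" using hb by (simp add: dist_norm add.assoc)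
    have "norm (s *\<^sub>R w + t *\<^sub>R u) \<le> s * norm w + t * norm u"
      using norm_triangle_ineq[of "s *\<^sub>R w" "t *\<^sub>R u"] that by simp
    also have "\<dots> \<le> h * norm w + h * norm u" using that by (intro add_mono mult_right_mono) auto
    finally show "dist (x + s *\<^sub>R w + t *\<^sub>R u) x < d" using hb by (simp add: dist_norm add.assoc)
  qed
  have inU: "x + s *\<^sub>R u + t *\<^sub>R w \<in> U" "x + s *\<^sub>R w + t *\<^sub>R u \<in> U"
    if "0 \<le> s" "s \<le> h" "0 \<le> t" "t \<le> h" for s t
    using near[OF that] d3 by (auto simp: d_def dist_commute subset_iff)
  obtain s t where st: "0 < s" "s < h" "0 < t" "t < h"
    "f (x + h *\<^sub>R u + h *\<^sub>R w) - f (x + h *\<^sub>R u) - f (x + h *\<^sub>R w) + f x = h * h * ?A (x + s *\<^sub>R u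
        + t *\<^sub>R w)"
    using second_difference_mvt[OF assms(2) h, of x u w] inU by blast
  obtain s' t' where st': "0 < s'" "s' < h" "0 < t'" "t' < h"
    "f (x + h *\<^sub>R w + h *\<^sub>R u) - f (x + h *\<^sub>R w) - f (x + h *\<^sub>R u) + f x = h * h * ?B (x + s' *\<^sub>R
        w + t' *\<^sub>R u)"
    using second_difference_mvt[OF assms(2) h, of x w u] inU by blast
  have "h * h * ?A (x + s *\<^sub>R u + t *\<^sub>R w) = h * h * ?B (x + s' *\<^sub>R w + t' *\<^sub>R u)"
    using st(5) st'(5) by (simp add: algebra_simps)
  then have "?A (x + s *\<^sub>R u + t *\<^sub>R w) = ?B (x + s' *\<^sub>R w + t' *\<^sub>R u)" using h by simp
  moreover have "\<bar>?A (x + s *\<^sub>R u + t *\<^sub>R w) - ?A x\<bar> < e" "\<bar>?B (x + s' *\<^sub>R w + t' *\<^sub>R u) - ?B x\<bar> < e"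
    using d1(2)[of "x + s *\<^sub>R u + t *\<^sub>R w"] d2(2)[of "x + s' *\<^sub>R w + t' *\<^sub>R u"] near(1)[of s t]
        near(2)[of s' t'] st st'
    by (auto simp: d_def)
  ultimately show False unfolding e_def by (simp add: abs_if split: if_splits)
qed

lemma frechet_derivative_inner_left:
  fixes f :: "'a::euclidean_space \<Rightarrow> 'b::real_inner"
  assumes "f differentiable (at x)"
  shows "frechet_derivative (\<lambda>y. c \<bullet> f y) (at x) v = c \<bullet> frechet_derivative f (at x) v"
  using frechet_derivative_at[OF has_derivative_inner_right[OF has_frechet_derivative[OF assms], of c]]
  by metis

text \<open>Reduced to the components of f, because the mean value theorem behind the real case
  fails for vector values.\<close>

lemma C_on_2_symmetric:
  fixes f :: "'a::euclidean_space \<Rightarrow> 'b::euclidean_space"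
  assumes "open U" "C_on 2 U f" "x \<in> U"
  shows "frechet_derivative (\<lambda>y. frechet_derivative f (at y) u) (at x) w
       = frechet_derivative (\<lambda>y. frechet_derivative f (at y) w) (at x) u"
proof (rule euclidean_eqI)
  fix c :: 'b
  have C2: "C_on (Suc (Suc 0)) U f" using assms(2) by (simp add: numeral_2_eq_2)
  let ?f = "\<lambda>y. c \<bullet> f y"
  have Cf: "C_on 2 U ?f"
    using C_on_inner[OF assms(1) C_on_const assms(2)] .
  have d: "frechet_derivative ?f (at y) v = c \<bullet> frechet_derivative f (at y) v" if "y \<in> U" for y v
    using C2 that by (intro frechet_derivative_inner_left) auto
  have dd: "frechet_derivative (\<lambda>y. frechet_derivative ?f (at y) v) (at x) v'
      = c \<bullet> frechet_derivative (\<lambda>y. frechet_derivative f (at y) v) (at x) v'" for v v'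
  proof -
    have df: "(\<lambda>y. frechet_derivative f (at y) v) differentiable (at x)"
      using C2 assms(3) by auto
    have "((\<lambda>y. frechet_derivative ?f (at y) v) has_derivative
       (\<lambda>v'. c \<bullet> frechet_derivative (\<lambda>y. frechet_derivative f (at y) v) (at x) v')) (at x)"
      by (rule has_derivative_transform_within_open[OF has_derivative_inner_right[OF
          has_frechet_derivative[OF df]] assms(1,3)])
         (simp add: d)
    from frechet_derivative_at[OF this] show ?thesis by metis
  qed
  show "frechet_derivative (\<lambda>y. frechet_derivative f (at y) u) (at x) w \<bullet> c
       = frechet_derivative (\<lambda>y. frechet_derivative f (at y) w) (at x) u \<bullet> c"
    using C_on_2_symmetric_real[OF assms(1) Cf assms(3), of u w] by (simp add: dd inner_commute)
qed

section \<open>Tangent spaces and the unit normal\<close>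

lemma has_vector_derivative_along_curve:
  assumes "(f has_derivative D) (at x within S)" "c 0 = x" "\<forall>\<^sub>F t in nhds (0::real). c t \<in> S"
    "(c has_vector_derivative v) (at 0)"
  shows "((\<lambda>t. f (c t)) has_vector_derivative D v) (at 0)"
proof -
  obtain T where T: "open T" "0 \<in> T" "\<And>t. t \<in> T \<Longrightarrow> c t \<in> S"
    using assms(3) unfolding eventually_nhds by blast
  have l: "linear D" using assms(1) has_derivative_linear by blast
  have "(c has_derivative (\<lambda>h. h *\<^sub>R v)) (at 0 within T)"
    using assms(4) by (auto simp: has_vector_derivative_def intro: has_derivative_at_withinI)
  moreover have "(f has_derivative D) (at (c 0) within c ` T)"
    using assms(1,2) T by (auto intro: has_derivative_subset)
  ultimately have "((\<lambda>t. f (c t)) has_derivative (\<lambda>h. D (h *\<^sub>R v))) (at 0 within T)"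
    by (rule has_derivative_in_compose)
  then show ?thesis
    using T by (simp add: has_vector_derivative_def linear_scale[OF l] at_within_open[OF T(2,1)])
qed

text \<open>Along a curve in S with velocity v, every derivative of f within S yields the derivative
  of f along the curve, so all of them agree at v.\<close>

lemma deriv_along_eq:
  assumes "(f has_derivative D) (at x within S)" "v \<in> tangent_space S x"
  shows "deriv_along S f x v = D v"
proof -
  obtain c where c: "c 0 = x" "\<forall>\<^sub>F t in nhds (0::real). c t \<in> S" "(c has_vector_derivative v) (at 0)"
    using assms(2) by (auto simp: tangent_space_def)
  have "(f has_derivative deriv_along S f x) (at x within S)"
    using assms(1) unfolding deriv_along_def
    by (intro has_frechet_derivative) (auto simp: differentiable_def)
  from has_vector_derivative_along_curve[OF this c] has_vector_derivative_along_curve[OF assms(1) c]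
  show ?thesis by (rule vector_derivative_unique_at)
qed

text \<open>The means of computing every derivative along S below: differentiate any ambient
  function that agrees with f on S near x.\<close>

lemma deriv_along_extension:
  assumes "(g has_derivative D) (at x)" "open U" "x \<in> S" "x \<in> U" "\<And>y. y \<in> S \<inter> U \<Longrightarrow> g y = f y"
    "v \<in> tangent_space S x"
  shows "deriv_along S f x v = D v"
proof (rule deriv_along_eq[OF _ assms(6)])
  obtain d where d: "d > 0" "ball x d \<subseteq> U" using assms(2,4) openE by blast
  show "(f has_derivative D) (at x within S)"
  proof (rule has_derivative_transform_within[OF has_derivative_at_withinI[OF assms(1)] d(1) assms(3)])
    fix y assume "y \<in> S" "dist y x < d"
    then show "g y = f y" using d by (intro assms(5)) (auto simp: dist_commute)
  qed
qed

section \<open>Tangent space and normal of a graph\<close>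

lemma graph_tangent:
  fixes b x :: "'a::euclidean_space" and u :: "'a \<Rightarrow> real"
  defines "F \<equiv> \<lambda>y. u (y - (y \<bullet> b) *\<^sub>R b)"
  assumes b: "norm b = 1" and U: "open U" "x \<in> U" "x \<in> S"
    and S: "S \<inter> U = {y \<in> U. y \<bullet> b = F y}" and D: "(F has_derivative D) (at x)"
  shows "D b = 0" and "v \<bullet> b = D v \<Longrightarrow> v \<in> tangent_space S x"
proof -
  have bb: "b \<bullet> b = 1" using b by (simp add: norm_eq_1)
  have l: "linear D" using D has_derivative_linear by blast
  have Fb: "F (y + t *\<^sub>R b) = F y" for y t
    by (simp add: F_def inner_add_left bb algebra_simps)
  have "((\<lambda>t. F (x + t *\<^sub>R b)) has_vector_derivative D b) (at 0)"
    by (rule has_vector_derivative_line) (simp add: D)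
  moreover have "((\<lambda>t. F (x + t *\<^sub>R b)) has_vector_derivative 0) (at 0)"
    by (simp add: Fb)
  ultimately show Db: "D b = 0" by (rule vector_derivative_unique_at)
  assume v: "v \<bullet> b = D v"
  define v' where "v' = v - (v \<bullet> b) *\<^sub>R b"
  have v'b: "v' \<bullet> b = 0" by (simp add: v'_def inner_diff_left bb)
  have Dv': "D v' = D v" by (simp add: v'_def linear_diff[OF l] linear_scale[OF l] Db)
  \<comment> \<open>The line through x in direction v' lifted to the graph: F ignores the
    b-coordinate, so the height of the curve over the hyperplane is
    \<open>F (x + t *\<^sub>R v')\<close>.\<close>
  define c where "c t = x + t *\<^sub>R v' + (F (x + t *\<^sub>R v') - F x) *\<^sub>R b" for t :: real
  have "((\<lambda>t. F (x + t *\<^sub>R v')) has_vector_derivative D v') (at 0)"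
    by (rule has_vector_derivative_line) (simp add: D)
  then have "(c has_vector_derivative (v' + D v' *\<^sub>R b)) (at 0)"
    unfolding c_def
    by (auto intro!: derivative_eq_intros simp: has_real_derivative_iff_has_vector_derivative)
  moreover have "v' + D v' *\<^sub>R b = v" unfolding Dv' v[symmetric] by (simp add: v'_def)
  ultimately have c': "(c has_vector_derivative v) (at 0)" by simp
  have c0: "c 0 = x" by (simp add: c_def)
  have "isCont c 0" using c' has_vector_derivative_continuous by blast
  then have "\<forall>\<^sub>F t in nhds 0. c t \<in> U"
    using U c0 by (simp add: continuous_at_open eventually_nhds)
  then have "\<forall>\<^sub>F t in nhds 0. c t \<in> S"
  proof eventually_elim
    case (elim t)
    have "x \<in> S \<inter> U" using U by simp
    then have "x \<bullet> b = F x" unfolding S by simp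
    then have "c t \<bullet> b = F (c t)"
      by (simp add: c_def Fb inner_add_left v'b bb)
    with elim have "c t \<in> S \<inter> U" unfolding S by simp
    then show ?case by simp
  qed
  with c' c0 show "v \<in> tangent_space S x" unfolding tangent_space_def by blast
qed

text \<open>W is the gradient of the defining function \<open>y \<mapsto> y \<bullet> b - F y\<close>.\<close>

lemma hypersurface_gradient:
  fixes S :: "'a::euclidean_space set"
  assumes "smooth_hypersurface S" "x \<in> S"
  obtains U b F W where "open U" "x \<in> U" "smooth_on U (F :: 'a \<Rightarrow> real)"
    "\<And>y v. y \<in> U \<Longrightarrow> W y \<bullet> v = v \<bullet> b - frechet_derivative F (at y) v" "\<And>k. C_on k U W"
    "\<And>y. y \<in> S \<inter> U \<Longrightarrow> W y \<noteq> 0" "\<And>y v. y \<in> S \<inter> U \<Longrightarrow> W y \<bullet> v = 0 \<Longrightarrow> v \<in> tangent_space S y"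
proof -
  obtain U b u where U: "open U" "x \<in> U" and b: "norm b = 1"
    and sm: "smooth_on U (\<lambda>y. u (y - (y \<bullet> b) *\<^sub>R b) :: real)"
    and S: "S \<inter> U = {y \<in> U. y \<bullet> b = u (y - (y \<bullet> b) *\<^sub>R b)}"
    using assms unfolding smooth_hypersurface_def by blast
  define F where "F = (\<lambda>y. u (y - (y \<bullet> b) *\<^sub>R b) :: real)"
  define W where "W y = b - (\<Sum>i\<in>Basis. frechet_derivative F (at y) i *\<^sub>R i)" for y
  note sm = sm[folded F_def] and S = S[folded F_def]
  have CF: "C_on (Suc k) U F" for k using sm by (rule smooth_onD)
  have D: "(F has_derivative frechet_derivative F (at y)) (at y)" if "y \<in> U" for y
    using C_on_Suc_deriv[OF CF that] .
  have WF: "W y \<bullet> v = v \<bullet> b - frechet_derivative F (at y) v" if "y \<in> U" for y v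
  proof -
    have l: "linear (frechet_derivative F (at y))" using D[OF that] has_derivative_linear by blast
    have "frechet_derivative F (at y) v = frechet_derivative F (at y) (\<Sum>i\<in>Basis. (v \<bullet> i) *\<^sub>R i)"
      by (simp add: euclidean_representation)
    also have "\<dots> = (\<Sum>i\<in>Basis. (v \<bullet> i) * frechet_derivative F (at y) i)"
      by (simp add: linear_sum[OF l] linear_scale[OF l])
    finally show ?thesis
      by (simp add: W_def inner_diff_left inner_diff_right inner_sum_left inner_sum_right
          inner_commute mult.commute)
  qed
  have CW: "C_on k U W" for k
    unfolding W_def using CF[of k] U
    by (intro C_on_diff C_on_const C_on_sum C_on_scaleR) auto
  show thesis
  proof (rule that[OF U sm])
    \<comment> \<open>F is constant along b, so that the inner product of W y and b is 1.\<close>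
    show "W y \<noteq> 0" if "y \<in> S \<inter> U" for y
    proof
      assume "W y = 0"
      then have "b \<bullet> b - frechet_derivative F (at y) b = 0" using WF[of y b] that by simp
      then show False
        using graph_tangent(1)[OF b U(1) _ _ S[unfolded F_def] D[unfolded F_def], folded F_def] that b
        by (auto simp: norm_eq_1)
    qed
    show "v \<in> tangent_space S y" if "y \<in> S \<inter> U" "W y \<bullet> v = 0" for y v
      using graph_tangent(2)[OF b U(1) _ _ S[unfolded F_def] D[unfolded F_def], folded F_def] that
          WF[of y v]
      by auto
  qed (use WF CW in auto)
qed

lemma unit_normal_fieldD:
  assumes "unit_normal_field S N" "x \<in> S"
  shows "norm (N x) = 1" "N x \<bullet> N x = 1" "v \<in> tangent_space S x \<Longrightarrow> N x \<bullet> v = 0"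
  using assms by (auto simp: unit_normal_field_def norm_eq_1)

text \<open>The part of a orthogonal to w is orthogonal to w, hence to a, hence to itself.\<close>

lemma unit_vector_parallel:
  fixes a w :: "'a::euclidean_space"
  assumes "a \<bullet> a = 1" "\<And>v. w \<bullet> v = 0 \<Longrightarrow> a \<bullet> v = 0" "w \<noteq> 0"
  shows "a = (a \<bullet> w / (w \<bullet> w)) *\<^sub>R w"
proof -
  define c where "c = a \<bullet> w / (w \<bullet> w)"
  have w: "w \<bullet> (a - c *\<^sub>R w) = 0"
    using assms(3) by (simp add: c_def inner_diff_right inner_commute)
  have "(a - c *\<^sub>R w) \<bullet> (a - c *\<^sub>R w) = 0"
    using w assms(2)[OF w] by (simp add: inner_diff_left)
  then show ?thesis by (simp add: c_def)
qed

text \<open>The kernel of W lies in the tangent space, which lies in the complement of N. The two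
  ends coincide because N is a nonzero multiple of W.\<close>

lemma tangent_space_eq:
  fixes S :: "'a::euclidean_space set"
  assumes "smooth_hypersurface S" "unit_normal_field S N" "x \<in> S"
  shows "tangent_space S x = {v. N x \<bullet> v = 0}"
proof -
  obtain U b F W where x: "x \<in> U" and ne: "\<And>y. y \<in> S \<inter> U \<Longrightarrow> W y \<noteq> 0"
    and tan: "\<And>y v. y \<in> S \<inter> U \<Longrightarrow> W y \<bullet> v = 0 \<Longrightarrow> v \<in> tangent_space S y"
    by (rule hypersurface_gradient[OF assms(1,3)]) (rule that)
  have "N x = (N x \<bullet> W x / (W x \<bullet> W x)) *\<^sub>R W x"
    using unit_normal_fieldD[OF assms(2,3)] ne tan x assms(3) by (intro unit_vector_parallel) auto
  then obtain k where k: "N x = k *\<^sub>R W x" by blast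
  have "k \<noteq> 0" using k unit_normal_fieldD(2)[OF assms(2,3)] by auto
  then have "W x \<bullet> v = 0" if "N x \<bullet> v = 0" for v
    using that by (simp add: k)
  then show ?thesis
    using tan x assms(3) unit_normal_fieldD(3)[OF assms(2,3)] by blast
qed

text \<open>The normalised gradient extends the unit normal to a unit field whose derivative has a
  symmetric tangential part at all points of U, not only at those of S; the symmetry can hence be
  differentiated.\<close>

lemma unit_normal_extension:
  fixes S :: "'a::euclidean_space set"
  assumes "smooth_hypersurface S" "unit_normal_field S N" "x \<in> S"
  obtains U V where "open U" "x \<in> U" "C_on 2 U V" "\<And>y. y \<in> S \<inter> U \<Longrightarrow> V y = N y"
    "\<And>y. y \<in> U \<Longrightarrow> V y \<bullet> V y = 1"
    "\<And>y u w. y \<in> U \<Longrightarrow> V y \<bullet> u = 0 \<Longrightarrow> V y \<bullet> w = 0 \<Longrightarrow>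
       frechet_derivative V (at y) u \<bullet> w = frechet_derivative V (at y) w \<bullet> u"
proof -
  obtain U b F W where U: "open U" "x \<in> U" and CF: "smooth_on U (F :: 'a \<Rightarrow> real)"
    and WF: "\<And>y v. y \<in> U \<Longrightarrow> W y \<bullet> v = v \<bullet> b - frechet_derivative F (at y) v"
    and CW: "\<And>k. C_on k U W"
    and ne: "\<And>y. y \<in> S \<inter> U \<Longrightarrow> W y \<noteq> 0"
    and tan: "\<And>y v. y \<in> S \<inter> U \<Longrightarrow> W y \<bullet> v = 0 \<Longrightarrow> v \<in> tangent_space S y"
    by (rule hypersurface_gradient[OF assms(1,3)]) (rule that)
  have DW: "(W has_derivative frechet_derivative W (at y)) (at y)" if "y \<in> U" for y
    using C_on_Suc_deriv[OF CW that] .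
  have sym: "frechet_derivative W (at y) u \<bullet> w = frechet_derivative W (at y) w \<bullet> u" if y: "y \<in> U"
      for y u w
  proof -
    \<comment> \<open>Up to sign the derivative of W is the Hessian of F, so its symmetry is that of
      second derivatives.\<close>
    have *: "w \<bullet> frechet_derivative W (at y) u = - frechet_derivative (\<lambda>y. frechet_derivative F
        (at y) w) (at y) u" for u w
    proof -
      have "(\<lambda>y. frechet_derivative F (at y) w) differentiable (at y)"
        using smooth_onD[OF CF, of "Suc (Suc 0)"] y by simp
      from has_derivative_diff[OF has_derivative_const has_frechet_derivative[OF this], of "w \<bullet> b"]
      have "((\<lambda>y. w \<bullet> W y) has_derivative (\<lambda>u. 0 - frechet_derivative (\<lambda>y. frechet_derivative F
          (at y) w) (at y) u)) (at y)"
        by (rule has_derivative_transform_within_open[OF _ U(1) y]) (simp add: WF inner_commute[of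
            w "W _"])
      from has_derivative_unique[OF this has_derivative_inner_right[OF DW[OF y]]]
      show ?thesis by (simp add: fun_eq_iff)
    qed
    show ?thesis
      using C_on_2_symmetric[OF U(1) smooth_onD[OF CF] y, of u w] *[of u w] *[of w u]
      by (simp add: inner_commute)
  qed
  obtain U1 N1 where U1: "open U1" "x \<in> U1" and C1: "smooth_on U1 N1" and N1: "\<And>y. y \<in> S \<inter> U1 \<Longrightarrow> N1
      y = N y"
    using assms(2,3) unfolding unit_normal_field_def smooth_along_def by blast
  have cW: "continuous_on U W" using CW[of 0] by simp
  \<comment> \<open>W is known to be nonzero only on S; by continuity it is nonzero on an open set
    around x.\<close>
  define U0 where "U0 = U - {y. y \<in> U \<and> W y = 0}"
  have "U0 = U \<inter> W -` (- {0})" by (auto simp: U0_def)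
  then have U0: "open U0" "x \<in> U0" "U0 \<subseteq> U" "\<And>y. y \<in> U0 \<Longrightarrow> W y \<noteq> 0"
    using continuous_open_preimage[OF cW U(1), of "- {0}"] ne U(2) assms(3) by auto
  define r where "r y = (W y \<bullet> W y) powr (- 1/2)" for y
  have r: "r y * (r y * (W y \<bullet> W y)) = 1" "r y > 0" if "y \<in> U0" for y
  proof -
    have "W y \<bullet> W y > 0" using U0(4)[OF that] by simp
    then have "r y * (r y * (W y \<bullet> W y)) = (W y \<bullet> W y) powr (- 1/2 + - 1/2 + 1)"
      unfolding r_def powr_add by simp
    then show "r y * (r y * (W y \<bullet> W y)) = 1" using \<open>W y \<bullet> W y > 0\<close> by simp
    show "r y > 0" using \<open>W y \<bullet> W y > 0\<close> by (simp add: r_def)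
  qed
  have CW0: "C_on k U0 W" for k using C_on_subset[OF CW U0(3)] .
  have Cr: "C_on k U0 r" for k
    unfolding r_def using U0 by (intro C_on_powr C_on_inner CW0) auto
  define V0 where "V0 y = r y *\<^sub>R W y" for y
  have CV0: "C_on k U0 V0" for k
    unfolding V0_def using U0 by (intro C_on_scaleR Cr CW0) auto
  have V0: "V0 y \<bullet> V0 y = 1" if "y \<in> U0" for y
    using r[OF that] by (simp add: V0_def)
  have NV0: "N y = (N y \<bullet> V0 y) *\<^sub>R V0 y" if y: "y \<in> S \<inter> U0" for y
  proof -
    have "N y = (N y \<bullet> V0 y / (V0 y \<bullet> V0 y)) *\<^sub>R V0 y"
    proof (rule unit_vector_parallel)
      show "N y \<bullet> N y = 1" using unit_normal_fieldD[OF assms(2)] y by blast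
      fix v assume "V0 y \<bullet> v = 0"
      then have "W y \<bullet> v = 0" using r(2)[of y] y by (simp add: V0_def)
      then show "N y \<bullet> v = 0" using tan[of y v] y U0 unit_normal_fieldD(3)[OF assms(2), of y v] by auto
    next
      show "V0 y \<noteq> 0" using V0[of y] y by auto
    qed
    then show ?thesis using V0 y by simp
  qed
  have NV0sq: "(N y \<bullet> V0 y)\<^sup>2 = 1" if y: "y \<in> S \<inter> U0" for y
  proof -
    have "N y \<bullet> N y = N y \<bullet> ((N y \<bullet> V0 y) *\<^sub>R V0 y)" using NV0[OF y] by simp
    then show ?thesis using unit_normal_fieldD(2)[OF assms(2), of y] y by (simp add: power2_eq_square)
  qed
  \<comment> \<open>On S the fields N and V0 agree up to a sign that could vary from point to point.
    The local extension N1 of N is continuous, so the sign equals e on the neighbourhood U2.\<close>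
  define e where "e = N x \<bullet> V0 x"
  have e: "e * e = 1" using NV0sq[of x] assms(3) U0 by (simp add: e_def power2_eq_square)
  define U2 where "U2 = {y \<in> U0 \<inter> U1. e * (N1 y \<bullet> V0 y) > 0}"
  have c: "continuous_on (U0 \<inter> U1) (\<lambda>y. e * (N1 y \<bullet> V0 y))"
    using C_on_continuous_on[OF CV0] C_on_continuous_on[OF smooth_onD[OF C1]]
    by (intro continuous_intros) (auto intro: continuous_on_subset)
  have "U2 = (U0 \<inter> U1) \<inter> (\<lambda>y. e * (N1 y \<bullet> V0 y)) -` {0<..}" by (auto simp: U2_def)
  then have oU2: "open U2" using continuous_open_preimage[OF c open_Int[OF U0(1) U1(1)], of
      "{0<..}"] by simp
  have x2: "x \<in> U2" using U0 U1 N1[of x] assms(3) e by (simp add: U2_def e_def)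
  have sub: "U2 \<subseteq> U0" "U2 \<subseteq> U" using U0 by (auto simp: U2_def)
  define V where "V y = e *\<^sub>R V0 y" for y
  have CV: "C_on k U2 V" for k
    unfolding V_def using oU2 C_on_subset[OF CV0 sub(1)] by (intro C_on_scaleR C_on_const) auto
  show thesis
  proof (rule that[OF oU2 x2 CV])
    fix y assume y: "y \<in> S \<inter> U2"
    then have "e * (N y \<bullet> V0 y) > 0" "(N y \<bullet> V0 y)\<^sup>2 = 1" using NV0sq[of y] N1[of y] by (auto
        simp: U2_def)
    moreover have "e\<^sup>2 = 1" using e by (simp add: power2_eq_square)
    ultimately have "N y \<bullet> V0 y = e" by (auto simp: power2_eq_1_iff)
    then show "V y = N y" using NV0[of y] y sub by (auto simp: V_def)
  next
    fix y assume y: "y \<in> U2"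
    then have "V0 y \<bullet> V0 y = 1" using V0 sub by blast
    then show "V y \<bullet> V y = 1" using e by (simp add: V_def)
    fix u w assume uw: "V y \<bullet> u = 0" "V y \<bullet> w = 0"
    have y': "y \<in> U0" "y \<in> U" using y sub by auto
    have en: "e \<noteq> 0" using e by auto
    have Wuw: "W y \<bullet> u = 0" "W y \<bullet> w = 0"
      using uw r(2)[OF y'(1)] en by (auto simp: V_def V0_def)
    define Dr where "Dr = frechet_derivative r (at y)"
    have Dr: "(r has_derivative Dr) (at y)" unfolding Dr_def using C_on_Suc_deriv[OF Cr y'(1)] .
    \<comment> \<open>Differentiating the factor r contributes only a multiple of W y, which is
      orthogonal to u and w; the symmetry of the derivative of W is therefore inherited.\<close>
    have "(V has_derivative (\<lambda>h. e *\<^sub>R (r y *\<^sub>R frechet_derivative W (at y) h + Dr h *\<^sub>R W y))) (at y)"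
      unfolding V_def V0_def using Dr DW[OF y'(2)]
      by (auto intro!: derivative_eq_intros simp: algebra_simps)
    note DV = fun_cong[OF frechet_derivative_at[OF this, symmetric]]
    then show "frechet_derivative V (at y) u \<bullet> w = frechet_derivative V (at y) w \<bullet> u"
      using Wuw sym[OF y'(2), of u w] by (simp add: DV inner_add_left)
  qed
qed

section \<open>Adapted frames and the shape operator\<close>

definition adapted_frame :: "'a::euclidean_space \<Rightarrow> (nat \<Rightarrow> 'a) \<Rightarrow> bool" where
  "adapted_frame a e \<longleftrightarrow> a \<bullet> a = 1 \<and> (\<forall>i<DIM('a) - 1. a \<bullet> e i = 0 \<and>
     (\<forall>j<DIM('a) - 1. e i \<bullet> e j = (if i = j then 1 else 0)))"

lemma adapted_frame_exists:
  fixes a :: "'a::euclidean_space"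
  assumes "a \<bullet> a = 1"
  obtains e where "adapted_frame a e"
proof -
  have a0: "a \<noteq> 0" using assms by auto
  obtain B where B: "B \<subseteq> {v. a \<bullet> v = 0}" "pairwise orthogonal B" "\<And>x. x \<in> B \<Longrightarrow> norm x = 1"
    "independent B" "card B = dim {v. a \<bullet> v = 0}"
    by (rule orthonormal_basis_subspace[OF subspace_hyperplane[of a]]) (rule that)
  have cB: "card B = DIM('a) - 1" using B(5) dim_hyperplane[OF a0] by simp
  have "finite B" using B(4) independent_bound by blast
  then obtain e where e: "bij_betw e {..<DIM('a) - 1} B"
    using ex_bij_betw_nat_finite[OF \<open>finite B\<close>] unfolding cB atLeast0LessThan by blast
  have "adapted_frame a e"
    unfolding adapted_frame_def
  proof (intro conjI allI impI)
    fix i assume i: "i < DIM('a) - 1"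
    then have ei: "e i \<in> B" using e by (auto simp: bij_betw_def)
    then show "a \<bullet> e i = 0" using B(1) by auto
    fix j assume j: "j < DIM('a) - 1"
    then have ej: "e j \<in> B" using e by (auto simp: bij_betw_def)
    show "e i \<bullet> e j = (if i = j then 1 else 0)"
    proof (cases "i = j")
      case True
      then show ?thesis using B(3)[OF ei] by (simp add: norm_eq_1)
    next
      case False
      then have "e i \<noteq> e j" using e i j by (auto simp: bij_betw_def inj_on_def)
      then show ?thesis using B(2) ei ej False by (auto simp: pairwise_def orthogonal_def)
    qed
  qed (rule assms)
  then show thesis by (rule that)
qed

text \<open>By dimension: a and the frame are \<open>DIM('a)\<close> orthonormal vectors and hence
  span the space.\<close>

lemma adapted_frame_expand:
  fixes a :: "'a::euclidean_space"
  assumes "adapted_frame a e"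
  shows "(u \<bullet> a) *\<^sub>R a + (\<Sum>i<DIM('a) - 1. (u \<bullet> e i) *\<^sub>R e i) = u"
proof -
  let ?n = "DIM('a) - 1"
  define B where "B = insert a (e ` {..<?n})"
  have aa: "a \<bullet> a = 1" and ae: "\<And>i. i < ?n \<Longrightarrow> a \<bullet> e i = 0"
    and ee: "\<And>i j. i < ?n \<Longrightarrow> j < ?n \<Longrightarrow> e i \<bullet> e j = (if i = j then 1 else 0)"
    using assms by (auto simp: adapted_frame_def)
  have finB: "finite B" by (simp add: B_def)
  have inj: "inj_on e {..<?n}"
  proof (rule inj_onI)
    fix i j assume "i \<in> {..<?n}" "j \<in> {..<?n}" "e i = e j"
    then have "e i \<bullet> e j = 1" using ee[of i i] by auto
    then show "i = j" using ee[of i j] \<open>i \<in> {..<?n}\<close> \<open>j \<in> {..<?n}\<close> by (auto split: if_splits)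
  qed
  have aB: "a \<notin> e ` {..<?n}" using aa ae by (metis imageE lessThan_iff zero_neq_one)
  have orth: "pairwise orthogonal B"
    using ae ee by (auto simp: B_def pairwise_def orthogonal_def inner_commute)
  have nrm: "norm b = 1" if "b \<in> B" for b
    using that aa ee by (auto simp: B_def norm_eq_1)
  have "card B = DIM('a)"
    using aB inj by (simp add: B_def card_image)
  moreover have "0 \<notin> B" using nrm[of 0] by auto
  ultimately have "UNIV \<subseteq> span B"
    by (intro card_ge_dim_independent pairwise_orthogonal_independent orth) auto
  then have "u = (\<Sum>b\<in>B. (u \<bullet> b) *\<^sub>R b)"
    using orthonormal_basis_expand[OF orth nrm _ finB, of u] by (simp add: subset_iff)
  also have "\<dots> = (u \<bullet> a) *\<^sub>R a + (\<Sum>i<?n. (u \<bullet> e i) *\<^sub>R e i)"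
    using aB sum.reindex[OF inj, of "\<lambda>b. (u \<bullet> b) *\<^sub>R b"] by (simp add: B_def)
  finally show ?thesis by simp
qed

lemma adapted_frame_inner:
  fixes a :: "'a::euclidean_space"
  assumes "adapted_frame a e"
  shows "u \<bullet> w = (u \<bullet> a) * (w \<bullet> a) + (\<Sum>i<DIM('a) - 1. (u \<bullet> e i) * (w \<bullet> e i))"
proof -
  have "u \<bullet> w = ((u \<bullet> a) *\<^sub>R a + (\<Sum>i<DIM('a) - 1. (u \<bullet> e i) *\<^sub>R e i)) \<bullet> w"
    by (simp only: adapted_frame_expand[OF assms])
  then show ?thesis by (simp add: inner_add_left inner_sum_left inner_commute[of w])
qed

text \<open>The trace of a bilinear form does not depend on the orthonormal basis. This trades a
  frame, which varies with the point, for the fixed standard basis.\<close>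

lemma adapted_frame_trace:
  fixes a :: "'a::euclidean_space" and q :: "'a \<Rightarrow> 'a \<Rightarrow> real"
  assumes e: "adapted_frame a e" and l1: "\<And>w. linear (\<lambda>u. q u w)" and l2: "\<And>u. linear (q u)"
  shows "(\<Sum>b\<in>Basis. q b b) = q a a + (\<Sum>i<DIM('a) - 1. q (e i) (e i))"
proof -
  \<comment> \<open>The option index joins a and the frame into one orthonormal family.\<close>
  let ?I = "insert None (Some ` {..<DIM('a) - 1})"
  define f where "f i = (case i of None \<Rightarrow> a | Some i \<Rightarrow> e i)" for i
  have sum_f: "(\<Sum>i\<in>?I. h (f i)) = h a + (\<Sum>i<DIM('a) - 1. h (e i))" for h :: "'a \<Rightarrow> 'c::comm_monoid_add"
    by (simp add: f_def sum.reindex)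
  have ff: "f i \<bullet> f j = (if i = j then 1 else 0)" if "i \<in> ?I" "j \<in> ?I" for i j
    using that e by (auto simp: f_def adapted_frame_def inner_commute split: option.splits)
  have ex: "(\<Sum>i\<in>?I. (b \<bullet> f i) *\<^sub>R f i) = b" for b
    using sum_f[of "\<lambda>v. (b \<bullet> v) *\<^sub>R v"] adapted_frame_expand[OF e, of b] by simp
  have "(\<Sum>b\<in>Basis. q b b) = (\<Sum>b\<in>Basis. q (\<Sum>i\<in>?I. (b \<bullet> f i) *\<^sub>R f i) (\<Sum>j\<in>?I. (b \<bullet> f j) *\<^sub>R f j))"
    by (simp only: ex)
  also have "\<dots> = (\<Sum>b\<in>Basis. \<Sum>i\<in>?I. \<Sum>j\<in>?I. (b \<bullet> f i) * (b \<bullet> f j) * q (f j) (f i))"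
    by (simp only: linear_sum[OF l1] linear_sum[OF l2] linear_scale[OF l1] linear_scale[OF l2]
        real_scaleR_def sum_distrib_left mult.assoc)
  also have "\<dots> = (\<Sum>i\<in>?I. \<Sum>b\<in>Basis. \<Sum>j\<in>?I. (b \<bullet> f i) * (b \<bullet> f j) * q (f j) (f i))"
    by (rule sum.swap)
  also have "\<dots> = (\<Sum>i\<in>?I. \<Sum>j\<in>?I. \<Sum>b\<in>Basis. (b \<bullet> f i) * (b \<bullet> f j) * q (f j) (f i))"
    by (intro sum.cong refl sum.swap)
  also have "\<dots> = (\<Sum>i\<in>?I. \<Sum>j\<in>?I. (f i \<bullet> f j) * q (f j) (f i))"
  proof -
    have "f i \<bullet> f j = (\<Sum>b\<in>Basis. (b \<bullet> f i) * (b \<bullet> f j))" for i j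
      by (subst euclidean_inner) (simp add: inner_commute)
    then show ?thesis by (simp only: sum_distrib_right)
  qed
  also have "\<dots> = (\<Sum>i\<in>?I. q (f i) (f i))"
  proof (intro sum.cong refl)
    fix i assume i: "i \<in> ?I"
    have "(\<Sum>j\<in>?I. (f i \<bullet> f j) * q (f j) (f i)) = (\<Sum>j\<in>?I. if i = j then q (f j) (f i) else 0)"
      using ff i by (intro sum.cong) auto
    also have "\<dots> = q (f i) (f i)" using i by (subst sum.delta') auto
    finally show "(\<Sum>j\<in>?I. (f i \<bullet> f j) * q (f j) (f i)) = q (f i) (f i)" .
  qed
  also have "\<dots> = q a a + (\<Sum>i<DIM('a) - 1. q (e i) (e i))" by (rule sum_f)
  finally show ?thesis .
qed

text \<open>For unit vectors with \<open>a \<bullet> c \<noteq> -1\<close> this rotates a to c in the plane they span; applied to a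
  fixed basis of the orthogonal complement of a it yields a frame depending smoothly on c.\<close>

definition plane_rotation :: "'a::euclidean_space \<Rightarrow> 'a \<Rightarrow> 'a \<Rightarrow> 'a" where
  "plane_rotation a c u = u - ((u \<bullet> c) * (1 + a \<bullet> c) powr (-1)) *\<^sub>R (a + c)"

text \<open>Everything rests on |a + c|^2 = 2 (1 + a . c), by which the quadratic term in the inner
  product of two images cancels the two linear ones.\<close>

lemma adapted_frame_rotation:
  assumes e: "adapted_frame a e" and c: "c \<bullet> c = 1" and pos: "0 < 1 + a \<bullet> c"
  shows "adapted_frame c (\<lambda>i. plane_rotation a c (e i))"
  unfolding adapted_frame_def
proof (intro conjI allI impI c)
  let ?n = "DIM('a) - 1"
  have aa: "a \<bullet> a = 1" and ae: "\<And>i. i < ?n \<Longrightarrow> a \<bullet> e i = 0"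
    and ee: "\<And>i j. i < ?n \<Longrightarrow> j < ?n \<Longrightarrow> e i \<bullet> e j = (if i = j then 1 else 0)"
    using e by (auto simp: adapted_frame_def)
  define r where "r = (1 + a \<bullet> c) powr (-1)"
  have r: "r * (1 + a \<bullet> c) = 1" using pos by (simp add: r_def powr_minus)
  have pr: "plane_rotation a c u = u - ((u \<bullet> c) * r) *\<^sub>R (a + c)" for u
    by (simp only: plane_rotation_def r_def)
  have cac: "c \<bullet> (a + c) = 1 + a \<bullet> c" by (simp add: inner_add_right c inner_commute)
  have ac2: "(a + c) \<bullet> (a + c) = 2 * (1 + a \<bullet> c)"
    by (simp add: inner_add_left inner_add_right aa c inner_commute)
  fix i assume i: "i < ?n"
  have eac: "e i \<bullet> (a + c) = e i \<bullet> c" if "i < ?n" for i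
    using ae[OF that] by (simp add: inner_add_right inner_commute)
  have "c \<bullet> plane_rotation a c (e i) = e i \<bullet> c - (e i \<bullet> c) * (r * (1 + a \<bullet> c))"
    by (simp add: pr inner_diff_right cac inner_commute[of c "e i"] mult.assoc)
  then show "c \<bullet> plane_rotation a c (e i) = 0" by (simp add: r)
  fix j assume j: "j < ?n"
  have "plane_rotation a c (e i) \<bullet> plane_rotation a c (e j) =
      e i \<bullet> e j - 2 * (e i \<bullet> c) * (e j \<bullet> c) * r
      + (e i \<bullet> c) * (e j \<bullet> c) * r * (r * ((a + c) \<bullet> (a + c)))"
  proof -
    have "(a + c) \<bullet> e j = e j \<bullet> c" using eac[OF j] by (simp add: inner_commute)
    then show ?thesis
      unfolding pr inner_diff_left inner_diff_right inner_scaleR_left inner_scaleR_right eac[OF i]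
      by (simp add: algebra_simps)
  qed
  also have "r * ((a + c) \<bullet> (a + c)) = 2" unfolding ac2 using r by (simp add: algebra_simps)
  finally show "plane_rotation a c (e i) \<bullet> plane_rotation a c (e j) = (if i = j then 1 else 0)"
    using ee[OF i j] by (simp add: algebra_simps)
qed

text \<open>Gives meaning to the choice in \<open>frame\<close>. A frame at x is carried to y by the
  rotation from N x to N y, which depends smoothly on y as long as
  \<open>1 + N x \<bullet> N y\<close> stays positive.\<close>

lemma local_frame_exists:
  fixes S :: "'a::euclidean_space set"
  assumes S: "smooth_hypersurface S" and N: "unit_normal_field S N" and x: "x \<in> S"
  shows "\<exists>e. local_frame S x e"
proof -
  note normal_unit = unit_normal_fieldD(2)[OF N]
  obtain e where e: "adapted_frame (N x) e" by (rule adapted_frame_exists[OF normal_unit[OF x]])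
  obtain U1 N1 where U1: "open U1" "x \<in> U1" and C1: "smooth_on U1 N1" and N1: "\<And>y. y \<in> S \<inter> U1 \<Longrightarrow> N1
      y = N y"
    using N x unfolding unit_normal_field_def smooth_along_def by blast
  have CN: "C_on k U1 N1" for k using C1 by (rule smooth_onD)
  define U where "U = {y \<in> U1. 0 < 1 + N x \<bullet> N1 y}"
  have c: "continuous_on U1 (\<lambda>y. 1 + N x \<bullet> N1 y)"
    using C_on_continuous_on[OF CN] by (intro continuous_intros)
  have "U = U1 \<inter> (\<lambda>y. 1 + N x \<bullet> N1 y) -` {0<..}" by (auto simp: U_def)
  then have oU: "open U" using continuous_open_preimage[OF c U1(1), of "{0<..}"] by simp
  have xU: "x \<in> U" using N1[of x] U1 x normal_unit[OF x] by (simp add: U_def)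
  have CN': "C_on k U N1" for k using C_on_subset[OF CN] by (auto simp: U_def)
  have "smooth_on U (\<lambda>y. plane_rotation (N x) (N1 y) (e i))" for i
    unfolding smooth_on_def plane_rotation_def
  proof
    show "C_on k U (\<lambda>y. e i - ((e i \<bullet> N1 y) * (1 + N x \<bullet> N1 y) powr (-1)) *\<^sub>R (N x + N1 y))" for k
      by (intro C_on_diff C_on_const C_on_scaleR C_on_mult C_on_inner C_on_powr C_on_add oU CN')
         (simp add: U_def)
  qed
  moreover have "plane_rotation (N x) (N1 y) (e i) = plane_rotation (N x) (N y) (e i)" if "y \<in> S \<inter>
      U" for y i
    using N1[of y] that by (simp add: U_def)
  ultimately have sm: "smooth_along (S \<inter> U) (\<lambda>y. plane_rotation (N x) (N y) (e i))" for i
    unfolding smooth_along_def using oU by blast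
  have af: "adapted_frame (N y) (\<lambda>i. plane_rotation (N x) (N y) (e i))" if "y \<in> S \<inter> U" for y
    using that N1[of y] by (intro adapted_frame_rotation e normal_unit) (auto simp: U_def)
  then have "local_frame S x (\<lambda>i y. plane_rotation (N x) (N y) (e i))"
    unfolding local_frame_def
    using oU xU sm tangent_space_eq[OF S N] by (intro exI[of _ U]) (auto simp: adapted_frame_def)
  then show ?thesis by blast
qed

lemma local_frame_frame:
  assumes "smooth_hypersurface S" "unit_normal_field S N" "x \<in> S"
  shows "local_frame S x (frame S x)"
  unfolding frame_def by (rule someI_ex[OF local_frame_exists[OF assms]])

lemma frame_extension:
  fixes S :: "'a::euclidean_space set"
  assumes S: "smooth_hypersurface S" and N: "unit_normal_field S N" and x: "x \<in> S"
    and j: "j < DIM('a) - 1"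
  obtains U g where "open U" "x \<in> U" "C_on 1 U g" "\<And>y. y \<in> S \<inter> U \<Longrightarrow> g y = frame S x j y"
    "\<And>y. y \<in> S \<inter> U \<Longrightarrow> N y \<bullet> g y = 0"
proof -
  obtain U where U: "open U" "x \<in> U" and sm: "smooth_along (S \<inter> U) (frame S x j)"
    and t: "\<And>y. y \<in> S \<inter> U \<Longrightarrow> frame S x j y \<in> tangent_space S y"
    using local_frame_frame[OF assms(1-3)] j unfolding local_frame_def by blast
  obtain U1 g where U1: "open U1" "x \<in> U1" "smooth_on U1 g" "\<And>y. y \<in> S \<inter> U \<inter> U1 \<Longrightarrow> g y = frame S x j y"
    using sm[unfolded smooth_along_def, rule_format, of x] x U by auto
  show thesis
  proof (rule that[of "U \<inter> U1" g])
    show "C_on 1 (U \<inter> U1) g" using smooth_onD[OF U1(3)] by (rule C_on_subset) auto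
    fix y assume "y \<in> S \<inter> (U \<inter> U1)"
    then show "g y = frame S x j y" "N y \<bullet> g y = 0"
      using U1(4)[of y] t[of y] unit_normal_fieldD(3)[OF N, of y] by auto
  qed (use U U1 in auto)
qed

definition tan_part :: "'a::euclidean_space \<Rightarrow> 'a \<Rightarrow> 'a" where
  "tan_part a u = u - (u \<bullet> a) *\<^sub>R a"

lemma tan_part_orthogonal [simp]:
  assumes "a \<bullet> a = 1" shows "a \<bullet> tan_part a u = 0"
  using assms by (simp add: tan_part_def inner_diff_right inner_commute)

lemma tan_part_id: "a \<bullet> u = 0 \<Longrightarrow> tan_part a u = u"
  by (simp add: tan_part_def inner_commute)

lemma tan_part_self [simp]: "a \<bullet> a = 1 \<Longrightarrow> tan_part a a = 0"
  by (simp add: tan_part_def)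

lemma linear_tan_part: "linear (tan_part a)"
  by (rule linearI) (simp_all add: tan_part_def inner_add_left algebra_simps)

lemma norm_tan_part_sq: "a \<bullet> a = 1 \<Longrightarrow> (norm (tan_part a u))\<^sup>2 = (norm u)\<^sup>2 - (u \<bullet> a)\<^sup>2"
  unfolding power2_norm_eq_inner tan_part_def
  by (simp add: inner_diff_left inner_diff_right inner_commute power2_eq_square)

lemma norm_tan_part_le: "a \<bullet> a = 1 \<Longrightarrow> norm (tan_part a u) \<le> norm u"
  using norm_tan_part_sq[of a u] by (simp add: norm_le_square power2_norm_eq_inner[symmetric])

text \<open>The projection is there because \<open>deriv_along\<close> is meaningful on tangent
  vectors only. The sign is that of the derivative of N: the trace is H, while the matrix is minus
  \<open>second_ff\<close>.\<close>

definition shape_op :: "'a::euclidean_space set \<Rightarrow> ('a \<Rightarrow> 'a) \<Rightarrow> 'a \<Rightarrow> 'a \<Rightarrow> 'a" where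
  "shape_op S N x u = deriv_along S N x (tan_part (N x) u)"

section \<open>The shape operator and the second fundamental form\<close>

locale oriented_hypersurface =
  fixes S :: "'a::euclidean_space set" and N :: "'a \<Rightarrow> 'a"
  assumes hyp: "smooth_hypersurface S" and nor: "unit_normal_field S N"
begin

lemma normal_unit: "x \<in> S \<Longrightarrow> N x \<bullet> N x = 1"
  by (rule unit_normal_fieldD(2)[OF nor])

lemma tangent_iff: "x \<in> S \<Longrightarrow> v \<in> tangent_space S x \<longleftrightarrow> N x \<bullet> v = 0"
  using tangent_space_eq[OF hyp nor] by auto

lemma frame_adapted:
  assumes "x \<in> S" shows "adapted_frame (N x) (\<lambda>i. frame S x i x)"
  using local_frame_frame[OF hyp nor assms] assms normal_unit tangent_iff
  by (auto simp: local_frame_def adapted_frame_def)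

lemma frame_orthogonal: "x \<in> S \<Longrightarrow> i < DIM('a) - 1 \<Longrightarrow> N x \<bullet> frame S x i x = 0"
  using frame_adapted by (auto simp: adapted_frame_def)

lemma frame_tangent: "x \<in> S \<Longrightarrow> i < DIM('a) - 1 \<Longrightarrow> frame S x i x \<in> tangent_space S x"
  by (simp add: tangent_iff frame_orthogonal)

lemma tangent_proj_eq:
  assumes "y \<in> S" shows "tangent_proj S y u = tan_part (N y) u"
  unfolding tangent_proj_def
proof (rule the_equality)
  show "tan_part (N y) u \<in> tangent_space S y \<and> (\<forall>w\<in>tangent_space S y. orthogonal (u - tan_part (N
      y) u) w)"
    using normal_unit[OF assms] by (auto simp: tangent_iff[OF assms] orthogonal_def) (simp add:
        tan_part_def)
next
  fix p assume p: "p \<in> tangent_space S y \<and> (\<forall>w\<in>tangent_space S y. orthogonal (u - p) w)"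
  define d where "d = tan_part (N y) u - p"
  have d: "N y \<bullet> d = 0"
    using p normal_unit[OF assms] by (simp add: d_def tangent_iff[OF assms] inner_diff_right)
  then have "(u - p) \<bullet> d = 0" using p by (simp add: tangent_iff[OF assms] orthogonal_def)
  moreover have "u - p = d + (u \<bullet> N y) *\<^sub>R N y" by (simp add: d_def tan_part_def)
  ultimately have "d \<bullet> d = 0" using d by (simp add: inner_add_left)
  then show "p = tan_part (N y) u" by (simp add: d_def)
qed

definition normal_ext :: "'a set \<Rightarrow> ('a \<Rightarrow> 'a) \<Rightarrow> bool" where
  "normal_ext U V \<longleftrightarrow> open U \<and> C_on 2 U V \<and> (\<forall>y\<in>S \<inter> U. V y = N y) \<and> (\<forall>y\<in>U. V y \<bullet> V y = 1) \<and>
     (\<forall>y\<in>U. \<forall>u w. V y \<bullet> u = 0 \<longrightarrow> V y \<bullet> w = 0 \<longrightarrow>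
       frechet_derivative V (at y) u \<bullet> w = frechet_derivative V (at y) w \<bullet> u)"

lemma normal_ext_exists: "x \<in> S \<Longrightarrow> \<exists>U V. x \<in> U \<and> normal_ext U V"
  using unit_normal_extension[OF hyp nor] unfolding normal_ext_def by metis

context
  fixes U V assumes ext: "normal_ext U V"
begin

lemma ext_open: "open U" and ext_C2: "C_on 2 U V"
  and ext_eq: "y \<in> S \<Longrightarrow> y \<in> U \<Longrightarrow> V y = N y" and ext_unit: "y \<in> U \<Longrightarrow> V y \<bullet> V y = 1"
  using ext by (auto simp: normal_ext_def)

lemma ext_C1: "C_on 1 U V" by (rule C_on_le[OF ext_C2]) simp

lemma ext_deriv: "y \<in> U \<Longrightarrow> (V has_derivative frechet_derivative V (at y)) (at y)"
  using C_on_Suc_deriv[of 0] ext_C1 by simp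

lemma ext_linear: "y \<in> U \<Longrightarrow> linear (frechet_derivative V (at y))"
  using ext_deriv has_derivative_linear by blast

text \<open>Differentiate |V|^2 = 1, which holds on all of U and therefore in every
  direction.\<close>

lemma ext_normal:
  assumes y: "y \<in> U" shows "V y \<bullet> frechet_derivative V (at y) u = 0"
proof -
  have "((\<lambda>y. V y \<bullet> V y) has_derivative (\<lambda>h. V y \<bullet> frechet_derivative V (at y) h +
      frechet_derivative V (at y) h \<bullet> V y)) (at y)"
    by (intro has_derivative_inner ext_deriv y)
  moreover have "((\<lambda>y. V y \<bullet> V y) has_derivative (\<lambda>h. 0)) (at y)"
    by (rule has_derivative_transform_within_open[OF has_derivative_const[of 1] ext_open y]) (simp
        add: ext_unit)
  ultimately have "(\<lambda>h. V y \<bullet> frechet_derivative V (at y) h + frechet_derivative V (at y) h \<bullet> V y)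
      = (\<lambda>h. 0)"
    by (rule has_derivative_unique)
  from fun_cong[OF this, of u] show ?thesis by (simp add: inner_commute)
qed

lemma ext_symmetric:
  assumes y: "y \<in> U"
  shows "frechet_derivative V (at y) (tan_part (V y) u) \<bullet> w
       = frechet_derivative V (at y) (tan_part (V y) w) \<bullet> u"
proof -
  have *: "frechet_derivative V (at y) v \<bullet> w = frechet_derivative V (at y) v \<bullet> tan_part (V y) w" for v w
    using ext_normal[OF y, of v] by (simp add: tan_part_def inner_diff_right inner_commute)
  have "frechet_derivative V (at y) (tan_part (V y) u) \<bullet> tan_part (V y) w
      = frechet_derivative V (at y) (tan_part (V y) w) \<bullet> tan_part (V y) u"
    using ext y tan_part_orthogonal[OF ext_unit[OF y]] unfolding normal_ext_def by blast
  then show ?thesis by (simp only: *[symmetric])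
qed

lemma shape_ext:
  assumes "x \<in> S" "x \<in> U"
  shows "shape_op S N x u = frechet_derivative V (at x) (tan_part (V x) u)"
proof -
  have "V x = N x" using ext_eq assms by blast
  then show ?thesis
    unfolding shape_op_def using assms ext_open ext_eq normal_unit[OF assms(1)]
    by (subst deriv_along_extension[OF ext_deriv[OF assms(2)], of U]) (auto simp: tangent_iff)
qed

end

lemma shape_linear:
  assumes "x \<in> S" shows "linear (shape_op S N x)"
proof -
  obtain U V where U: "x \<in> U" "normal_ext U V" using normal_ext_exists[OF assms] by blast
  have "linear (frechet_derivative V (at x) \<circ> tan_part (V x))"
    by (intro linear_compose linear_tan_part ext_linear[OF U(2,1)])
  moreover have "frechet_derivative V (at x) \<circ> tan_part (V x) = shape_op S N x"
    by (simp add: fun_eq_iff shape_ext[OF U(2) assms U(1)])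
  ultimately show ?thesis by simp
qed

lemma shape_symmetric:
  assumes "x \<in> S" shows "shape_op S N x u \<bullet> w = shape_op S N x w \<bullet> u"
proof -
  obtain U V where U: "x \<in> U" "normal_ext U V" using normal_ext_exists[OF assms] by blast
  then show ?thesis using ext_symmetric[OF U(2,1)] shape_ext[OF U(2) assms U(1)] by simp
qed

lemma shape_normal:
  assumes "x \<in> S" shows "N x \<bullet> shape_op S N x u = 0"
proof -
  obtain U V where U: "x \<in> U" "normal_ext U V" using normal_ext_exists[OF assms] by blast
  then show ?thesis
    using ext_normal[OF U(2,1)] shape_ext[OF U(2) assms U(1)] ext_eq[OF U(2) assms U(1)] by simp
qed

lemma shape_N [simp]: "x \<in> S \<Longrightarrow> shape_op S N x (N x) = 0"
  using shape_symmetric[of x "N x" "shape_op S N x (N x)"] shape_normal[of x]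
  by (simp add: inner_commute)

lemma shape_tan_part: "x \<in> S \<Longrightarrow> shape_op S N x (tan_part (N x) u) = shape_op S N x u"
  by (simp add: tan_part_def linear_diff[OF shape_linear] linear_scale[OF shape_linear])

lemma shape_continuous: "continuous_on S (\<lambda>x. shape_op S N x u)"
proof -
  have "continuous (at x within S) (\<lambda>x. shape_op S N x u)" if x: "x \<in> S" for x
  proof -
    obtain U V where U: "x \<in> U" "normal_ext U V" using normal_ext_exists[OF x] by blast
    have o: "open U" by (rule ext_open[OF U(2)])
    have c: "continuous_on U (\<lambda>y. frechet_derivative V (at y) v)" for v
      using ext_C1[OF U(2)] by simp
    have cV: "continuous_on U V" using C_on_continuous_on[OF ext_C1[OF U(2)]] .
    \<comment> \<open>\<open>C_on\<close> gives continuity of the derivative in fixed directions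
      only, so the moving direction V y is expanded in the standard basis.\<close>
    have "continuous_on U (\<lambda>y. frechet_derivative V (at y) u - (u \<bullet> V y) *\<^sub>R (\<Sum>b\<in>Basis. (V y \<bullet> b)
        *\<^sub>R frechet_derivative V (at y) b))"
      by (intro continuous_intros c cV)
    then have "continuous_on (S \<inter> U) (\<lambda>y. frechet_derivative V (at y) u - (u \<bullet> V y) *\<^sub>R (\<Sum>b\<in>Basis.
        (V y \<bullet> b) *\<^sub>R frechet_derivative V (at y) b))"
      by (rule continuous_on_subset) auto
    then have "continuous_on (S \<inter> U) (\<lambda>y. shape_op S N y u)"
    proof (rule continuous_on_eq)
      fix y assume y: "y \<in> S \<inter> U"
      then have l: "linear (frechet_derivative V (at y))" using ext_linear[OF U(2)] by blast
      have "frechet_derivative V (at y) (V y) = frechet_derivative V (at y) (\<Sum>b\<in>Basis. (V y \<bullet> b) *\<^sub>R b)"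
        by (simp add: euclidean_representation)
      also have "\<dots> = (\<Sum>b\<in>Basis. (V y \<bullet> b) *\<^sub>R frechet_derivative V (at y) b)"
        by (simp add: linear_sum[OF l] linear_scale[OF l])
      finally show "frechet_derivative V (at y) u - (u \<bullet> V y) *\<^sub>R (\<Sum>b\<in>Basis. (V y \<bullet> b) *\<^sub>R
          frechet_derivative V (at y) b) = shape_op S N y u"
        using shape_ext[OF U(2), of y u] y by (simp add: tan_part_def linear_diff[OF l]
            linear_scale[OF l])
    qed
    moreover have "at x within S = at x within (S \<inter> U)"
      using U(1) o by (rule at_within_nhd) auto
    ultimately show ?thesis
      using U(1) x by (auto simp: continuous_on_eq_continuous_within continuous_within)
  qed
  then show ?thesis by (simp add: continuous_on_eq_continuous_within)
qed

text \<open>Differentiate the inner product of N and the j-th frame field, which is 0 on S, in the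
  direction of the i-th frame vector.\<close>

lemma second_ff_eq:
  assumes x: "x \<in> S" and i: "i < DIM('a) - 1" and j: "j < DIM('a) - 1"
  shows "second_ff S N x i j = - (shape_op S N x (frame S x i x) \<bullet> frame S x j x)"
proof -
  obtain U V where U: "x \<in> U" "normal_ext U V" using normal_ext_exists[OF x] by blast
  obtain U' g where U': "open U'" "x \<in> U'" "C_on 1 U' g" "\<And>y. y \<in> S \<inter> U' \<Longrightarrow> g y = frame S x j y"
    and ng: "\<And>y. y \<in> S \<inter> U' \<Longrightarrow> N y \<bullet> g y = 0"
    by (rule frame_extension[OF hyp nor x j]) (rule that)
  let ?e = "frame S x i x"
  note t = frame_tangent[OF x i]
  have dg: "(g has_derivative frechet_derivative g (at x)) (at x)"
    using C_on_Suc_deriv[of 0] U'(2,3) by simp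
  have "((\<lambda>y. V y \<bullet> g y) has_derivative (\<lambda>h. V x \<bullet> frechet_derivative g (at x) h +
      frechet_derivative V (at x) h \<bullet> g x)) (at x)"
    by (intro has_derivative_inner ext_deriv[OF U(2,1)] dg)
  \<comment> \<open>The product of the extensions of N and of the frame field is an ambient
    extension of the zero function on S.\<close>
  from deriv_along_extension[OF this _ x _ _ t, of "U \<inter> U'" "\<lambda>_. 0"]
  have "deriv_along S (\<lambda>_. 0) x ?e = V x \<bullet> frechet_derivative g (at x) ?e + frechet_derivative V
      (at x) ?e \<bullet> g x"
    using U U' ng ext_open[OF U(2)] ext_eq[OF U(2)] by auto
  moreover have "deriv_along S (\<lambda>_. 0::real) x ?e = 0"
    using deriv_along_eq[OF has_derivative_const t] .
  moreover have "deriv_along S (frame S x j) x ?e = frechet_derivative g (at x) ?e"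
    by (rule deriv_along_extension[OF dg U'(1) x U'(2,4) t])
  moreover have "shape_op S N x ?e = frechet_derivative V (at x) ?e"
    using shape_ext[OF U(2) x U(1), of ?e] ext_eq[OF U(2) x U(1)] frame_orthogonal[OF x i]
    by (simp add: tan_part_id)
  ultimately show ?thesis
    using ext_eq[OF U(2) x U(1)] U'(4)[of x] x U'(2) by (simp add: second_ff_def inner_commute)
qed

lemma second_ff_norm_sq_frame:
  assumes x: "x \<in> S"
  shows "second_ff_norm_sq S N x =
    (\<Sum>i<DIM('a) - 1. shape_op S N x (frame S x i x) \<bullet> shape_op S N x (frame S x i x))"
  unfolding second_ff_norm_sq_def
proof (intro sum.cong refl)
  fix i assume i: "i \<in> {..<DIM('a) - 1}"
  show "(\<Sum>j<DIM('a) - 1. (second_ff S N x i j)\<^sup>2) = shape_op S N x (frame S x i x) \<bullet> shape_op S N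
      x (frame S x i x)"
    using i by (subst adapted_frame_inner[OF frame_adapted[OF x]])
      (auto simp: shape_normal[OF x] inner_commute[of _ "N x"] second_ff_eq[OF x] power2_eq_square
          intro!: sum.cong)
qed

lemma second_ff_norm_sq_eq:
  assumes x: "x \<in> S"
  shows "second_ff_norm_sq S N x = (\<Sum>b\<in>Basis. (norm (shape_op S N x b))\<^sup>2)"
proof -
  note l = shape_linear[OF x]
  have "(\<Sum>b\<in>Basis. (norm (shape_op S N x b))\<^sup>2) = (\<Sum>b\<in>Basis. shape_op S N x b \<bullet> shape_op S N x b)"
    by (simp add: power2_norm_eq_inner)
  also have "\<dots> = second_ff_norm_sq S N x"
    unfolding second_ff_norm_sq_frame[OF x]
    by (subst adapted_frame_trace[OF frame_adapted[OF x]])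
       (auto simp: x intro!: linearI simp: linear_add[OF l] linear_scale[OF l] inner_add_left
           inner_add_right)
  finally show ?thesis by simp
qed

text \<open>Coefficient vectors correspond isometrically to tangent vectors. Admitting all vectors
  of the unit ball leaves the supremum unchanged, since passing to the tangential part keeps W u and
  does not increase the norm.\<close>

lemma second_ff_opnorm_eq:
  assumes x: "x \<in> S"
  shows "second_ff_opnorm S N x = (SUP u\<in>cball 0 1. norm (shape_op S N x u))"
proof -
  note af = frame_adapted[OF x] and l = shape_linear[OF x]
  let ?n = "DIM('a) - 1" and ?W = "shape_op S N x"
  define h where "h c = (\<Sum>j<?n. c j *\<^sub>R frame S x j x)" for c :: "nat \<Rightarrow> real"
  have ee: "frame S x i x \<bullet> frame S x j x = (if i = j then 1 else 0)" if "i < ?n" "j < ?n" for i j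
    using af that by (simp add: adapted_frame_def)
  have hc: "h c \<bullet> frame S x i x = c i" if "i < ?n" for c i
  proof -
    have "h c \<bullet> frame S x i x = (\<Sum>j<?n. if j = i then c j else 0)"
      unfolding h_def inner_sum_left using that ee by (intro sum.cong) auto
    then show ?thesis using that by simp
  qed
  have hN: "h c \<bullet> N x = 0" for c
    unfolding h_def inner_sum_left
    by (intro sum.neutral) (auto simp: frame_orthogonal[OF x] inner_commute[of _ "N x"])
  have nh: "norm (h c) = L2_set c {..<?n}" for c
  proof -
    have "h c \<bullet> h c = (\<Sum>i<?n. (c i)\<^sup>2)"
      by (subst adapted_frame_inner[OF af]) (auto simp: hN hc power2_eq_square intro!: sum.cong)
    then show ?thesis by (simp add: norm_eq_sqrt_inner L2_set_def)
  qed
  have L: "L2_set (\<lambda>i. \<Sum>j<?n. second_ff S N x i j * c j) {..<?n} = norm (?W (h c))" for c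
  proof -
    have *: "(\<Sum>j<?n. second_ff S N x i j * c j) = - (?W (h c) \<bullet> frame S x i x)" if "i < ?n" for i
    proof -
      have "?W (h c) \<bullet> frame S x i x = ?W (frame S x i x) \<bullet> h c" by (rule shape_symmetric[OF x])
      also have "\<dots> = (\<Sum>j<?n. ?W (frame S x i x) \<bullet> frame S x j x * c j)"
        by (simp add: h_def inner_sum_right mult.commute)
      finally show ?thesis using that by (simp add: second_ff_eq[OF x] sum_negf)
    qed
    have "?W (h c) \<bullet> ?W (h c) = (\<Sum>i<?n. (?W (h c) \<bullet> frame S x i x) * (?W (h c) \<bullet> frame S x i x))"
      by (subst adapted_frame_inner[OF af]) (simp add: shape_normal[OF x] inner_commute[of _ "N x"])
    also have "\<dots> = (\<Sum>i<?n. (\<Sum>j<?n. second_ff S N x i j * c j)\<^sup>2)"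
      by (intro sum.cong refl) (simp only: * lessThan_iff power2_eq_square minus_mult_minus)
    finally have "?W (h c) \<bullet> ?W (h c) = (\<Sum>i<?n. (\<Sum>j<?n. second_ff S N x i j * c j)\<^sup>2)" .
    then show ?thesis by (simp add: norm_eq_sqrt_inner L2_set_def)
  qed
  have "(\<lambda>c. L2_set (\<lambda>i. \<Sum>j<?n. second_ff S N x i j * c j) {..<?n}) ` {c. L2_set c {..<?n} \<le> 1}
      = (\<lambda>u. norm (?W u)) ` cball 0 1" (is "?A = ?B")
  proof
    show "?A \<subseteq> ?B"
    proof (rule image_subsetI)
      fix c assume "c \<in> {c. L2_set c {..<?n} \<le> 1}"
      then have "h c \<in> cball 0 1" by (simp only: mem_Collect_eq mem_cball_0 nh)
      then show "L2_set (\<lambda>i. \<Sum>j<?n. second_ff S N x i j * c j) {..<?n} \<in> ?B"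
        unfolding L by (rule imageI)
    qed
    show "?B \<subseteq> ?A"
    proof
      fix z assume "z \<in> ?B"
      then obtain u where u: "norm u \<le> 1" "z = norm (?W u)" by auto
      define c where "c j = u \<bullet> frame S x j x" for j
      have "h c = tan_part (N x) u"
        using adapted_frame_expand[OF af, of u] by (simp add: h_def c_def tan_part_def algebra_simps)
      then have "norm (?W (h c)) = z" "norm (h c) \<le> 1"
        using u norm_tan_part_le[OF normal_unit[OF x], of u] by (auto simp: shape_tan_part[OF x])
      then show "z \<in> ?A" by (intro image_eqI[of _ _ c]) (simp_all only: L nh[symmetric] mem_Collect_eq)
    qed
  qed
  then show ?thesis by (simp add: second_ff_opnorm_def)
qed

text \<open>Cauchy-Schwarz in the coordinates of u: the Hilbert-Schmidt norm dominates the operator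
  norm.\<close>

lemma shape_norm_le:
  assumes x: "x \<in> S"
  shows "(norm (shape_op S N x u))\<^sup>2 \<le> second_ff_norm_sq S N x * (norm u)\<^sup>2"
proof -
  have "norm (shape_op S N x u) = norm (\<Sum>b\<in>Basis. (u \<bullet> b) *\<^sub>R shape_op S N x b)"
    by (subst euclidean_representation[of u, symmetric])
       (simp only: linear_sum[OF shape_linear[OF x]] linear_scale[OF shape_linear[OF x]])
  also have "\<dots> \<le> (\<Sum>b\<in>Basis. \<bar>u \<bullet> b\<bar> * norm (shape_op S N x b))"
    by (rule order_trans[OF norm_sum]) simp
  also have "\<dots> \<le> L2_set (\<lambda>b. \<bar>u \<bullet> b\<bar>) Basis * L2_set (\<lambda>b. norm (shape_op S N x b)) Basis"
    using L2_set_mult_ineq[of "\<lambda>b. \<bar>u \<bullet> b\<bar>" "\<lambda>b. norm (shape_op S N x b)" Basis] by simp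
  also have "\<dots> = norm u * sqrt (second_ff_norm_sq S N x)"
    by (simp add: L2_set_def second_ff_norm_sq_eq[OF x] norm_eq_sqrt_inner euclidean_inner[of u u]
        power2_eq_square)
  finally have "(norm (shape_op S N x u))\<^sup>2 \<le> (norm u * sqrt (second_ff_norm_sq S N x))\<^sup>2"
    by (rule power_mono) simp
  then show ?thesis
    by (simp add: power_mult_distrib second_ff_norm_sq_eq[OF x] sum_nonneg mult.commute)
qed

lemma shape_bdd:
  assumes x: "x \<in> S"
  shows "bdd_above ((\<lambda>u. norm (shape_op S N x u)) ` cball 0 1)"
proof (rule bdd_aboveI2)
  fix u :: 'a assume "u \<in> cball 0 1"
  then have "(norm u)\<^sup>2 \<le> 1" by (simp add: power_le_one)
  then have "(norm (shape_op S N x u))\<^sup>2 \<le> second_ff_norm_sq S N x"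
    using shape_norm_le[OF x, of u] by (simp add: second_ff_norm_sq_eq[OF x])
      (meson mult_left_le order_trans sum_nonneg zero_le_power2)
  then show "norm (shape_op S N x u) \<le> sqrt (second_ff_norm_sq S N x)"
    using real_le_rsqrt by blast
qed

lemma opnorm_nonneg: "x \<in> S \<Longrightarrow> 0 \<le> second_ff_opnorm S N x"
  unfolding second_ff_opnorm_eq using cSUP_upper[OF _ shape_bdd, of 0 x]
  by (simp add: linear_0[OF shape_linear])

lemma opnorm_sq_le:
  assumes x: "x \<in> S" shows "(second_ff_opnorm S N x)\<^sup>2 \<le> second_ff_norm_sq S N x"
proof -
  have "second_ff_opnorm S N x \<le> sqrt (second_ff_norm_sq S N x)"
    unfolding second_ff_opnorm_eq[OF x]
  proof (rule cSUP_least)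
    fix u :: 'a assume "u \<in> cball 0 1"
    then have "(norm u)\<^sup>2 \<le> 1" by (simp add: power_le_one)
    then have "(norm (shape_op S N x u))\<^sup>2 \<le> second_ff_norm_sq S N x"
      using shape_norm_le[OF x, of u] by (simp add: second_ff_norm_sq_eq[OF x])
        (meson mult_left_le order_trans sum_nonneg zero_le_power2)
    then show "norm (shape_op S N x u) \<le> sqrt (second_ff_norm_sq S N x)"
      using real_le_rsqrt by blast
  qed auto
  then have "(second_ff_opnorm S N x)\<^sup>2 \<le> (sqrt (second_ff_norm_sq S N x))\<^sup>2"
    using opnorm_nonneg[OF x] by (intro power_mono)
  then show ?thesis by (simp add: second_ff_norm_sq_eq[OF x] sum_nonneg)
qed

text \<open>Used with u = N z: the tangential part on the right is where the projection in the final
  estimate comes from.\<close>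

lemma shape_opnorm_le:
  assumes x: "x \<in> S"
  shows "norm (shape_op S N x u) \<le> second_ff_opnorm S N x * norm (tan_part (N x) u)"
proof (cases "tan_part (N x) u = 0")
  case True
  then show ?thesis using shape_tan_part[OF x, of u] linear_0[OF shape_linear[OF x]] by simp
next
  case False
  define p where "p = tan_part (N x) u"
  have "norm (shape_op S N x (p /\<^sub>R norm p)) \<le> second_ff_opnorm S N x"
    unfolding second_ff_opnorm_eq[OF x] using False
    by (intro cSUP_upper shape_bdd[OF x]) (auto simp: p_def)
  then show ?thesis
    using False shape_tan_part[OF x, of u]
    by (simp add: linear_scale[OF shape_linear[OF x]] p_def[symmetric] divide_simps)
qed

end

section \<open>The Laplacian of the components of the normal\<close>

context oriented_hypersurface begin

lemma mean_curvature_eq: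
  assumes x: "x \<in> S"
  shows "mean_curvature S N x = (\<Sum>b\<in>Basis. shape_op S N x b \<bullet> b)"
proof -
  note l = shape_linear[OF x]
  have "(\<Sum>b\<in>Basis. shape_op S N x b \<bullet> b) = (\<Sum>i<DIM('a) - 1. shape_op S N x (frame S x i x) \<bullet> frame
      S x i x)"
    by (subst adapted_frame_trace[OF frame_adapted[OF x]])
       (auto simp: x intro!: linearI simp: linear_add[OF l] linear_scale[OF l] inner_add_left
           inner_add_right)
  also have "\<dots> = mean_curvature S N x"
    unfolding mean_curvature_def surface_div_def
    by (intro sum.cong refl) (simp add: shape_op_def tan_part_id frame_orthogonal[OF x])
  finally show ?thesis by simp
qed

context
  fixes U V x lam
  assumes ext: "normal_ext U V" and x: "x \<in> S" "x \<in> U"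
    and H: "\<And>y. y \<in> S \<Longrightarrow> mean_curvature S N y = y \<bullet> N y + lam"
begin

definition "shape_field u y = frechet_derivative V (at y) (tan_part (V y) u)"

definition "hess u h = frechet_derivative (\<lambda>y. frechet_derivative V (at y) u) (at x) h"

text \<open>The product rule for \<open>shape_field u\<close>: the first term differentiates the
  direction u itself, the other two the normal part that the projection subtracts.\<close>

definition "dshape u h = hess u h
   - (u \<bullet> V x) *\<^sub>R (hess (V x) h + frechet_derivative V (at x) (frechet_derivative V (at x) h))
   - (u \<bullet> frechet_derivative V (at x) h) *\<^sub>R frechet_derivative V (at x) (V x)"

abbreviation "B \<equiv> frechet_derivative V (at x)"

lemma shape_field_eq: "y \<in> S \<Longrightarrow> y \<in> U \<Longrightarrow> shape_field u y = shape_op S N y u"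
  by (simp add: shape_field_def shape_ext[OF ext])

lemma V_x [simp]: "V x = N x"
  using ext_eq[OF ext x] .

lemma B_linear: "linear B"
  using ext_linear[OF ext x(2)] .

lemma B_normal [simp]: "N x \<bullet> B u = 0"
  using ext_normal[OF ext x(2), of u] by simp

lemma B_symmetric: "N x \<bullet> u = 0 \<Longrightarrow> N x \<bullet> w = 0 \<Longrightarrow> B u \<bullet> w = B w \<bullet> u"
  using ext_symmetric[OF ext x(2), of u w] by (simp add: tan_part_id)

lemma B_shape: "N x \<bullet> u = 0 \<Longrightarrow> B u = shape_op S N x u"
  using shape_ext[OF ext x, of u] by (simp add: tan_part_id)

lemma hess_deriv: "((\<lambda>y. frechet_derivative V (at y) u) has_derivative hess u) (at x)"
proof -
  have "C_on (Suc (Suc 0)) U V" using ext_C2[OF ext] by (simp add: numeral_2_eq_2)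
  then have "C_on (Suc 0) U (\<lambda>y. frechet_derivative V (at y) u)" by (subst (asm) C_on.simps(2)) blast
  from C_on_Suc_deriv[OF this x(2)] show ?thesis unfolding hess_def .
qed

lemma hess_symmetric: "hess u h = hess h u"
  unfolding hess_def using C_on_2_symmetric[OF ext_open[OF ext] ext_C2[OF ext] x(2)] .

lemma hess_linear: "linear (hess u)"
  using hess_deriv has_derivative_linear by blast

lemma hess_linear_left: "linear (\<lambda>u. hess u h)"
  by (subst hess_symmetric) (rule hess_linear)

lemma dshape_linear: "linear (\<lambda>u. dshape u h)"
  by (rule linearI)
     (simp_all add: dshape_def linear_add[OF hess_linear_left] linear_scale[OF hess_linear_left]
         inner_add_left algebra_simps)

lemma shape_field_deriv: "(shape_field u has_derivative dshape u) (at x)"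
proof -
  let ?D = "\<lambda>y. frechet_derivative V (at y)"
  \<comment> \<open>V y is again expanded in the standard basis, so that only derivatives of V in
    fixed directions get differentiated.\<close>
  have "((\<lambda>y. ?D y u - (u \<bullet> V y) *\<^sub>R (\<Sum>b\<in>Basis. (V y \<bullet> b) *\<^sub>R ?D y b)) has_derivative
    (\<lambda>h. hess u h - ((u \<bullet> V x) *\<^sub>R (\<Sum>b\<in>Basis. (V x \<bullet> b) *\<^sub>R hess b h + (B h \<bullet> b) *\<^sub>R B b)
       + (u \<bullet> B h) *\<^sub>R (\<Sum>b\<in>Basis. (V x \<bullet> b) *\<^sub>R B b)))) (at x)"
    by (intro has_derivative_diff has_derivative_scaleR has_derivative_sum has_derivative_inner_left
        has_derivative_inner_right hess_deriv ext_deriv[OF ext x(2)])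
  moreover have "(\<lambda>h. hess u h - ((u \<bullet> V x) *\<^sub>R (\<Sum>b\<in>Basis. (V x \<bullet> b) *\<^sub>R hess b h + (B h \<bullet> b) *\<^sub>R B b)
       + (u \<bullet> B h) *\<^sub>R (\<Sum>b\<in>Basis. (V x \<bullet> b) *\<^sub>R B b))) = dshape u"
  proof
    fix h
    have rep: "(\<Sum>b\<in>Basis. (w \<bullet> b) *\<^sub>R T b) = T w" if "linear T" for T :: "'a \<Rightarrow> 'a" and w
    proof -
      have "T w = T (\<Sum>b\<in>Basis. (w \<bullet> b) *\<^sub>R b)" by (simp only: euclidean_representation)
      then show ?thesis by (simp only: linear_sum[OF that] linear_scale[OF that])
    qed
    show "hess u h - ((u \<bullet> V x) *\<^sub>R (\<Sum>b\<in>Basis. (V x \<bullet> b) *\<^sub>R hess b h + (B h \<bullet> b) *\<^sub>R B b)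
       + (u \<bullet> B h) *\<^sub>R (\<Sum>b\<in>Basis. (V x \<bullet> b) *\<^sub>R B b)) = dshape u h"
      unfolding sum.distrib rep[OF hess_linear_left] rep[OF B_linear] dshape_def
      by (simp add: algebra_simps)
  qed
  ultimately have "((\<lambda>y. ?D y u - (u \<bullet> V y) *\<^sub>R (\<Sum>b\<in>Basis. (V y \<bullet> b) *\<^sub>R ?D y b)) has_derivative
      dshape u) (at x)"
    by simp
  then show ?thesis
  proof (rule has_derivative_transform_within_open[OF _ ext_open[OF ext] x(2)])
    fix y assume "y \<in> U"
    then have l: "linear (?D y)" by (rule ext_linear[OF ext])
    have "?D y (V y) = ?D y (\<Sum>b\<in>Basis. (V y \<bullet> b) *\<^sub>R b)" by (simp only: euclidean_representation)
    then show "?D y u - (u \<bullet> V y) *\<^sub>R (\<Sum>b\<in>Basis. (V y \<bullet> b) *\<^sub>R ?D y b) = shape_field u y"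
      by (simp add: shape_field_def tan_part_def linear_diff[OF l] linear_sum[OF l] linear_scale[OF l])
  qed
qed

text \<open>The field of the vectors W u is the surface gradient of the component
  \<open>u \<bullet> N\<close>, so its divergence is the Laplacian of that component.\<close>

definition "lap u = (\<Sum>i<DIM('a) - 1. dshape u (frame S x i x) \<bullet> frame S x i x)"

text \<open>Codazzi: the trace over the frame of the derivative of the shape operator is the derivative of
  its trace, because the Hessian of V is symmetric.\<close>

lemma lap_tangent:
  assumes h: "N x \<bullet> h = 0"
  shows "lap h = x \<bullet> shape_op S N x h"
proof -
  let ?e = "\<lambda>i. frame S x i x" and ?n = "DIM('a) - 1"
  have th: "h \<in> tangent_space S x" using h tangent_iff[OF x(1)] by simp
  have "deriv_along S (mean_curvature S N) x h = (\<Sum>b\<in>Basis. dshape b h \<bullet> b)"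
  proof (rule deriv_along_extension[OF _ ext_open[OF ext] x _ th])
    show "((\<lambda>y. \<Sum>b\<in>Basis. shape_field b y \<bullet> b) has_derivative (\<lambda>h. \<Sum>b\<in>Basis. dshape b h \<bullet> b)) (at x)"
      by (intro has_derivative_sum has_derivative_inner_left shape_field_deriv)
  qed (simp add: mean_curvature_eq shape_field_eq)
  \<comment> \<open>The hypothesis on H enters here. The constant lam disappears, and so does the
    term from differentiating y, because h is tangent.\<close>
  moreover have "deriv_along S (mean_curvature S N) x h = x \<bullet> B h + h \<bullet> V x"
  proof (rule deriv_along_extension[OF _ ext_open[OF ext] x _ th])
    show "((\<lambda>y. y \<bullet> V y + lam) has_derivative (\<lambda>h. x \<bullet> B h + h \<bullet> V x)) (at x)"
      using has_derivative_add[OF has_derivative_inner[OF has_derivative_ident ext_deriv[OF ext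
          x(2)]] has_derivative_const[of lam]]
      by simp
  qed (simp add: H ext_eq[OF ext])
  ultimately have "(\<Sum>b\<in>Basis. dshape b h \<bullet> b) = x \<bullet> B h"
    using h by (simp add: inner_commute)
  moreover have "(\<Sum>b\<in>Basis. dshape b h \<bullet> b) = dshape (N x) h \<bullet> N x + (\<Sum>i<?n. dshape (?e i) h \<bullet> ?e i)"
    by (rule adapted_frame_trace[OF frame_adapted[OF x(1)]])
       (auto intro!: linearI simp: inner_add_left inner_add_right linear_add[OF dshape_linear]
           linear_scale[OF dshape_linear])
  moreover have "dshape (N x) h \<bullet> N x = 0"
  proof -
    have "B u \<bullet> N x = 0" for u by (subst inner_commute) (rule B_normal)
    then show ?thesis using normal_unit[OF x(1)] by (simp add: dshape_def inner_diff_left inner_add_left)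
  qed
  \<comment> \<open>Beyond the symmetric Hessian, both sides contain the normal derivative of the
    extension with the factors \<open>?e i \<bullet> B h\<close> and
    \<open>h \<bullet> B (?e i)\<close>, which agree by the symmetry of B on tangent
    vectors.\<close>
  moreover have "dshape (?e i) h \<bullet> ?e i = dshape h (?e i) \<bullet> ?e i" if "i < ?n" for i
  proof -
    have o: "?e i \<bullet> N x = 0" "h \<bullet> N x = 0"
      using h frame_orthogonal[OF x(1) that] by (simp_all only: inner_commute[of _ "N x"])
    have "h \<bullet> B (?e i) = ?e i \<bullet> B h"
      using B_symmetric[OF h frame_orthogonal[OF x(1) that]] by (simp only: inner_commute)
    then show ?thesis by (simp add: dshape_def o hess_symmetric[of h "?e i"])
  qed
  ultimately show ?thesis using B_shape[OF h] by (simp add: lap_def)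
qed

text \<open>For u = N x the two Hessian terms cancel. What remains is minus B applied twice to a
  frame vector, and symmetry moves one B to the other side of the inner product.\<close>

lemma lap_normal: "lap (N x) = - second_ff_norm_sq S N x"
proof -
  have "dshape (N x) (frame S x i x) \<bullet> frame S x i x = - (shape_op S N x (frame S x i x) \<bullet>
      shape_op S N x (frame S x i x))"
    if "i < DIM('a) - 1" for i
    using normal_unit[OF x(1)] frame_orthogonal[OF x(1) that] B_symmetric[of "B (frame S x i x)"
        "frame S x i x"]
    by (simp add: dshape_def inner_diff_left B_shape[symmetric])
  then show ?thesis by (simp add: lap_def second_ff_norm_sq_frame[OF x(1)] sum_negf)
qed

text \<open>Split v into its tangential and normal parts. In L the drift term removes the first
  summand and the zeroth order term |A|^2 the second, which leaves L (v . N) = v . N.\<close>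

lemma lap_eq: "lap v = x \<bullet> shape_op S N x v - second_ff_norm_sq S N x * (v \<bullet> N x)"
proof -
  have "dshape v h = dshape (tan_part (N x) v) h + (v \<bullet> N x) *\<^sub>R dshape (N x) h" for h
    by (simp add: linear_diff[OF dshape_linear] linear_scale[OF dshape_linear] tan_part_def)
  then have "lap v = lap (tan_part (N x) v) + (v \<bullet> N x) * lap (N x)"
    by (simp add: lap_def inner_add_left sum.distrib sum_distrib_left)
  then show ?thesis
    using normal_unit[OF x(1)] by (simp add: lap_tangent lap_normal shape_tan_part[OF x(1)] mult.commute)
qed

text \<open>The product rule for the Laplacian. The gradient formula G is required at all points of
  S, not only at x, because it replaces a sum over unrelated frames by a field that can be
  differentiated.\<close>

lemma surface_laplacian_product:
  assumes G: "\<And>y. y \<in> S \<Longrightarrow> surface_grad S f y = (v \<bullet> N y) *\<^sub>R shape_op S N y w + (w \<bullet> N y) *\<^sub>R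
      shape_op S N y v"
  shows "surface_laplacian S f x = (v \<bullet> N x) * lap w + (w \<bullet> N x) * lap v
    + 2 * (shape_op S N x v \<bullet> shape_op S N x w)"
proof -
  let ?e = "\<lambda>i. frame S x i x" and ?n = "DIM('a) - 1" and ?W = "shape_op S N x"
  have d: "deriv_along S (surface_grad S f) x (?e i) =
      (v \<bullet> N x) *\<^sub>R dshape w (?e i) + (v \<bullet> B (?e i)) *\<^sub>R ?W w + ((w \<bullet> N x) *\<^sub>R dshape v (?e i) +
          (w \<bullet> B (?e i)) *\<^sub>R ?W v)"
    if i: "i < ?n" for i
  proof (rule deriv_along_extension[OF _ ext_open[OF ext] x _ frame_tangent[OF x(1) i]])
    show "((\<lambda>y. (v \<bullet> V y) *\<^sub>R shape_field w y + (w \<bullet> V y) *\<^sub>R shape_field v y) has_derivative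
        (\<lambda>h. (v \<bullet> N x) *\<^sub>R dshape w h + (v \<bullet> B h) *\<^sub>R ?W w + ((w \<bullet> N x) *\<^sub>R dshape v h + (w \<bullet> B h)
            *\<^sub>R ?W v))) (at x)"
      unfolding V_x[symmetric] shape_field_eq[OF x, symmetric]
      by (intro has_derivative_add has_derivative_scaleR has_derivative_inner_right
          shape_field_deriv ext_deriv[OF ext x(2)])
  qed (simp add: G shape_field_eq ext_eq[OF ext])
  have s: "(\<Sum>i<?n. (v \<bullet> B (?e i)) * (?W w \<bullet> ?e i)) = ?W v \<bullet> ?W w" for v w
  proof -
    have "v \<bullet> B (?e i) = ?W v \<bullet> ?e i" if "i < ?n" for i
      using B_shape[OF frame_orthogonal[OF x(1) that]] shape_symmetric[OF x(1), of v "?e i"] by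
          (simp add: inner_commute)
    then show ?thesis
      by (subst adapted_frame_inner[OF frame_adapted[OF x(1)]]) (simp add: shape_normal[OF x(1)]
          inner_commute[of _ "N x"])
  qed
  have "surface_laplacian S f x = (\<Sum>i<?n. (v \<bullet> N x) * (dshape w (?e i) \<bullet> ?e i) + (v \<bullet> B (?e i)) *
      (?W w \<bullet> ?e i)
     + ((w \<bullet> N x) * (dshape v (?e i) \<bullet> ?e i) + (w \<bullet> B (?e i)) * (?W v \<bullet> ?e i)))"
    unfolding surface_laplacian_def surface_div_def
    by (intro sum.cong refl) (simp add: d inner_add_left)
  also have "\<dots> = (v \<bullet> N x) * lap w + ?W v \<bullet> ?W w + ((w \<bullet> N x) * lap v + ?W w \<bullet> ?W v)"
    by (simp only: sum.distrib sum_distrib_left[symmetric] lap_def[symmetric] s)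
  finally show ?thesis by (simp add: inner_commute)
qed

end

lemma surface_grad_product:
  assumes x: "x \<in> S"
  shows "surface_grad S (\<lambda>y. (v \<bullet> N y) * (w \<bullet> N y) - m) x =
    (v \<bullet> N x) *\<^sub>R shape_op S N x w + (w \<bullet> N x) *\<^sub>R shape_op S N x v"
proof -
  let ?e = "\<lambda>i. frame S x i x" and ?n = "DIM('a) - 1" and ?W = "shape_op S N x"
  obtain U V where U: "x \<in> U" "normal_ext U V" using normal_ext_exists[OF x] by blast
  let ?B = "frechet_derivative V (at x)"
  have Vx: "V x = N x" using ext_eq[OF U(2) x U(1)] .
  have W: "u \<bullet> ?B (?e i) = ?W u \<bullet> ?e i" if "i < ?n" for u i
    using shape_ext[OF U(2) x U(1), of "?e i"] shape_symmetric[OF x, of u "?e i"]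
    by (simp add: Vx tan_part_id frame_orthogonal[OF x that] inner_commute)
  have d: "deriv_along S (\<lambda>y. (v \<bullet> N y) * (w \<bullet> N y) - m) x (?e i) =
      ((v \<bullet> N x) *\<^sub>R ?W w + (w \<bullet> N x) *\<^sub>R ?W v) \<bullet> ?e i" if i: "i < ?n" for i
  proof -
    have "((\<lambda>y. (v \<bullet> V y) * (w \<bullet> V y) - m) has_derivative
        (\<lambda>h. (v \<bullet> V x) * (w \<bullet> ?B h) + (v \<bullet> ?B h) * (w \<bullet> V x) - 0)) (at x)"
      by (intro has_derivative_diff has_derivative_const has_derivative_mult
          has_derivative_inner_right ext_deriv[OF U(2,1)])
    from deriv_along_extension[OF this ext_open[OF U(2)] x U(1) _ frame_tangent[OF x i], of "\<lambda>y.
        (v \<bullet> N y) * (w \<bullet> N y) - m"]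
    show ?thesis
      using ext_eq[OF U(2)] by (simp add: W[OF i] Vx inner_add_left)
  qed
  let ?g = "(v \<bullet> N x) *\<^sub>R ?W w + (w \<bullet> N x) *\<^sub>R ?W v"
  have "surface_grad S (\<lambda>y. (v \<bullet> N y) * (w \<bullet> N y) - m) x = (\<Sum>i<?n. (?g \<bullet> ?e i) *\<^sub>R ?e i)"
    unfolding surface_grad_def by (intro sum.cong refl) (simp only: d lessThan_iff)
  also have "\<dots> = (?g \<bullet> N x) *\<^sub>R N x + (\<Sum>i<?n. (?g \<bullet> ?e i) *\<^sub>R ?e i)"
  proof -
    have "N x \<bullet> ?g = 0" by (simp add: inner_add_right shape_normal[OF x])
    then have "?g \<bullet> N x = 0" by (subst inner_commute)
    then show ?thesis by simp
  qed
  also have "\<dots> = ?g" by (rule adapted_frame_expand[OF frame_adapted[OF x]])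
  finally show ?thesis .
qed

text \<open>The drift cancels the gradient terms of both Laplacians. These also contribute -2 |A|^2
  f, with f the product of the two components, and the zeroth order term of L gives back |A|^2 f +
  f.\<close>

lemma L_op_product:
  assumes H: "\<And>y. y \<in> S \<Longrightarrow> mean_curvature S N y = y \<bullet> N y + lam" and x: "x \<in> S"
  shows "L_op S N (\<lambda>y. (v \<bullet> N y) * (w \<bullet> N y) - m) x =
    (1 - second_ff_norm_sq S N x) * ((v \<bullet> N x) * (w \<bullet> N x))
    + 2 * (shape_op S N x v \<bullet> shape_op S N x w) - (second_ff_norm_sq S N x + 1) * m"
proof -
  obtain U V where U: "x \<in> U" "normal_ext U V" using normal_ext_exists[OF x] by blast
  have "surface_laplacian S (\<lambda>y. (v \<bullet> N y) * (w \<bullet> N y) - m) x =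
      (v \<bullet> N x) * lap V x w + (w \<bullet> N x) * lap V x v + 2 * (shape_op S N x v \<bullet> shape_op S N x w)"
    by (rule surface_laplacian_product[OF U(2) x U(1) H surface_grad_product])
  then show ?thesis
    unfolding L_op_def surface_grad_product[OF x]
    by (simp add: lap_eq[OF U(2) x U(1) H] inner_add_right algebra_simps)
qed

end

section \<open>The averaged inequality over an abstract measure space\<close>

text \<open>Fubini needs sigma-finiteness, obtained here from the weight instead of the geometry of
  S: by Markov's inequality the sets where g is at least 1/(n+1) have finite measure, and they
  exhaust the space.\<close>

lemma sigma_finite_measure_if_integrable_pos:
  fixes g :: "'x \<Rightarrow> real"
  assumes g: "integrable M g" and pos: "\<And>x. x \<in> space M \<Longrightarrow> 0 < g x"
  shows "sigma_finite_measure M"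
proof
  have [measurable]: "g \<in> borel_measurable M" using g by auto
  let ?A = "\<lambda>n::nat. {x \<in> space M. 1 / real (Suc n) \<le> g x}"
  have fin: "emeasure M (?A n) \<noteq> \<infinity>" for n
  proof -
    have "emeasure M (?A n) \<le> ennreal (1 / (1 / real (Suc n)) * integral\<^sup>L M g)"
    proof (rule integral_Markov_inequality[OF g])
      show "AE x in M. 0 \<le> g x" using pos by (intro AE_I2) (simp add: less_imp_le)
    qed simp
    then show ?thesis by (auto simp: top_unique)
  qed
  have "\<exists>n. x \<in> ?A n" if x: "x \<in> space M" for x
  proof -
    obtain n where "1 / real (Suc n) < g x"
      using reals_Archimedean[OF pos[OF x]] by (auto simp: inverse_eq_divide)
    then show ?thesis using x by (intro exI[of _ n]) auto
  qed
  then have "\<Union> (range ?A) = space M" by auto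
  then show "\<exists>A. countable A \<and> A \<subseteq> sets M \<and> \<Union> A = space M \<and> (\<forall>a\<in>A. emeasure M a \<noteq> \<infinity>)"
    using fin by (intro exI[of _ "range ?A"]) auto
qed

lemma (in pair_sigma_finite)
  fixes f h :: "_ \<Rightarrow> real"
  assumes f: "integrable M1 f" and h: "integrable M2 h"
  shows integrable_times: "integrable (M1 \<Otimes>\<^sub>M M2) (\<lambda>q. f (fst q) * h (snd q))"
    and integral_times: "(LINT q|(M1 \<Otimes>\<^sub>M M2). f (fst q) * h (snd q)) = (LINT x|M1. f x) * (LINT
        y|M2. h y)"
proof -
  have [measurable]: "f \<in> borel_measurable M1" "h \<in> borel_measurable M2" using f h by auto
  show i: "integrable (M1 \<Otimes>\<^sub>M M2) (\<lambda>q. f (fst q) * h (snd q))"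
    by (rule Fubini_integrable) (auto simp: abs_mult f h)
  show "(LINT q|(M1 \<Otimes>\<^sub>M M2). f (fst q) * h (snd q)) = (LINT x|M1. f x) * (LINT y|M2. h y)"
    by (subst integral_fst'[OF i, symmetric]) simp
qed

lemma integral_double_sum:
  fixes f :: "'i \<Rightarrow> 'j \<Rightarrow> 'x \<Rightarrow> real"
  assumes "\<And>i j. i \<in> I \<Longrightarrow> j \<in> J \<Longrightarrow> integrable M (f i j)"
  shows "(LINT x|M. (\<Sum>i\<in>I. \<Sum>j\<in>J. f i j x)) = (\<Sum>i\<in>I. \<Sum>j\<in>J. (LINT x|M. f i j x))"
  by (subst Bochner_Integration.integral_sum)
     (auto intro!: Bochner_Integration.integrable_sum sum.cong Bochner_Integration.integral_sum assms)

lemma euclidean_inner_sum: "(\<Sum>i\<in>Basis. (i \<bullet> u) * (i \<bullet> w)) = u \<bullet> w"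
  for u w :: "'b::euclidean_space"
  by (subst euclidean_inner[of u w]) (simp only: inner_commute)

text \<open>Used with T = W x, once for u = N x, where both sides vanish, and once for u = N z, to
  separate the variables x and z.\<close>

lemma linear_inner_expand:
  fixes T :: "'b::euclidean_space \<Rightarrow> 'c::real_inner"
  assumes "linear T"
  shows "(\<Sum>i\<in>Basis. \<Sum>j\<in>Basis. (i \<bullet> u) * (j \<bullet> u) * (T i \<bullet> T j)) = T u \<bullet> T u"
proof -
  have *: "T u = (\<Sum>i\<in>Basis. (i \<bullet> u) *\<^sub>R T i)"
  proof -
    have "T u = T (\<Sum>i\<in>Basis. (u \<bullet> i) *\<^sub>R i)" by (simp only: euclidean_representation)
    then show ?thesis by (simp only: linear_sum[OF assms] linear_scale[OF assms] inner_commute)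
  qed
  show ?thesis
    unfolding * inner_sum_left inner_sum_right inner_scaleR_left inner_scaleR_right sum_distrib_left
    by (intro sum.cong refl) (simp add: inner_commute ac_simps)
qed

text \<open>What the averaging needs of the hypersurface: \<open>W_opn\<close> gives the final
  estimate, and \<open>opn_sq\<close> makes the square of opn integrable once |A|^2 is.\<close>

locale normal_data =
  fixes M :: "'x measure" and g :: "'x \<Rightarrow> real" and N :: "'x \<Rightarrow> 'b::euclidean_space"
    and W :: "'x \<Rightarrow> 'b \<Rightarrow> 'b" and opn :: "'x \<Rightarrow> real"
  assumes g_meas [measurable]: "g \<in> borel_measurable M"
    and N_meas [measurable]: "N \<in> borel_measurable M"
    and W_meas [measurable]: "\<And>u. (\<lambda>x. W x u) \<in> borel_measurable M"
    and opn_meas [measurable]: "opn \<in> borel_measurable M"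
    and g_pos: "\<And>x. x \<in> space M \<Longrightarrow> 0 < g x"
    and N_unit: "\<And>x. x \<in> space M \<Longrightarrow> N x \<bullet> N x = 1"
    and W_linear: "\<And>x. x \<in> space M \<Longrightarrow> linear (W x)"
    and W_N: "\<And>x. x \<in> space M \<Longrightarrow> W x (N x) = 0"
    and W_opn: "\<And>x u. x \<in> space M \<Longrightarrow> norm (W x u) \<le> opn x * norm (tan_part (N x) u)"
    and opn_sq: "\<And>x. x \<in> space M \<Longrightarrow> (opn x)\<^sup>2 \<le> (\<Sum>b\<in>Basis. (norm (W x b))\<^sup>2)"
begin

definition "al x = (\<Sum>b\<in>Basis. (norm (W x b))\<^sup>2)"

definition "p = (LINT x|M. g x)"

definition "mean v w = 1 / p * (LINT y|M. (v \<bullet> N y) * (w \<bullet> N y) * g y)"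

text \<open>The integrand f L f, without the Gaussian weight.\<close>

definition "Q m v w x = ((v \<bullet> N x) * (w \<bullet> N x) - m) *
  ((1 - al x) * ((v \<bullet> N x) * (w \<bullet> N x)) + 2 * (W x v \<bullet> W x w) - (al x + 1) * m)"

definition "tau y z = (norm (tan_part (N y) (N z)))\<^sup>2"

definition "rhs = (LINT q|(M \<Otimes>\<^sub>M M \<Otimes>\<^sub>M M). (1 - al (fst q) - 2 * (opn (fst (snd q)))\<^sup>2)
   * tau (fst (snd q)) (snd (snd q)) * g (fst q) * g (fst (snd q)) * g (snd (snd q)))"

definition "good_pair v w \<longleftrightarrow> (real DIM('b))\<^sup>2 * (LINT x|M. Q (mean v w) v w x * g x) \<ge> 1 / p\<^sup>2 * rhs"

lemma al_meas [measurable]: "al \<in> borel_measurable M"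
  unfolding al_def by measurable

lemma al_nonneg: "0 \<le> al x"
  by (simp add: al_def sum_nonneg)

lemma al_ge: "i \<in> Basis \<Longrightarrow> (norm (W x i))\<^sup>2 \<le> al x"
  unfolding al_def by (rule member_le_sum) auto

lemma W_inner_le:
  assumes "i \<in> Basis" "j \<in> Basis" shows "\<bar>W x i \<bullet> W x j\<bar> \<le> al x"
proof -
  have "\<bar>W x i \<bullet> W x j\<bar> \<le> norm (W x i) * norm (W x j)" by (rule Cauchy_Schwarz_ineq2)
  also have "\<dots> \<le> sqrt (al x) * sqrt (al x)"
    using al_ge[OF assms(1)] al_ge[OF assms(2)] by (intro mult_mono real_le_rsqrt) (auto simp: al_nonneg)
  finally show ?thesis by (simp add: al_nonneg)
qed

lemma N_comp_le: "x \<in> space M \<Longrightarrow> i \<in> Basis \<Longrightarrow> \<bar>i \<bullet> N x\<bar> \<le> 1"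
  using Cauchy_Schwarz_ineq2[of i "N x"] N_unit[of x] by (simp add: norm_eq_1[symmetric])

lemma N_comp2_le: "x \<in> space M \<Longrightarrow> i \<in> Basis \<Longrightarrow> j \<in> Basis \<Longrightarrow> \<bar>(i \<bullet> N x) * (j \<bullet> N x)\<bar> \<le> 1"
  using N_comp_le[of x i] N_comp_le[of x j] by (simp add: abs_mult mult_le_one)

lemma sum_N_sq: "x \<in> space M \<Longrightarrow> (\<Sum>i\<in>Basis. (i \<bullet> N x)\<^sup>2) = 1"
  using euclidean_inner_sum[of "N x" "N x"] N_unit[of x] by (simp add: power2_eq_square)

lemma sum_W: "(\<Sum>i\<in>Basis. W x i \<bullet> W x i) = al x"
  by (simp add: al_def power2_norm_eq_inner)

lemma sum_NW: "x \<in> space M \<Longrightarrow> (\<Sum>i\<in>Basis. \<Sum>j\<in>Basis. (i \<bullet> N x) * (j \<bullet> N x) * (W x i \<bullet> W x j)) = 0"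
  using linear_inner_expand[OF W_linear, of x "N x"] W_N[of x] by simp

lemma tau_eq: "y \<in> space M \<Longrightarrow> z \<in> space M \<Longrightarrow> tau y z = 1 - (N y \<bullet> N z)\<^sup>2"
  using norm_tan_part_sq[OF N_unit, of y "N z"] N_unit[of z]
  by (simp add: tau_def power2_norm_eq_inner[of "N z"] inner_commute)

lemma good_pairI:
  assumes "good_pair v w" "norm v = 1" "norm w = 1"
  shows "\<exists>v\<in>sphere 0 1. \<exists>w\<in>sphere 0 1. good_pair v w"
  using assms by (intro bexI[of _ v] bexI[of _ w]) auto

text \<open>With m = 0 the integrand is a quadratic form in v and in w; the sum below polarises it.\<close>

lemma Q_polarization:
  assumes x: "x \<in> space M"
  shows "(\<Sum>i\<in>Basis. \<Sum>j\<in>Basis. Q 0 (i + j) (i + j) x - Q 0 (i + j) (i - j) x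
    - Q 0 (i - j) (i + j) x + Q 0 (i - j) (i - j) x) = 16"
proof -
  note l = W_linear[OF x]
  have "Q 0 (i + j) (i + j) x - Q 0 (i + j) (i - j) x - Q 0 (i - j) (i + j) x + Q 0 (i - j) (i - j) x =
     16 * (1 - al x) * ((i \<bullet> N x)\<^sup>2 * (j \<bullet> N x)\<^sup>2) + 8 * ((i \<bullet> N x)\<^sup>2 * (W x j \<bullet> W x j))
     + 8 * ((j \<bullet> N x)\<^sup>2 * (W x i \<bullet> W x i)) + 16 * ((i \<bullet> N x) * (j \<bullet> N x) * (W x i \<bullet> W x j))" for i j
  proof -
    have D: "W x j \<bullet> W x i = W x i \<bullet> W x j" by (rule inner_commute)
    show ?thesis
      unfolding Q_def linear_add[OF l] linear_diff[OF l] inner_add_left inner_diff_left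
          inner_add_right inner_diff_right D
      by (simp add: algebra_simps power2_eq_square)
  qed
  then have "(\<Sum>i\<in>Basis. \<Sum>j\<in>Basis. Q 0 (i + j) (i + j) x - Q 0 (i + j) (i - j) x
    - Q 0 (i - j) (i + j) x + Q 0 (i - j) (i - j) x) =
     16 * (1 - al x) * ((\<Sum>i\<in>Basis. (i \<bullet> N x)\<^sup>2) * (\<Sum>j\<in>Basis. (j \<bullet> N x)\<^sup>2))
     + 8 * ((\<Sum>i\<in>Basis. (i \<bullet> N x)\<^sup>2) * (\<Sum>j\<in>Basis. W x j \<bullet> W x j))
     + 8 * ((\<Sum>j\<in>Basis. (j \<bullet> N x)\<^sup>2) * (\<Sum>i\<in>Basis. W x i \<bullet> W x i))
     + 16 * (\<Sum>i\<in>Basis. \<Sum>j\<in>Basis. (i \<bullet> N x) * (j \<bullet> N x) * (W x i \<bullet> W x j))"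
    by (simp only: sum.distrib sum_distrib_left[symmetric] sum_distrib_right[symmetric])
  \<comment> \<open>The traces are 16 (1 - al), 8 al, 8 al and 0, so the curvature drops
    out.\<close>
  then show ?thesis by (simp add: sum_N_sq[OF x] sum_W sum_NW[OF x])
qed

text \<open>Here p = 0, and division by zero makes every mean and the right-hand side 0.
  Polarisation is essential: the sum over basis pairs would yield integrability of (1 - al) g only,
  whereas the polarised sum is 16 g.\<close>

lemma case_infinite:
  assumes "\<not> integrable M g"
  shows "\<exists>v\<in>sphere 0 1. \<exists>w\<in>sphere 0 1. good_pair v w"
proof -
  have p: "p = 0" using assms by (simp add: p_def not_integrable_integral_eq)
  have "\<exists>v\<in>sphere 0 1. \<exists>w\<in>sphere 0 1. \<not> integrable M (\<lambda>x. Q 0 v w x * g x)"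
  proof (rule ccontr)
    assume "\<not> ?thesis"
    then have I: "integrable M (\<lambda>x. Q 0 v w x * g x)" if "norm v = 1" "norm w = 1" for v w
      using that by auto
    \<comment> \<open>Q 0 is homogeneous of degree two in v and in w, so integrability extends from
      unit vectors to the vectors i + j and i - j, which may have other lengths or vanish.\<close>
    have I': "integrable M (\<lambda>x. Q 0 v w x * g x)" for v w
    proof (cases "v = 0 \<or> w = 0")
      case True
      then have "(\<lambda>x. Q 0 v w x * g x) = (\<lambda>x. 0)" by (auto simp: Q_def)
      then show ?thesis by (simp only: Bochner_Integration.integrable_zero)
    next
      case False
      let ?v = "v /\<^sub>R norm v" and ?w = "w /\<^sub>R norm w"
      have "integrable M (\<lambda>x. (norm v * norm w)\<^sup>2 * (Q 0 ?v ?w x * g x))"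
        using I[of ?v ?w] False by simp
      then show ?thesis
      proof (rule Bochner_Integration.integrable_cong[THEN iffD1, rotated -1])
        fix x assume x: "x \<in> space M"
        define a b where "a = norm v" and "b = norm w"
        have ab: "a \<noteq> 0" "b \<noteq> 0" using False by (auto simp: a_def b_def)
        define v' w' where "v' = ?v" and "w' = ?w"
        have vw: "v = a *\<^sub>R v'" "w = b *\<^sub>R w'" using ab by (auto simp: v'_def w'_def a_def b_def)
        have "Q 0 v w x = (a * b)\<^sup>2 * Q 0 v' w' x"
          unfolding Q_def vw linear_scale[OF W_linear[OF x]]
          by (simp add: algebra_simps power2_eq_square)
        then show "(norm v * norm w)\<^sup>2 * (Q 0 ?v ?w x * g x) = Q 0 v w x * g x"
          by (simp add: a_def b_def v'_def w'_def)
      qed simp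
    qed
    have "integrable M (\<lambda>x. \<Sum>i\<in>Basis. \<Sum>j\<in>Basis. Q 0 (i + j) (i + j) x * g x - Q 0 (i + j) (i - j) x * g x
      - Q 0 (i - j) (i + j) x * g x + Q 0 (i - j) (i - j) x * g x)"
      by (intro Bochner_Integration.integrable_sum Bochner_Integration.integrable_add
          Bochner_Integration.integrable_diff I')
    then have "integrable M (\<lambda>x. 16 * g x)"
    proof (rule Bochner_Integration.integrable_cong[THEN iffD1, rotated -1])
      fix x assume "x \<in> space M"
      show "(\<Sum>i\<in>Basis. \<Sum>j\<in>Basis. Q 0 (i + j) (i + j) x * g x - Q 0 (i + j) (i - j) x * g x
          - Q 0 (i - j) (i + j) x * g x + Q 0 (i - j) (i - j) x * g x) = 16 * g x"
        unfolding Q_polarization[OF \<open>x \<in> space M\<close>, symmetric] sum_distrib_right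
        by (simp only: left_diff_distrib distrib_right)
    qed simp
    then show False using assms by simp
  qed
  then obtain v w where "norm v = 1" "norm w = 1" "\<not> integrable M (\<lambda>x. Q 0 v w x * g x)" by auto
  then show ?thesis
    by (intro good_pairI[of v w]) (auto simp: good_pair_def mean_def p not_integrable_integral_eq)
qed

text \<open>With P the matrix of the means of basis pairs, that is, the second moment matrix of N: K
  is its squared norm, s its quadratic form at N x, and R x the trace of P against the Gram matrix
  of the vectors W x i.\<close>

definition "K = (\<Sum>i\<in>Basis. \<Sum>j\<in>Basis. (mean i j)\<^sup>2)"
definition "s x = (\<Sum>i\<in>Basis. \<Sum>j\<in>Basis. mean i j * ((i \<bullet> N x) * (j \<bullet> N x)))"
definition "R x = (\<Sum>i\<in>Basis. \<Sum>j\<in>Basis. mean i j * (W x i \<bullet> W x j))"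

text \<open>Expand the product and take traces; the cross term with W vanishes because W N =
  0.\<close>

lemma sum_Q:
  assumes x: "x \<in> space M"
  shows "(\<Sum>i\<in>Basis. \<Sum>j\<in>Basis. Q (mean i j) i j x) = 1 - 2 * s x + K - al x * (1 - K) - 2 * R x"
proof -
  have "Q m i j x = (1 - al x) * ((i \<bullet> N x)\<^sup>2 * (j \<bullet> N x)\<^sup>2) + 2 * ((i \<bullet> N x) * (j \<bullet> N x) * (W x i
      \<bullet> W x j))
    - 2 * (m * ((i \<bullet> N x) * (j \<bullet> N x))) - 2 * (m * (W x i \<bullet> W x j)) + (al x + 1) * m\<^sup>2" for i j m
    unfolding Q_def by (simp add: algebra_simps power2_eq_square)
  then have "(\<Sum>i\<in>Basis. \<Sum>j\<in>Basis. Q (mean i j) i j x) =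
      (1 - al x) * ((\<Sum>i\<in>Basis. (i \<bullet> N x)\<^sup>2) * (\<Sum>j\<in>Basis. (j \<bullet> N x)\<^sup>2))
      + 2 * (\<Sum>i\<in>Basis. \<Sum>j\<in>Basis. (i \<bullet> N x) * (j \<bullet> N x) * (W x i \<bullet> W x j))
      - 2 * s x - 2 * R x + (al x + 1) * K"
    unfolding s_def R_def K_def
    by (simp only: sum.distrib sum_subtractf sum_distrib_left[symmetric] sum_distrib_right[symmetric])
  then show ?thesis by (simp only: sum_N_sq[OF x] sum_NW[OF x]) (simp add: algebra_simps)
qed

lemma integrable_bounded:
  assumes "integrable M g" "f \<in> borel_measurable M" "\<And>x. x \<in> space M \<Longrightarrow> \<bar>f x\<bar> \<le> c"
  shows "integrable M (\<lambda>x. f x * g x)"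
proof (rule Bochner_Integration.integrable_bound[OF integrable_mult_right[OF assms(1), of c]])
  show "AE x in M. norm (f x * g x) \<le> norm (c * g x)"
    using assms(3) g_pos by (intro AE_I2) (fastforce simp: abs_mult intro!: mult_mono)
qed (use assms(2) in measurable)

lemma integrable_al_bounded:
  assumes "integrable M (\<lambda>x. al x * g x)" "f \<in> borel_measurable M" "\<And>x. x \<in> space M \<Longrightarrow> \<bar>f x\<bar> \<le> al x"
  shows "integrable M (\<lambda>x. f x * g x)"
proof (rule Bochner_Integration.integrable_bound[OF assms(1)])
  show "AE x in M. norm (f x * g x) \<le> norm (al x * g x)"
    using assms(3) g_pos al_nonneg by (intro AE_I2) (fastforce simp: abs_mult intro!: mult_mono)
qed (use assms(2) in measurable)

context
  assumes g_int: "integrable M g" and p_pos: "p > 0"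
begin

lemma sigma_finite: "sigma_finite_measure M"
  by (rule sigma_finite_measure_if_integrable_pos[OF g_int g_pos])

interpretation sigma_finite_measure M by (rule sigma_finite)
interpretation MM: pair_sigma_finite M M ..
interpretation MMM: pair_sigma_finite M "M \<Otimes>\<^sub>M M" ..

lemma NN_integrable:
  "i \<in> Basis \<Longrightarrow> j \<in> Basis \<Longrightarrow> integrable M (\<lambda>x. (i \<bullet> N x) * (j \<bullet> N x) * g x)"
  by (rule integrable_bounded[OF g_int _ N_comp2_le]) auto

lemma NN_integral: "(LINT x|M. (i \<bullet> N x) * (j \<bullet> N x) * g x) = p * mean i j"
  using p_pos by (simp add: mean_def)

lemma s_integrable: "integrable M (\<lambda>x. s x * g x)"
  and s_integral: "(LINT x|M. s x * g x) = p * K"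
proof -
  have eq: "s x * g x = (\<Sum>i\<in>Basis. \<Sum>j\<in>Basis. mean i j * ((i \<bullet> N x) * (j \<bullet> N x) * g x))" for x
    by (simp add: s_def sum_distrib_right mult.assoc)
  show "integrable M (\<lambda>x. s x * g x)"
    unfolding eq by (intro Bochner_Integration.integrable_sum integrable_mult_right NN_integrable)
  have "(LINT x|M. s x * g x) = (\<Sum>i\<in>Basis. \<Sum>j\<in>Basis. mean i j * (p * mean i j))"
    unfolding eq by (simp add: Bochner_Integration.integral_sum NN_integrable NN_integral)
  then show "(LINT x|M. s x * g x) = p * K"
    by (simp add: K_def sum_distrib_left power2_eq_square ac_simps)
qed

text \<open>R x is the average over z of |W_x N(z)|^2 for the density \<open>g / p\<close>.\<close>

lemma R_nonneg: assumes x: "x \<in> space M" shows "0 \<le> R x"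
proof -
  have "R x = 1 / p * (\<Sum>i\<in>Basis. \<Sum>j\<in>Basis. (W x i \<bullet> W x j) * (LINT z|M. (i \<bullet> N z) * (j \<bullet> N z) * g z))"
    by (simp add: R_def mean_def sum_distrib_left ac_simps)
  also have "(\<Sum>i\<in>Basis. \<Sum>j\<in>Basis. (W x i \<bullet> W x j) * (LINT z|M. (i \<bullet> N z) * (j \<bullet> N z) * g z))
     = (LINT z|M. (\<Sum>i\<in>Basis. \<Sum>j\<in>Basis. (W x i \<bullet> W x j) * ((i \<bullet> N z) * (j \<bullet> N z) * g z)))"
    by (simp add: Bochner_Integration.integral_sum NN_integrable)
  also have "\<dots> = (LINT z|M. (W x (N z) \<bullet> W x (N z)) * g z)"
    unfolding linear_inner_expand[OF W_linear[OF x], symmetric] sum_distrib_right by (simp add: ac_simps)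
  finally have R: "R x = 1 / p * (LINT z|M. (W x (N z) \<bullet> W x (N z)) * g z)" .
  have "0 \<le> (LINT z|M. (W x (N z) \<bullet> W x (N z)) * g z)"
    using g_pos by (intro Bochner_Integration.integral_nonneg) (simp add: less_imp_le)
  then show ?thesis using p_pos unfolding R by simp
qed

definition "tg q = tau (fst q) (snd q) * g (fst q) * g (snd q)"

lemma tg_nonneg: "q \<in> space (M \<Otimes>\<^sub>M M) \<Longrightarrow> 0 \<le> tg q"
  using g_pos[of "fst q"] g_pos[of "snd q"] by (auto simp: tg_def tau_def space_pair_measure)

lemma tg_meas [measurable]: "tg \<in> borel_measurable (M \<Otimes>\<^sub>M M)"
  unfolding tg_def tau_def tan_part_def by measurable

text \<open>The square of N(y) . N(z), expanded over pairs of basis vectors, is a sum of products of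
  a function of y and a function of z; Fubini turns its integral into p^2 K.\<close>

lemma tg_integrable: "integrable (M \<Otimes>\<^sub>M M) tg"
  and tg_integral: "(LINT q|(M \<Otimes>\<^sub>M M). tg q) = p\<^sup>2 * (1 - K)"
proof -
  define h where "h q = g (fst q) * g (snd q) - (\<Sum>i\<in>Basis. \<Sum>j\<in>Basis.
      ((i \<bullet> N (fst q)) * (j \<bullet> N (fst q)) * g (fst q)) * ((i \<bullet> N (snd q)) * (j \<bullet> N (snd q)) * g
          (snd q)))" for q
  have i1: "integrable (M \<Otimes>\<^sub>M M) (\<lambda>q. g (fst q) * g (snd q))"
    by (rule MM.integrable_times[OF g_int g_int])
  have i2: "integrable (M \<Otimes>\<^sub>M M) (\<lambda>q. ((i \<bullet> N (fst q)) * (j \<bullet> N (fst q)) * g (fst q)) * ((i \<bullet> N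
      (snd q)) * (j \<bullet> N (snd q)) * g (snd q)))"
    if "i \<in> Basis" "j \<in> Basis" for i j
    by (rule MM.integrable_times[OF NN_integrable[OF that] NN_integrable[OF that]])
  have eq: "tg q = h q" if "q \<in> space (M \<Otimes>\<^sub>M M)" for q
  proof -
    have q: "fst q \<in> space M" "snd q \<in> space M" using that by (auto simp: space_pair_measure)
    have "(N (fst q) \<bullet> N (snd q))\<^sup>2 = (\<Sum>i\<in>Basis. \<Sum>j\<in>Basis. ((i \<bullet> N (fst q)) * (i \<bullet> N (snd q))) *
        ((j \<bullet> N (fst q)) * (j \<bullet> N (snd q))))"
      unfolding power2_eq_square euclidean_inner_sum[of "N (fst q)" "N (snd q)", symmetric] by
          (rule sum_product)
    then show ?thesis
      by (simp add: tg_def h_def tau_eq[OF q] left_diff_distrib sum_distrib_right mult.assoc)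
          (simp add: ac_simps)
  qed
  have hi: "integrable (M \<Otimes>\<^sub>M M) h"
    unfolding h_def by (intro Bochner_Integration.integrable_diff
        Bochner_Integration.integrable_sum i1 i2)
  then show "integrable (M \<Otimes>\<^sub>M M) tg" by (subst Bochner_Integration.integrable_cong[OF refl eq])
  have "(LINT q|(M \<Otimes>\<^sub>M M). tg q) = (LINT q|(M \<Otimes>\<^sub>M M). h q)"
    by (rule Bochner_Integration.integral_cong[OF refl eq])
  also have "\<dots> = (LINT q|(M \<Otimes>\<^sub>M M). g (fst q) * g (snd q)) - (\<Sum>i\<in>Basis. \<Sum>j\<in>Basis. (LINT q|(M \<Otimes>\<^sub>M M).
      ((i \<bullet> N (fst q)) * (j \<bullet> N (fst q)) * g (fst q)) * ((i \<bullet> N (snd q)) * (j \<bullet> N (snd q)) * g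
          (snd q))))"
    unfolding h_def
    by (subst Bochner_Integration.integral_diff[OF i1 Bochner_Integration.integrable_sum[OF
        Bochner_Integration.integrable_sum[OF i2]]])
       (simp_all only: integral_double_sum[OF i2])
  also have "\<dots> = p * p - (\<Sum>i\<in>Basis. \<Sum>j\<in>Basis. (p * mean i j) * (p * mean i j))"
    unfolding MM.integral_times[OF g_int g_int] p_def[symmetric]
    by (intro arg_cong2[where f="(-)"] sum.cong refl)
       (simp only: MM.integral_times[OF NN_integrable NN_integrable] NN_integral)
  also have "\<dots> = p\<^sup>2 * (1 - K)"
    by (simp add: K_def algebra_simps power2_eq_square sum_distrib_left)
  finally show "(LINT q|(M \<Otimes>\<^sub>M M). tg q) = p\<^sup>2 * (1 - K)" .
qed

definition "Phi q = (1 - al (fst q) - 2 * (opn (fst (snd q)))\<^sup>2) * g (fst q) * tg (snd q)"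

lemma rhs_eq: "rhs = (LINT q|(M \<Otimes>\<^sub>M M \<Otimes>\<^sub>M M). Phi q)"
  by (simp add: rhs_def Phi_def tg_def ac_simps)

lemma K_le_1: "K \<le> 1"
proof -
  have "0 \<le> p\<^sup>2 * (1 - K)"
    unfolding tg_integral[symmetric] by (intro Bochner_Integration.integral_nonneg tg_nonneg)
  then show ?thesis using p_pos by (simp add: zero_le_mult_iff)
qed

text \<open>Here N is constant up to sign almost everywhere, so all integrands vanish.\<close>

lemma case_degenerate:
  assumes K: "K = 1"
  shows "\<exists>v\<in>sphere 0 1. \<exists>w\<in>sphere 0 1. good_pair v w"
proof -
  have "(LINT q|(M \<Otimes>\<^sub>M M). tg q) = 0" by (simp add: tg_integral K)
  then have tg0: "AE q in M \<Otimes>\<^sub>M M. tg q = 0"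
    using integral_nonneg_eq_0_iff_AE[OF tg_integrable] tg_nonneg by (auto intro: AE_I2)
  have rhs0: "rhs = 0"
  proof (cases "integrable (M \<Otimes>\<^sub>M M \<Otimes>\<^sub>M M) Phi")
    \<comment> \<open>By Fubini it is enough that the integral over (y, z) vanishes for each x,
      which follows from tg = 0 almost everywhere.\<close>
    case True
    have "(LINT q|(M \<Otimes>\<^sub>M M). Phi (x, q)) = 0" for x
      by (rule integral_eq_zero_AE) (use tg0 in \<open>auto simp: Phi_def\<close>)
    then show ?thesis unfolding rhs_eq MMM.integral_fst'[OF True, symmetric] by simp
  qed (simp add: rhs_eq not_integrable_integral_eq)
  \<comment> \<open>The squared distance of the matrix of products of components of N x from its
    mean. Its weighted integral is p (1 - K) = 0, so every component of N N^T equals its mean almost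
    everywhere.\<close>
  define F where "F x = (\<Sum>i\<in>Basis. \<Sum>j\<in>Basis. ((i \<bullet> N x) * (j \<bullet> N x) - mean i j)\<^sup>2)" for x
  have F: "F x = 1 - 2 * s x + K" if x: "x \<in> space M" for x
  proof -
    have "((i \<bullet> N x) * (j \<bullet> N x) - mean i j)\<^sup>2 = (i \<bullet> N x)\<^sup>2 * (j \<bullet> N x)\<^sup>2
        - 2 * (mean i j * ((i \<bullet> N x) * (j \<bullet> N x))) + (mean i j)\<^sup>2" for i j
      by (simp add: power2_eq_square algebra_simps)
    then have "F x = (\<Sum>i\<in>Basis. (i \<bullet> N x)\<^sup>2) * (\<Sum>j\<in>Basis. (j \<bullet> N x)\<^sup>2) - 2 * s x + K"
      unfolding F_def s_def K_def
      by (simp only: sum.distrib sum_subtractf sum_distrib_left[symmetric] sum_distrib_right[symmetric])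
    then show ?thesis by (simp add: sum_N_sq[OF x])
  qed
  have eq: "F x * g x = g x - 2 * (s x * g x) + K * g x" if "x \<in> space M" for x
    by (simp add: F[OF that] algebra_simps)
  have Fi: "integrable M (\<lambda>x. F x * g x)"
    by (subst Bochner_Integration.integrable_cong[OF refl eq])
       (auto intro!: Bochner_Integration.integrable_add Bochner_Integration.integrable_diff
           integrable_mult_right g_int s_integrable)
  have "(LINT x|M. F x * g x) = (LINT x|M. g x - 2 * (s x * g x) + K * g x)"
    by (rule Bochner_Integration.integral_cong[OF refl eq])
  also have "\<dots> = p - 2 * (p * K) + K * p"
    by (simp add: g_int s_integrable s_integral p_def[symmetric])
  finally have "(LINT x|M. F x * g x) = 0" by (simp add: K)
  moreover have "AE x in M. 0 \<le> F x * g x"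
    using g_pos by (intro AE_I2 mult_nonneg_nonneg) (auto simp: F_def less_imp_le intro!: sum_nonneg)
  ultimately have "AE x in M. F x * g x = 0"
    using integral_nonneg_eq_0_iff_AE[OF Fi] by simp
  obtain i :: 'b where i: "i \<in> Basis" using nonempty_Basis by blast
  have "AE x in M. Q (mean i i) i i x * g x = 0"
    using \<open>AE x in M. F x * g x = 0\<close>
  proof (rule AE_mp, intro AE_I2 impI)
    fix x assume x: "x \<in> space M" and "F x * g x = 0"
    then have "F x = 0" using g_pos[OF x] by simp
    then have "\<forall>i\<in>Basis. (\<Sum>j\<in>Basis. ((i \<bullet> N x) * (j \<bullet> N x) - mean i j)\<^sup>2) = 0"
      unfolding F_def by (subst (asm) sum_nonneg_eq_0_iff) (auto intro!: sum_nonneg)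
    then have "((i \<bullet> N x) * (i \<bullet> N x) - mean i i)\<^sup>2 = 0"
      using i by (subst (asm) sum_nonneg_eq_0_iff) auto
    then show "Q (mean i i) i i x * g x = 0" by (simp add: Q_def)
  qed
  then have "(LINT x|M. Q (mean i i) i i x * g x) = 0" by (rule integral_eq_zero_AE)
  then show ?thesis using i by (intro good_pairI[of i i]) (auto simp: good_pair_def rhs0)
qed

lemma case_curvature_not_integrable:
  assumes K: "K \<noteq> 1" and al: "\<not> integrable M (\<lambda>x. al x * g x)"
  shows "\<exists>v\<in>sphere 0 1. \<exists>w\<in>sphere 0 1. good_pair v w"
proof -
  have K1: "1 - K > 0" using K K_le_1 by simp
  have "\<not> integrable (M \<Otimes>\<^sub>M M \<Otimes>\<^sub>M M) Phi"
  proof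
    assume "integrable (M \<Otimes>\<^sub>M M \<Otimes>\<^sub>M M) Phi"
    \<comment> \<open>The difference is (al + 2 opn^2) g tg, whose summands are nonnegative; it
      therefore dominates al g tg.\<close>
    then have "integrable (M \<Otimes>\<^sub>M M \<Otimes>\<^sub>M M) (\<lambda>q. g (fst q) * tg (snd q) - Phi q)"
      by (intro Bochner_Integration.integrable_diff MMM.integrable_times g_int tg_integrable)
    then have "integrable (M \<Otimes>\<^sub>M M \<Otimes>\<^sub>M M) (\<lambda>q. al (fst q) * g (fst q) * tg (snd q))"
    proof (rule Bochner_Integration.integrable_bound)
      show "AE q in M \<Otimes>\<^sub>M M \<Otimes>\<^sub>M M. norm (al (fst q) * g (fst q) * tg (snd q)) \<le> norm (g (fst q) *
          tg (snd q) - Phi q)"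
      proof (rule AE_I2)
        fix q assume "q \<in> space (M \<Otimes>\<^sub>M M \<Otimes>\<^sub>M M)"
        then have q: "fst q \<in> space M" "snd q \<in> space (M \<Otimes>\<^sub>M M)" by (auto simp: space_pair_measure)
        define c where "c = g (fst q) * tg (snd q)"
        have c: "0 \<le> c" using g_pos[OF q(1)] tg_nonneg[OF q(2)] by (simp add: c_def)
        have e1: "g (fst q) * tg (snd q) - Phi q = (al (fst q) + 2 * (opn (fst (snd q)))\<^sup>2) * c"
          by (simp add: Phi_def c_def algebra_simps)
        have e2: "al (fst q) * g (fst q) * tg (snd q) = al (fst q) * c" by (simp only: c_def mult.assoc)
        show "norm (al (fst q) * g (fst q) * tg (snd q)) \<le> norm (g (fst q) * tg (snd q) - Phi q)"
          unfolding e1 e2 using c al_nonneg[of "fst q"] by (simp add: abs_mult mult_right_mono)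
      qed
    qed measurable
    then have "integrable (M \<Otimes>\<^sub>M M \<Otimes>\<^sub>M M) (case_prod (\<lambda>x q. al x * g x * tg q))"
      by (simp add: case_prod_unfold)
    \<comment> \<open>For almost every q = (y, z) the section \<open>al x * g x * tg q\<close> is
      integrable in x. As al g is not integrable, tg q must be 0, against K < 1.\<close>
    from MMM.AE_integrable_snd[OF this]
    have "AE q in M \<Otimes>\<^sub>M M. tg q = 0"
      by (rule AE_mp) (use al in \<open>auto intro!: AE_I2\<close>)
    then have "(LINT q|(M \<Otimes>\<^sub>M M). tg q) = 0" by (rule integral_eq_zero_AE)
    then show False using K1 p_pos by (simp add: tg_integral)
  qed
  then have rhs0: "rhs = 0" by (simp add: rhs_eq not_integrable_integral_eq)
  have "\<exists>i\<in>Basis. \<exists>j\<in>Basis. \<not> integrable M (\<lambda>x. Q (mean i j) i j x * g x)"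
  proof (rule ccontr)
    assume "\<not> ?thesis"
    \<comment> \<open>By \<open>sum_Q\<close> this combination is (1 - K) al g + 2 R g, and R is
      nonnegative, so it dominates its first summand.\<close>
    then have "integrable M (\<lambda>x. g x - 2 * (s x * g x) + K * g x - (\<Sum>i\<in>Basis. \<Sum>j\<in>Basis. Q (mean i
        j) i j x * g x))"
      by (intro Bochner_Integration.integrable_add Bochner_Integration.integrable_diff
          Bochner_Integration.integrable_sum integrable_mult_right g_int s_integrable) auto
    then have "integrable M (\<lambda>x. (1 - K) * (al x * g x))"
    proof (rule Bochner_Integration.integrable_bound)
      show "AE x in M. norm ((1 - K) * (al x * g x)) \<le> norm (g x - 2 * (s x * g x) + K * g x -
          (\<Sum>i\<in>Basis. \<Sum>j\<in>Basis. Q (mean i j) i j x * g x))"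
      proof (rule AE_I2)
        fix x assume x: "x \<in> space M"
        have "g x - 2 * (s x * g x) + K * g x - (\<Sum>i\<in>Basis. \<Sum>j\<in>Basis. Q (mean i j) i j x * g x)
            = (1 - K) * (al x * g x) + 2 * (R x * g x)"
          unfolding sum_distrib_right[symmetric] sum_Q[OF x] by (simp add: algebra_simps)
        moreover have "0 \<le> (1 - K) * (al x * g x)" "0 \<le> R x * g x"
          using K1 al_nonneg[of x] g_pos[OF x] R_nonneg[OF x] by simp_all
        ultimately show "norm ((1 - K) * (al x * g x)) \<le> norm (g x - 2 * (s x * g x) + K * g x -
            (\<Sum>i\<in>Basis. \<Sum>j\<in>Basis. Q (mean i j) i j x * g x))"
          by simp
      qed
    qed measurable
    then show False using al K1 by simp
  qed
  then obtain i j :: 'b where ij: "i \<in> Basis" "j \<in> Basis" "\<not> integrable M (\<lambda>x. Q (mean i j) i j x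
      * g x)" by blast
  then show ?thesis
    by (intro good_pairI[of i j]) (auto simp: good_pair_def rhs0 not_integrable_integral_eq)
qed

lemma case_integrable:
  assumes al: "integrable M (\<lambda>x. al x * g x)"
  shows "\<exists>v\<in>sphere 0 1. \<exists>w\<in>sphere 0 1. good_pair v w"
proof -
  define A where "A = (LINT x|M. al x * g x)"
  define RI where "RI = (LINT x|M. R x * g x)"
  have Wi: "integrable M (\<lambda>x. (W x i \<bullet> W x j) * g x)" if "i \<in> Basis" "j \<in> Basis" for i j
    by (rule integrable_al_bounded[OF al _ W_inner_le]) (use that in auto)
  have Req: "R x * g x = (\<Sum>i\<in>Basis. \<Sum>j\<in>Basis. mean i j * ((W x i \<bullet> W x j) * g x))" for x
    by (simp add: R_def sum_distrib_right mult.assoc)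
  have Ri: "integrable M (\<lambda>x. R x * g x)"
    unfolding Req by (intro Bochner_Integration.integrable_sum integrable_mult_right Wi)
  have RI: "RI = (\<Sum>i\<in>Basis. \<Sum>j\<in>Basis. mean i j * (LINT x|M. (W x i \<bullet> W x j) * g x))"
    unfolding RI_def Req by (subst integral_double_sum) (auto intro: integrable_mult_right Wi)
  have Qi: "integrable M (\<lambda>x. Q m i j x * g x)" if ij: "i \<in> Basis" "j \<in> Basis" for m i j
  proof -
    define a where "a x = (i \<bullet> N x) * (j \<bullet> N x)" for x
    have [measurable]: "a \<in> borel_measurable M" unfolding a_def by measurable
    have a1: "\<bar>a x\<bar> \<le> 1" if "x \<in> space M" for x using N_comp2_le[OF that ij] by (simp add: a_def)
    have aa: "\<bar>a x * a x\<bar> \<le> 1" if "x \<in> space M" for x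
      using a1[OF that] unfolding abs_mult by (intro mult_le_one) auto
    have i1: "integrable M (\<lambda>x. (a x * a x) * g x)" by (rule integrable_bounded[OF g_int _ aa]) auto
    have i2: "integrable M (\<lambda>x. (al x * (a x * a x)) * g x)"
    proof (rule integrable_al_bounded[OF al])
      show "\<bar>al x * (a x * a x)\<bar> \<le> al x" if "x \<in> space M" for x
        using mult_left_mono[OF aa[OF that] al_nonneg[of x]] al_nonneg[of x] by (simp add: abs_mult)
    qed auto
    have i3: "integrable M (\<lambda>x. (a x * (W x i \<bullet> W x j)) * g x)"
    proof (rule integrable_al_bounded[OF al])
      show "\<bar>a x * (W x i \<bullet> W x j)\<bar> \<le> al x" if "x \<in> space M" for x
        using mult_mono[OF a1[OF that] W_inner_le[OF ij, of x]] by (simp add: abs_mult)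
    qed auto
    have i4: "integrable M (\<lambda>x. a x * g x)" by (rule integrable_bounded[OF g_int _ a1]) auto
    have "Q m i j x * g x = (a x * a x) * g x - (al x * (a x * a x)) * g x + 2 * ((a x * (W x i \<bullet>
        W x j)) * g x)
       - 2 * m * (a x * g x) - 2 * m * ((W x i \<bullet> W x j) * g x) + m\<^sup>2 * (al x * g x) + m\<^sup>2 * g x" for x
      unfolding Q_def a_def[symmetric] by (simp add: algebra_simps power2_eq_square)
    then show ?thesis
      by (simp only:) (intro Bochner_Integration.integrable_add Bochner_Integration.integrable_diff
          integrable_mult_right i1 i2 i3 i4 Wi ij al g_int)
  qed
  have lhs: "(\<Sum>i\<in>Basis. \<Sum>j\<in>Basis. (LINT x|M. Q (mean i j) i j x * g x)) = (1 - K) * (p - A) - 2 * RI"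
  proof -
    have "(\<Sum>i\<in>Basis. \<Sum>j\<in>Basis. (LINT x|M. Q (mean i j) i j x * g x))
        = (LINT x|M. (\<Sum>i\<in>Basis. \<Sum>j\<in>Basis. Q (mean i j) i j x * g x))"
      by (rule integral_double_sum[symmetric, OF Qi])
    also have "\<dots> = (LINT x|M. g x - 2 * (s x * g x) + K * g x - (1 - K) * (al x * g x) - 2 * (R x
        * g x))"
    proof (rule Bochner_Integration.integral_cong[OF refl])
      fix x assume "x \<in> space M"
      then show "(\<Sum>i\<in>Basis. \<Sum>j\<in>Basis. Q (mean i j) i j x * g x) = g x - 2 * (s x * g x) + K * g x
          - (1 - K) * (al x * g x) - 2 * (R x * g x)"
        unfolding sum_distrib_right[symmetric] sum_Q[OF \<open>x \<in> space M\<close>] by (simp add: algebra_simps)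
    qed
    also have "\<dots> = p - 2 * (p * K) + K * p - (1 - K) * A - 2 * RI"
      by (simp add: g_int s_integrable al Ri s_integral p_def[symmetric] A_def[symmetric]
          RI_def[symmetric])
    finally show ?thesis by (simp add: algebra_simps)
  qed
  define ot where "ot q = (opn (fst q))\<^sup>2 * tg q" for q
  have opn_int: "integrable M (\<lambda>x. (opn x)\<^sup>2 * g x)"
    by (rule integrable_al_bounded[OF al]) (use opn_sq in \<open>auto simp: al_def\<close>)
  have ot_int: "integrable (M \<Otimes>\<^sub>M M) ot"
  proof (rule Bochner_Integration.integrable_bound[OF MM.integrable_times[OF opn_int g_int]])
    show "ot \<in> borel_measurable (M \<Otimes>\<^sub>M M)" unfolding ot_def by measurable
    show "AE q in M \<Otimes>\<^sub>M M. norm (ot q) \<le> norm ((opn (fst q))\<^sup>2 * g (fst q) * g (snd q))"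
    proof (rule AE_I2)
      fix q assume "q \<in> space (M \<Otimes>\<^sub>M M)"
      then have q: "fst q \<in> space M" "snd q \<in> space M" by (auto simp: space_pair_measure)
      have "tau (fst q) (snd q) \<le> 1" by (simp add: tau_eq[OF q])
      moreover have "0 \<le> tau (fst q) (snd q)" by (simp add: tau_def)
      moreover define c where "c = (opn (fst q))\<^sup>2 * g (fst q) * g (snd q)"
      moreover have "0 \<le> c" using g_pos[OF q(1)] g_pos[OF q(2)] by (simp add: c_def)
      ultimately have "tau (fst q) (snd q) * c \<le> c" "0 \<le> tau (fst q) (snd q) * c"
        by (simp_all add: mult_left_le_one_le)
      moreover have "ot q = tau (fst q) (snd q) * c" by (simp add: ot_def tg_def c_def ac_simps)
      ultimately show "norm (ot q) \<le> norm ((opn (fst q))\<^sup>2 * g (fst q) * g (snd q))"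
        by (simp add: c_def[symmetric])
    qed
  qed
  define S where "S = (LINT q|(M \<Otimes>\<^sub>M M). ot q)"
  have S: "p * RI \<le> S"
  proof -
    \<comment> \<open>Expanding N(z) in the basis separates y from z, so p RI is the double integral
      of |W_y N(z)|^2 g g. Bounding this by the operator norm is the only loss between the summed
      left-hand side and the right-hand side.\<close>
    define h where "h i j q = ((W (fst q) i \<bullet> W (fst q) j) * g (fst q)) * ((i \<bullet> N (snd q)) * (j \<bullet>
        N (snd q)) * g (snd q))" for i j q
    have hi: "integrable (M \<Otimes>\<^sub>M M) (h i j)" if "i \<in> Basis" "j \<in> Basis" for i j
      unfolding h_def by (intro MM.integrable_times Wi NN_integrable that)
    have "(LINT q|(M \<Otimes>\<^sub>M M). (\<Sum>i\<in>Basis. \<Sum>j\<in>Basis. h i j q)) = (\<Sum>i\<in>Basis. \<Sum>j\<in>Basis. (LINT q|(M \<Otimes>\<^sub>M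
        M). h i j q))"
      by (rule integral_double_sum[OF hi])
    also have "\<dots> = (\<Sum>i\<in>Basis. \<Sum>j\<in>Basis. (LINT x|M. (W x i \<bullet> W x j) * g x) * (p * mean i j))"
      by (intro sum.cong refl) (simp only: h_def MM.integral_times[OF Wi NN_integrable] NN_integral)
    also have "\<dots> = p * RI" by (simp add: RI sum_distrib_left ac_simps)
    finally have "p * RI = (LINT q|(M \<Otimes>\<^sub>M M). (\<Sum>i\<in>Basis. \<Sum>j\<in>Basis. h i j q))" by simp
    also have "\<dots> \<le> S"
      unfolding S_def
    proof (rule integral_mono)
      show "integrable (M \<Otimes>\<^sub>M M) (\<lambda>q. \<Sum>i\<in>Basis. \<Sum>j\<in>Basis. h i j q)"
        by (intro Bochner_Integration.integrable_sum hi)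
      fix q assume "q \<in> space (M \<Otimes>\<^sub>M M)"
      then have q: "fst q \<in> space M" "snd q \<in> space M" by (auto simp: space_pair_measure)
      define y z where "y = fst q" and "z = snd q"
      have yz: "y \<in> space M" "z \<in> space M" using q by (auto simp: y_def z_def)
      have "(\<Sum>i\<in>Basis. \<Sum>j\<in>Basis. h i j q) = (W y (N z) \<bullet> W y (N z)) * (g y * g z)"
        unfolding linear_inner_expand[OF W_linear[OF yz(1)], symmetric] sum_distrib_right
        by (intro sum.cong refl) (simp add: h_def y_def z_def ac_simps)
      also have "\<dots> \<le> ((opn y)\<^sup>2 * tau y z) * (g y * g z)"
      proof (rule mult_right_mono)
        have "(norm (W y (N z)))\<^sup>2 \<le> (opn y * norm (tan_part (N y) (N z)))\<^sup>2"
          by (rule power_mono[OF W_opn[OF yz(1)]]) simp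
        then show "W y (N z) \<bullet> W y (N z) \<le> (opn y)\<^sup>2 * tau y z"
          by (simp add: tau_def power_mult_distrib power2_norm_eq_inner)
      qed (use g_pos yz in \<open>auto simp: less_imp_le\<close>)
      also have "\<dots> = ot q" by (simp add: ot_def tg_def y_def z_def ac_simps)
      finally show "(\<Sum>i\<in>Basis. \<Sum>j\<in>Basis. h i j q) \<le> ot q" .
    qed (rule ot_int)
    finally show ?thesis .
  qed
  have ai: "integrable M (\<lambda>x. g x - al x * g x)" by (intro Bochner_Integration.integrable_diff g_int al)
  have Phi_eq: "Phi q = (g (fst q) - al (fst q) * g (fst q)) * tg (snd q) - 2 * (g (fst q) * ot
      (snd q))" for q
    by (simp add: Phi_def ot_def algebra_simps)
  have "rhs = (LINT q|(M \<Otimes>\<^sub>M M \<Otimes>\<^sub>M M). (g (fst q) - al (fst q) * g (fst q)) * tg (snd q))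
      - 2 * (LINT q|(M \<Otimes>\<^sub>M M \<Otimes>\<^sub>M M). g (fst q) * ot (snd q))"
    unfolding rhs_eq Phi_eq
    by (subst Bochner_Integration.integral_diff) (auto intro: integrable_mult_right
        MMM.integrable_times ai tg_integrable g_int ot_int)
  also have "\<dots> = (p - A) * (p\<^sup>2 * (1 - K)) - 2 * (p * S)"
    unfolding MMM.integral_times[OF ai tg_integrable] MMM.integral_times[OF g_int ot_int]
    by (simp add: tg_integral S_def[symmetric] p_def[symmetric] A_def[symmetric] g_int al)
  finally have rhs: "1 / p\<^sup>2 * rhs = (1 - K) * (p - A) - 2 * (S / p)"
    using p_pos by (simp add: field_simps power2_eq_square)
  have "RI \<le> S / p" using S p_pos by (simp add: field_simps)
  then have le: "1 / p\<^sup>2 * rhs \<le> (\<Sum>i\<in>Basis. \<Sum>j\<in>Basis. (LINT x|M. Q (mean i j) i j x * g x))"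
    unfolding rhs lhs by simp
  \<comment> \<open>If each of the \<open>DIM('b)\<close> squared pairs fell short of its equal
    share of the right-hand side, so would their sum.\<close>
  have "\<exists>i\<in>Basis. \<exists>j\<in>Basis. good_pair i j"
  proof (rule ccontr)
    assume no: "\<not> (\<exists>i\<in>Basis. \<exists>j\<in>Basis. good_pair i j)"
    have lt: "(LINT x|M. Q (mean i j) i j x * g x) < 1 / p\<^sup>2 * rhs / (real DIM('b))\<^sup>2" if "i \<in>
        Basis" "j \<in> Basis" for i j
    proof -
      have "\<not> good_pair i j" using no that by blast
      then show ?thesis unfolding good_pair_def not_le by (subst pos_less_divide_eq) (simp_all
          add: mult.commute)
    qed
    have "(\<Sum>i\<in>Basis. \<Sum>j\<in>Basis. (LINT x|M. Q (mean i j) i j x * g x))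
        < (\<Sum>i\<in>(Basis::'b set). \<Sum>j\<in>(Basis::'b set). 1 / p\<^sup>2 * rhs / (real DIM('b))\<^sup>2)"
      by (intro sum_strict_mono lt) auto
    also have "\<dots> = 1 / p\<^sup>2 * rhs" by (simp add: power2_eq_square)
    finally show False using le by simp
  qed
  then show ?thesis using good_pairI by (metis norm_Basis)
qed

end

proposition exists_directions: "\<exists>v\<in>sphere 0 1. \<exists>w\<in>sphere 0 1. good_pair v w"
proof (cases "integrable M g")
  case True
  have p0: "0 \<le> p" unfolding p_def using g_pos by (intro Bochner_Integration.integral_nonneg)
      (simp add: less_imp_le)
  show ?thesis
  proof (cases "p = 0")
    case True
    \<comment> \<open>A positive weight with integral 0 means a null measure, as for the empty
      hypersurface.\<close>
    have "AE x in M. g x = 0"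
      using integral_nonneg_eq_0_iff_AE[OF \<open>integrable M g\<close>] g_pos True by (auto simp: p_def
          less_imp_le intro: AE_I2)
    then have z: "(LINT x|M. Q m v w x * g x) = 0" for m v w
      by (intro integral_eq_zero_AE) auto
    obtain i :: 'b where i: "i \<in> Basis" using nonempty_Basis by blast
    then show ?thesis by (intro good_pairI[of i i]) (auto simp: good_pair_def True z)
  next
    case False
    then show ?thesis
      using p0 True case_degenerate case_curvature_not_integrable case_integrable by fastforce
  qed
qed (rule case_infinite)

end

section \<open>Measurability\<close>

lemma space_surface_measure [simp]: "space (surface_measure S) = S"
  by (simp add: surface_measure_def space_restrict_space)

lemma sets_surface_measure: "sets (surface_measure S) = sets (restrict_space borel S)"
  unfolding surface_measure_def by (rule sets_restrict_space_cong) simp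

lemma borel_measurable_surface_measure:
  fixes f :: "'a::euclidean_space \<Rightarrow> 'b::topological_space"
  assumes "continuous_on S f" shows "f \<in> borel_measurable (surface_measure S)"
  using borel_measurable_continuous_on_restrict[OF assms]
  by (simp cong: measurable_cong_sets add: sets_surface_measure)

context oriented_hypersurface begin

lemma normal_continuous: "continuous_on S N"
proof -
  have "continuous (at x within S) N" if x: "x \<in> S" for x
  proof -
    obtain U V where U: "x \<in> U" "normal_ext U V" using normal_ext_exists[OF x] by blast
    have o: "open U" by (rule ext_open[OF U(2)])
    have "continuous_on (S \<inter> U) V"
      using C_on_continuous_on[OF ext_C1[OF U(2)]] by (rule continuous_on_subset) auto
    then have "continuous_on (S \<inter> U) N"
      by (rule continuous_on_eq) (use ext_eq[OF U(2)] in auto)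
    moreover have "at x within S = at x within (S \<inter> U)"
      using U(1) o by (rule at_within_nhd) auto
    ultimately show ?thesis
      using U(1) x by (auto simp: continuous_on_eq_continuous_within)
  qed
  then show ?thesis by (simp add: continuous_on_eq_continuous_within)
qed

text \<open>A supremum of continuous functions is lower semicontinuous.\<close>

lemma opnorm_measurable: "second_ff_opnorm S N \<in> borel_measurable (surface_measure S)"
  unfolding borel_measurable_iff_greater
proof
  fix a :: real
  let ?G = "\<Union>u\<in>cball 0 1. S \<inter> (\<lambda>x. norm (shape_op S N x u)) -` {a<..}"
  have "{x \<in> space (surface_measure S). a < second_ff_opnorm S N x} = ?G"
  proof -
    have "a < second_ff_opnorm S N x \<longleftrightarrow> (\<exists>u\<in>cball 0 1. a < norm (shape_op S N x u))" if "x \<in> S" for x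
      unfolding second_ff_opnorm_eq[OF that] by (rule less_cSUP_iff[OF _ shape_bdd[OF that]]) simp
    then show ?thesis unfolding space_surface_measure by blast
  qed
  moreover have "openin (top_of_set S) ?G"
    by (intro openin_Union ballI) (auto intro!: continuous_openin_preimage_gen continuous_on_norm
        shape_continuous)
  then obtain T where "open T" "?G = S \<inter> T" by (auto simp: openin_open)
  ultimately show "{x \<in> space (surface_measure S). a < second_ff_opnorm S N x} \<in> sets
      (surface_measure S)"
    by (auto simp: sets_surface_measure sets_restrict_space)
qed

lemma normal_data: "normal_data (surface_measure S) (gauss n) N (shape_op S N) (second_ff_opnorm S N)"
proof (rule normal_data.intro)
  show "gauss n \<in> borel_measurable (surface_measure S)"
    unfolding gauss_def by (intro borel_measurable_surface_measure continuous_intros) auto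
  show "N \<in> borel_measurable (surface_measure S)"
    by (intro borel_measurable_surface_measure normal_continuous)
  show "(\<lambda>x. shape_op S N x u) \<in> borel_measurable (surface_measure S)" for u
    by (intro borel_measurable_surface_measure shape_continuous)
  show "second_ff_opnorm S N \<in> borel_measurable (surface_measure S)"
    by (rule opnorm_measurable)
  show "0 < gauss n x" for x :: 'a by (simp add: gauss_def)
qed (auto simp: normal_unit shape_linear shape_opnorm_le opnorm_sq_le second_ff_norm_sq_eq[symmetric])

end

theorem theorem1p9:
  fixes \<Sigma> :: "'a::euclidean_space set" and N :: "'a \<Rightarrow> 'a" and n :: nat and lam :: real
  assumes "DIM('a) = n + 1"
    and "smooth_hypersurface \<Sigma>"
    and "unit_normal_field \<Sigma> N"
    and "\<forall>x\<in>\<Sigma>. mean_curvature \<Sigma> N x = x \<bullet> N x + lam"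
  shows "let \<sigma> = surface_measure \<Sigma>; p = (LINT x|\<sigma>. gauss n x) in
    \<exists>v\<in>sphere 0 1. \<exists>w\<in>sphere 0 1.
      let m = 1 / p * (LINT y|\<sigma>. (v \<bullet> N y) * (w \<bullet> N y) * gauss n y);
          f = (\<lambda>x. (v \<bullet> N x) * (w \<bullet> N x) - m)
      in (real n + 1)\<^sup>2 * (LINT x|\<sigma>. f x * L_op \<Sigma> N f x * gauss n x)
         \<ge> 1 / p\<^sup>2 * (LINT (x, y, z)|(\<sigma> \<Otimes>\<^sub>M \<sigma> \<Otimes>\<^sub>M \<sigma>).
              (1 - second_ff_norm_sq \<Sigma> N x - 2 * (second_ff_opnorm \<Sigma> N y)\<^sup>2)
              * (norm (tangent_proj \<Sigma> y (N z)))\<^sup>2 * gauss n x * gauss n y * gauss n z)"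
proof -
  interpret oriented_hypersurface \<Sigma> N by standard (rule assms)+
  interpret normal_data "surface_measure \<Sigma>" "gauss n" N "shape_op \<Sigma> N" "second_ff_opnorm \<Sigma> N"
    by (rule normal_data)
  let ?M = "surface_measure \<Sigma>"
  have al: "al x = second_ff_norm_sq \<Sigma> N x" if "x \<in> \<Sigma>" for x
    using that by (simp add: al_def second_ff_norm_sq_eq)
  have Q: "Q m v w x = ((v \<bullet> N x) * (w \<bullet> N x) - m) * L_op \<Sigma> N (\<lambda>x. (v \<bullet> N x) * (w \<bullet> N x) - m) x"
    if "x \<in> \<Sigma>" for m v w x
    using that assms(4) by (subst L_op_product[of lam]) (auto simp: Q_def al)
  have lhs: "(LINT x|?M. Q m v w x * gauss n x) = (LINT x|?M. ((v \<bullet> N x) * (w \<bullet> N x) - m) *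
      L_op \<Sigma> N (\<lambda>x. (v \<bullet> N x) * (w \<bullet> N x) - m) x * gauss n x)" for m v w
    by (intro Bochner_Integration.integral_cong refl) (simp add: Q)
  have rhs: "rhs = (LINT (x, y, z)|(?M \<Otimes>\<^sub>M ?M \<Otimes>\<^sub>M ?M).
              (1 - second_ff_norm_sq \<Sigma> N x - 2 * (second_ff_opnorm \<Sigma> N y)\<^sup>2)
              * (norm (tangent_proj \<Sigma> y (N z)))\<^sup>2 * gauss n x * gauss n y * gauss n z)"
    unfolding rhs_def
    by (intro Bochner_Integration.integral_cong refl)
       (auto simp: space_pair_measure al tau_def tangent_proj_eq)
  have dim: "real DIM('a) = real n + 1" using assms(1) by simp
  show ?thesis
    using exists_directions unfolding good_pair_def mean_def p_def lhs rhs dim Let_def .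
qed

end
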